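(* Let $k$ be a commutative ring and let $H$ be a monoidal $k$-prebialgebra (that is, a prebialgebra satisfying (lm) and (rm)). Then $({}_H\mathcal{M},\otimes^l,H_L^*,a,l,r)$ is a monoidal category, where ${}_H\mathcal{M}$ is the category of left $H$-modules, $\otimes^l$ is the tensor product, $H_L^*$ the unit object, $a$ the associativity constraint, and $l,r$ the left and right unit constraints described in the context.
   Context: Conventions. $k$ is a commutative ring and $\otimes=\otimes_k$. A $k$-prebialgebra is a $k$-module $H$ that is both an associative unital $k$-algebra (unit $1$) and a coassociative counital $k$-coalgebra (comultiplication $\Delta$, counit $\varepsilon$) such that $\Delta(hk)=\Delta(h)\Delta(k)$ for all $h,k\in H$; it is not required that $\Delta(1)=1\otimes 1$ nor that $\varepsilon$ is multiplicative. Sweedler notation: $\Delta(h)=h_{(1)}\otimes h_{(2)}$, $\Delta(1)=1_{(1)}\otimes 1_{(2)}$. $H$ is monoidal if for all $h,k,l\in H$: (lm) $\varepsilon(hkl)=\varepsilon(hk_{(1)})\varepsilon(k_{(2)}l)$; (rm) $\varepsilon(hkl)=\varepsilon(hk_{(2)})\varepsilon(k_{(1)}l)$. Let $H^*=\mathrm{Hom}_k(H,k)$. Define $f,f':H^*\to H$ by $f(h^* )=\langle h^*,1_{(1)}\rangle 1_{(2)}$, $f'(h^* )=\langle h^*,1_{(2)}\rangle 1_{(1)}$, and $g:H\to H^*$ by $g(h)=\langle\varepsilon,-h\rangle$. Put $H_L^*=\mathrm{Im}(g)\subset H^*$, a left $H$-module via $k\cdot g(h)=g(kh)$. For left $H$-modules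 $M,N$, $M\otimes N$ carries the associative but in general non-unital action $h\cdot(m\otimes n)=h_{(1)}m\otimes h_{(2)}n$, and $M\otimes^l N:=1\cdot(M\otimes N)\subset M\otimes N$, which is a unital left $H$-module under this action. On morphisms $\otimes^l$ is the restriction of $\otimes$. The associativity constraint $a$ is induced by that of the category of $k$-modules. The left unit constraint $l_M:H_L^*\otimes^l M\to M$ is the restriction of the map $H_L^*\otimes M\to M$, $\varphi\otimes m\mapsto f(\varphi)m$, and the right unit constraint $r_M:M\otimes^l H_L^*\to M$ is the restriction of the map $M\otimes H_L^*\to M$, $m\otimes\varphi\mapsto f'(\varphi)m$. *)

theory Defs
  imports "HOL-Algebra.Module" "HOL-Algebra.AbelCoset" "HOL-Library.FSet" "HOL-Library.FuncSet"
begin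

section \<open>Monoidal categories\<close>

text \<open>Hom-sets carry their source and target as indices and need not be disjoint, so all the
  structure on morphisms is indexed by objects: \<open>Comp A B C g f\<close> is the composite of
  \<open>f \<in> Hom A B\<close> and \<open>g \<in> Hom B C\<close>.\<close>

locale category =
  fixes Ob :: "'o set"
    and Hom :: "'o \<Rightarrow> 'o \<Rightarrow> 'a set"
    and Id :: "'o \<Rightarrow> 'a"
    and Comp :: "'o \<Rightarrow> 'o \<Rightarrow> 'o \<Rightarrow> 'a \<Rightarrow> 'a \<Rightarrow> 'a"
  assumes Id_in_Hom: "A \<in> Ob \<Longrightarrow> Id A \<in> Hom A A"
    and Comp_in_Hom:
      "\<lbrakk>A \<in> Ob; B \<in> Ob; C \<in> Ob; f \<in> Hom A B; g \<in> Hom B C\<rbrakk> \<Longrightarrow> Comp A B C g f \<in> Hom A C"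
    and Comp_Id_left: "\<lbrakk>A \<in> Ob; B \<in> Ob; f \<in> Hom A B\<rbrakk> \<Longrightarrow> Comp A B B (Id B) f = f"
    and Comp_Id_right: "\<lbrakk>A \<in> Ob; B \<in> Ob; f \<in> Hom A B\<rbrakk> \<Longrightarrow> Comp A A B f (Id A) = f"
    and Comp_assoc:
      "\<lbrakk>A \<in> Ob; B \<in> Ob; C \<in> Ob; D \<in> Ob; f \<in> Hom A B; g \<in> Hom B C; h \<in> Hom C D\<rbrakk>
        \<Longrightarrow> Comp A B D (Comp B C D h g) f = Comp A C D h (Comp A B C g f)"
begin

definition Iso :: "'o \<Rightarrow> 'o \<Rightarrow> 'a set"
  where "Iso A B =
    {f \<in> Hom A B. \<exists>g \<in> Hom B A. Comp A B A g f = Id A \<and> Comp B A B f g = Id B}"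

end

text \<open>For \<open>f \<in> Hom A A'\<close> and \<open>g \<in> Hom B B'\<close> the tensor product of morphisms is
  \<open>TenHom A A' B B' f g\<close>.\<close>

locale monoidal_category = category Ob Hom Id Comp
  for Ob :: "'o set"
    and Hom :: "'o \<Rightarrow> 'o \<Rightarrow> 'a set"
    and Id :: "'o \<Rightarrow> 'a"
    and Comp :: "'o \<Rightarrow> 'o \<Rightarrow> 'o \<Rightarrow> 'a \<Rightarrow> 'a \<Rightarrow> 'a" +
  fixes TenOb :: "'o \<Rightarrow> 'o \<Rightarrow> 'o"
    and TenHom :: "'o \<Rightarrow> 'o \<Rightarrow> 'o \<Rightarrow> 'o \<Rightarrow> 'a \<Rightarrow> 'a \<Rightarrow> 'a"
    and Unit :: "'o"
    and Assoc :: "'o \<Rightarrow> 'o \<Rightarrow> 'o \<Rightarrow> 'a"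
    and LUnit :: "'o \<Rightarrow> 'a"
    and RUnit :: "'o \<Rightarrow> 'a"
  assumes TenOb_in_Ob: "\<lbrakk>A \<in> Ob; B \<in> Ob\<rbrakk> \<Longrightarrow> TenOb A B \<in> Ob"
    and TenHom_in_Hom:
      "\<lbrakk>A \<in> Ob; A' \<in> Ob; B \<in> Ob; B' \<in> Ob; f \<in> Hom A A'; g \<in> Hom B B'\<rbrakk>
        \<Longrightarrow> TenHom A A' B B' f g \<in> Hom (TenOb A B) (TenOb A' B')"
    and TenHom_Id:
      "\<lbrakk>A \<in> Ob; B \<in> Ob\<rbrakk> \<Longrightarrow> TenHom A A B B (Id A) (Id B) = Id (TenOb A B)"
    and TenHom_Comp:
      "\<lbrakk>A \<in> Ob; A' \<in> Ob; A'' \<in> Ob; B \<in> Ob; B' \<in> Ob; B'' \<in> Ob;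
        f \<in> Hom A A'; f' \<in> Hom A' A''; g \<in> Hom B B'; g' \<in> Hom B' B''\<rbrakk>
        \<Longrightarrow> TenHom A A'' B B'' (Comp A A' A'' f' f) (Comp B B' B'' g' g)
          = Comp (TenOb A B) (TenOb A' B') (TenOb A'' B'')
              (TenHom A' A'' B' B'' f' g') (TenHom A A' B B' f g)"
    and Unit_in_Ob: "Unit \<in> Ob"
    and Assoc_iso:
      "\<lbrakk>A \<in> Ob; B \<in> Ob; C \<in> Ob\<rbrakk>
        \<Longrightarrow> Assoc A B C \<in> Iso (TenOb (TenOb A B) C) (TenOb A (TenOb B C))"
    and Assoc_natural:
      "\<lbrakk>A \<in> Ob; A' \<in> Ob; B \<in> Ob; B' \<in> Ob; C \<in> Ob; C' \<in> Ob;
        f \<in> Hom A A'; g \<in> Hom B B'; h \<in> Hom C C'\<rbrakk>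
        \<Longrightarrow> Comp (TenOb (TenOb A B) C) (TenOb (TenOb A' B') C') (TenOb A' (TenOb B' C'))
              (Assoc A' B' C')
              (TenHom (TenOb A B) (TenOb A' B') C C' (TenHom A A' B B' f g) h)
          = Comp (TenOb (TenOb A B) C) (TenOb A (TenOb B C)) (TenOb A' (TenOb B' C'))
              (TenHom A A' (TenOb B C) (TenOb B' C') f (TenHom B B' C C' g h))
              (Assoc A B C)"
    and LUnit_iso: "A \<in> Ob \<Longrightarrow> LUnit A \<in> Iso (TenOb Unit A) A"
    and LUnit_natural:
      "\<lbrakk>A \<in> Ob; A' \<in> Ob; f \<in> Hom A A'\<rbrakk>
        \<Longrightarrow> Comp (TenOb Unit A) (TenOb Unit A') A'
              (LUnit A') (TenHom Unit Unit A A' (Id Unit) f)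
          = Comp (TenOb Unit A) A A' f (LUnit A)"
    and RUnit_iso: "A \<in> Ob \<Longrightarrow> RUnit A \<in> Iso (TenOb A Unit) A"
    and RUnit_natural:
      "\<lbrakk>A \<in> Ob; A' \<in> Ob; f \<in> Hom A A'\<rbrakk>
        \<Longrightarrow> Comp (TenOb A Unit) (TenOb A' Unit) A'
              (RUnit A') (TenHom A A' Unit Unit f (Id Unit))
          = Comp (TenOb A Unit) A A' f (RUnit A)"
    and pentagon:
      "\<lbrakk>A \<in> Ob; B \<in> Ob; C \<in> Ob; D \<in> Ob\<rbrakk>
        \<Longrightarrow> Comp (TenOb (TenOb (TenOb A B) C) D) (TenOb (TenOb A B) (TenOb C D))
              (TenOb A (TenOb B (TenOb C D)))
              (Assoc A B (TenOb C D)) (Assoc (TenOb A B) C D)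
          = Comp (TenOb (TenOb (TenOb A B) C) D) (TenOb A (TenOb (TenOb B C) D))
              (TenOb A (TenOb B (TenOb C D)))
              (TenHom A A (TenOb (TenOb B C) D) (TenOb B (TenOb C D)) (Id A) (Assoc B C D))
              (Comp (TenOb (TenOb (TenOb A B) C) D) (TenOb (TenOb A (TenOb B C)) D)
                (TenOb A (TenOb (TenOb B C) D))
                (Assoc A (TenOb B C) D)
                (TenHom (TenOb (TenOb A B) C) (TenOb A (TenOb B C)) D D (Assoc A B C) (Id D)))"
    and triangle:
      "\<lbrakk>A \<in> Ob; B \<in> Ob\<rbrakk>
        \<Longrightarrow> Comp (TenOb (TenOb A Unit) B) (TenOb A (TenOb Unit B)) (TenOb A B)
              (TenHom A A (TenOb Unit B) B (Id A) (LUnit B)) (Assoc A Unit B)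
          = TenHom (TenOb A Unit) A B B (RUnit A) (Id B)"


section \<open>Tensor products of modules over a commutative ring\<close>

text \<open>The ring multiplication and unit in a record \<^typ>\<open>('k, 'm) module\<close> play no role for a mere
  module and are left \<^term>\<open>undefined\<close>.\<close>

definition linear_map ::
  "('k, 'r) ring_scheme \<Rightarrow> ('k, 'm, 's) module_scheme \<Rightarrow> ('k, 'n, 't) module_scheme
    \<Rightarrow> ('m \<Rightarrow> 'n) \<Rightarrow> bool"
  where "linear_map k M N f \<longleftrightarrow>
    f \<in> carrier M \<rightarrow> carrier N \<and>
    (\<forall>x \<in> carrier M. \<forall>y \<in> carrier M. f (x \<oplus>\<^bsub>M\<^esub> y) = f x \<oplus>\<^bsub>N\<^esub> f y) \<and>
    (\<forall>a \<in> carrier k. \<forall>x \<in> carrier M. f (a \<odot>\<^bsub>M\<^esub> x) = a \<odot>\<^bsub>N\<^esub> f x)"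

text \<open>The elements of \<open>linear_maps\<close> are extensional, so that equality of functions is equality of
  maps.\<close>

definition linear_maps ::
  "('k, 'r) ring_scheme \<Rightarrow> ('k, 'm, 's) module_scheme \<Rightarrow> ('k, 'n, 't) module_scheme
    \<Rightarrow> ('m \<Rightarrow> 'n) set"
  where "linear_maps k M N = {f \<in> extensional (carrier M). linear_map k M N f}"

definition self_module :: "('k, 'r) ring_scheme \<Rightarrow> ('k, 'k) module"
  where "self_module k =
    \<lparr>carrier = carrier k, mult = mult k, one = one k, zero = zero k, add = add k,
     smult = mult k\<rparr>"

definition free_module :: "('k, 'r) ring_scheme \<Rightarrow> 'b set \<Rightarrow> ('k, 'b \<Rightarrow> 'k) module"
  where "free_module k B =
    \<lparr>carrier = {c. (\<forall>b. c b \<in> carrier k) \<and> finite {b. c b \<noteq> \<zero>\<^bsub>k\<^esub>} \<and> {b. c b \<noteq> \<zero>\<^bsub>k\<^esub>} \<subseteq> B},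
     mult = undefined, one = undefined,
     zero = (\<lambda>b. \<zero>\<^bsub>k\<^esub>), add = (\<lambda>c d b. c b \<oplus>\<^bsub>k\<^esub> d b),
     smult = (\<lambda>a c b. a \<otimes>\<^bsub>k\<^esub> c b)\<rparr>"

definition free_basis :: "('k, 'r) ring_scheme \<Rightarrow> 'b \<Rightarrow> 'b \<Rightarrow> 'k"
  where "free_basis k b = (\<lambda>b'. if b' = b then \<one>\<^bsub>k\<^esub> else \<zero>\<^bsub>k\<^esub>)"

definition span_module ::
  "('k, 'r) ring_scheme \<Rightarrow> ('k, 'm, 's) module_scheme \<Rightarrow> 'm set \<Rightarrow> 'm set"
  where "span_module k M G = \<Inter>{S. submodule S k M \<and> G \<subseteq> S}"

definition quotient_module ::
  "('k, 'm, 's) module_scheme \<Rightarrow> 'm set \<Rightarrow> ('k, 'm set) module"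
  where "quotient_module M S =
    \<lparr>carrier = a_rcosets\<^bsub>M\<^esub> S, mult = undefined, one = undefined,
     zero = S, add = set_add M,
     smult = (\<lambda>a X. \<Union>x \<in> X. S +>\<^bsub>M\<^esub> (a \<odot>\<^bsub>M\<^esub> x))\<rparr>"

type_synonym ('k, 'm, 'n) tensor = "('m \<times> 'n \<Rightarrow> 'k) set"

definition tensor_relations ::
  "('k, 'r) ring_scheme \<Rightarrow> ('k, 'm, 's) module_scheme \<Rightarrow> ('k, 'n, 't) module_scheme
    \<Rightarrow> ('m \<times> 'n \<Rightarrow> 'k) set"
  where "tensor_relations k M N =
    (let F = free_module k (carrier M \<times> carrier N); \<delta> = free_basis k in
      {\<delta> (x \<oplus>\<^bsub>M\<^esub> x', y) \<ominus>\<^bsub>F\<^esub> (\<delta> (x, y) \<oplus>\<^bsub>F\<^esub> \<delta> (x', y)) | x x' y.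
         x \<in> carrier M \<and> x' \<in> carrier M \<and> y \<in> carrier N} \<union>
      {\<delta> (x, y \<oplus>\<^bsub>N\<^esub> y') \<ominus>\<^bsub>F\<^esub> (\<delta> (x, y) \<oplus>\<^bsub>F\<^esub> \<delta> (x, y')) | x y y'.
         x \<in> carrier M \<and> y \<in> carrier N \<and> y' \<in> carrier N} \<union>
      {\<delta> (a \<odot>\<^bsub>M\<^esub> x, y) \<ominus>\<^bsub>F\<^esub> a \<odot>\<^bsub>F\<^esub> \<delta> (x, y) | a x y.
         a \<in> carrier k \<and> x \<in> carrier M \<and> y \<in> carrier N} \<union>
      {\<delta> (x, a \<odot>\<^bsub>N\<^esub> y) \<ominus>\<^bsub>F\<^esub> a \<odot>\<^bsub>F\<^esub> \<delta> (x, y) | a x y.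
         a \<in> carrier k \<and> x \<in> carrier M \<and> y \<in> carrier N})"

definition tensor_kernel ::
  "('k, 'r) ring_scheme \<Rightarrow> ('k, 'm, 's) module_scheme \<Rightarrow> ('k, 'n, 't) module_scheme
    \<Rightarrow> ('m \<times> 'n \<Rightarrow> 'k) set"
  where "tensor_kernel k M N =
    span_module k (free_module k (carrier M \<times> carrier N)) (tensor_relations k M N)"

definition tensor_module ::
  "('k, 'r) ring_scheme \<Rightarrow> ('k, 'm, 's) module_scheme \<Rightarrow> ('k, 'n, 't) module_scheme
    \<Rightarrow> ('k, ('k, 'm, 'n) tensor) module"
  where "tensor_module k M N =
    quotient_module (free_module k (carrier M \<times> carrier N)) (tensor_kernel k M N)"

definition pure_tensor ::
  "('k, 'r) ring_scheme \<Rightarrow> ('k, 'm, 's) module_scheme \<Rightarrow> ('k, 'n, 't) module_scheme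
    \<Rightarrow> 'm \<Rightarrow> 'n \<Rightarrow> ('k, 'm, 'n) tensor"
  where "pure_tensor k M N x y =
    tensor_kernel k M N +>\<^bsub>free_module k (carrier M \<times> carrier N)\<^esub> free_basis k (x, y)"

text \<open>\<open>tensor_lift k M N P b\<close> is the linear map \<open>M \<otimes> N \<rightarrow> P\<close>, \<open>x \<otimes> y \<mapsto> b x y\<close>, for a bilinear
  \<open>b\<close>.  In Sweedler notation, \<open>tensor_lift k H H P b (\<Delta> h)\<close> is \<open>b h\<^sub>(\<^sub>1\<^sub>) h\<^sub>(\<^sub>2\<^sub>)\<close>.\<close>

definition tensor_lift ::
  "('k, 'r) ring_scheme \<Rightarrow> ('k, 'm, 's) module_scheme \<Rightarrow> ('k, 'n, 't) module_scheme
    \<Rightarrow> ('k, 'p, 'u) module_scheme \<Rightarrow> ('m \<Rightarrow> 'n \<Rightarrow> 'p) \<Rightarrow> ('k, 'm, 'n) tensor \<Rightarrow> 'p"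
  where "tensor_lift k M N P b =
    (THE f. f \<in> linear_maps k (tensor_module k M N) P \<and>
       (\<forall>x \<in> carrier M. \<forall>y \<in> carrier N. f (pure_tensor k M N x y) = b x y))"

definition tensor_map ::
  "('k, 'r) ring_scheme \<Rightarrow> ('k, 'm, 's) module_scheme \<Rightarrow> ('k, 'm', 's') module_scheme
    \<Rightarrow> ('k, 'n, 't) module_scheme \<Rightarrow> ('k, 'n', 't') module_scheme
    \<Rightarrow> ('m \<Rightarrow> 'm') \<Rightarrow> ('n \<Rightarrow> 'n') \<Rightarrow> ('k, 'm, 'n) tensor \<Rightarrow> ('k, 'm', 'n') tensor"
  where "tensor_map k M M' N N' f g =
    tensor_lift k M N (tensor_module k M' N') (\<lambda>x y. pure_tensor k M' N' (f x) (g y))"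

definition tensor_assoc ::
  "('k, 'r) ring_scheme \<Rightarrow> ('k, 'm, 's) module_scheme \<Rightarrow> ('k, 'n, 't) module_scheme
    \<Rightarrow> ('k, 'p, 'u) module_scheme
    \<Rightarrow> ('k, ('k, 'm, 'n) tensor, 'p) tensor \<Rightarrow> ('k, 'm, ('k, 'n, 'p) tensor) tensor"
  where "tensor_assoc k M N P =
    (let NP = tensor_module k N P; MNP = tensor_module k M NP in
      tensor_lift k (tensor_module k M N) P MNP
        (\<lambda>u z. tensor_lift k M N MNP
           (\<lambda>x y. pure_tensor k M NP x (pure_tensor k N P y z)) u))"

text \<open>If \<open>\<mu> a\<close> and \<open>\<nu> a\<close> are the actions of \<open>a \<in> H\<close> on \<open>M\<close> and \<open>N\<close>, then
  \<open>tensor_act k H M N \<mu> \<nu>\<close> is the action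
  \<open>(a \<otimes> b) \<cdot> (x \<otimes> y) = \<mu> a x \<otimes> \<nu> b y\<close> of \<open>H \<otimes> H\<close> on \<open>M \<otimes> N\<close>.\<close>

definition tensor_act ::
  "('k, 'r) ring_scheme \<Rightarrow> ('k, 'h, 'q) module_scheme
    \<Rightarrow> ('k, 'm, 's) module_scheme \<Rightarrow> ('k, 'n, 't) module_scheme
    \<Rightarrow> ('h \<Rightarrow> 'm \<Rightarrow> 'm) \<Rightarrow> ('h \<Rightarrow> 'n \<Rightarrow> 'n)
    \<Rightarrow> ('k, 'h, 'h) tensor \<Rightarrow> ('k, 'm, 'n) tensor \<Rightarrow> ('k, 'm, 'n) tensor"
  where "tensor_act k H M N \<mu> \<nu> w u =
    tensor_lift k H H (tensor_module k M N) (\<lambda>a b. tensor_map k M M N N (\<mu> a) (\<nu> b) u) w"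


section \<open>Monoidal prebialgebras\<close>

text \<open>A \<open>k\<close>-algebra is a record \<^typ>\<open>('k, 'h) module\<close> whose ring part is used too; unlike
  in \<^locale>\<open>algebra\<close> it need not be commutative.\<close>

locale prebialgebra =
  fixes k :: "('k, 'r) ring_scheme"
    and H :: "('k, 'h, 's) module_scheme"
    and \<Delta> :: "'h \<Rightarrow> ('k, 'h, 'h) tensor"
    and \<epsilon> :: "'h \<Rightarrow> 'k"
  assumes k_cring: "cring k"
    and H_ring: "ring H"
    and H_module: "module k H"
    and smult_mult_left:
      "\<lbrakk>a \<in> carrier k; x \<in> carrier H; y \<in> carrier H\<rbrakk>
        \<Longrightarrow> a \<odot>\<^bsub>H\<^esub> (x \<otimes>\<^bsub>H\<^esub> y) = (a \<odot>\<^bsub>H\<^esub> x) \<otimes>\<^bsub>H\<^esub> y"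
    and smult_mult_right:
      "\<lbrakk>a \<in> carrier k; x \<in> carrier H; y \<in> carrier H\<rbrakk>
        \<Longrightarrow> a \<odot>\<^bsub>H\<^esub> (x \<otimes>\<^bsub>H\<^esub> y) = x \<otimes>\<^bsub>H\<^esub> (a \<odot>\<^bsub>H\<^esub> y)"
    and comult_linear: "linear_map k H (tensor_module k H H) \<Delta>"
    and counit_linear: "linear_map k H (self_module k) \<epsilon>"
    and coassoc:
      "h \<in> carrier H \<Longrightarrow>
        tensor_assoc k H H H (tensor_map k H (tensor_module k H H) H H \<Delta> (\<lambda>x. x) (\<Delta> h))
        = tensor_map k H H H (tensor_module k H H) (\<lambda>x. x) \<Delta> (\<Delta> h)"
    and counit_left: "h \<in> carrier H \<Longrightarrow> tensor_lift k H H H (\<lambda>x y. \<epsilon> x \<odot>\<^bsub>H\<^esub> y) (\<Delta> h) = h"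
    and counit_right: "h \<in> carrier H \<Longrightarrow> tensor_lift k H H H (\<lambda>x y. \<epsilon> y \<odot>\<^bsub>H\<^esub> x) (\<Delta> h) = h"
    and comult_mult:
      "\<lbrakk>h \<in> carrier H; h' \<in> carrier H\<rbrakk>
        \<Longrightarrow> \<Delta> (h \<otimes>\<^bsub>H\<^esub> h') = tensor_act k H H H (mult H) (mult H) (\<Delta> h) (\<Delta> h')"

locale monoidal_prebialgebra = prebialgebra k H \<Delta> \<epsilon>
  for k :: "('k, 'r) ring_scheme"
    and H :: "('k, 'h, 's) module_scheme"
    and \<Delta> :: "'h \<Rightarrow> ('k, 'h, 'h) tensor"
    and \<epsilon> :: "'h \<Rightarrow> 'k" +
  assumes left_monoidal:
      "\<lbrakk>x \<in> carrier H; y \<in> carrier H; z \<in> carrier H\<rbrakk>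
        \<Longrightarrow> \<epsilon> (x \<otimes>\<^bsub>H\<^esub> y \<otimes>\<^bsub>H\<^esub> z) =
          tensor_lift k H H (self_module k)
            (\<lambda>y1 y2. \<epsilon> (x \<otimes>\<^bsub>H\<^esub> y1) \<otimes>\<^bsub>k\<^esub> \<epsilon> (y2 \<otimes>\<^bsub>H\<^esub> z)) (\<Delta> y)"
    and right_monoidal:
      "\<lbrakk>x \<in> carrier H; y \<in> carrier H; z \<in> carrier H\<rbrakk>
        \<Longrightarrow> \<epsilon> (x \<otimes>\<^bsub>H\<^esub> y \<otimes>\<^bsub>H\<^esub> z) =
          tensor_lift k H H (self_module k)
            (\<lambda>y1 y2. \<epsilon> (x \<otimes>\<^bsub>H\<^esub> y2) \<otimes>\<^bsub>k\<^esub> \<epsilon> (y1 \<otimes>\<^bsub>H\<^esub> z)) (\<Delta> y)"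


section \<open>Left modules over a prebialgebra\<close>

record ('k, 'h, 'm) hmodule = "('k, 'm) module" +
  act :: "'h \<Rightarrow> 'm \<Rightarrow> 'm"

definition left_module ::
  "('k, 'r) ring_scheme \<Rightarrow> ('k, 'h, 's) module_scheme \<Rightarrow> ('k, 'h, 'm) hmodule \<Rightarrow> bool"
  where "left_module k H M \<longleftrightarrow>
    module k M \<and>
    (\<forall>h \<in> carrier H. linear_map k M M (act M h)) \<and>
    (\<forall>x \<in> carrier M. linear_map k H M (\<lambda>h. act M h x)) \<and>
    (\<forall>h \<in> carrier H. \<forall>h' \<in> carrier H. \<forall>x \<in> carrier M.
       act M (h \<otimes>\<^bsub>H\<^esub> h') x = act M h (act M h' x)) \<and>
    (\<forall>x \<in> carrier M. act M \<one>\<^bsub>H\<^esub> x = x)"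

definition left_module_maps ::
  "('k, 'r) ring_scheme \<Rightarrow> ('k, 'h, 's) module_scheme
    \<Rightarrow> ('k, 'h, 'm) hmodule \<Rightarrow> ('k, 'h, 'n) hmodule \<Rightarrow> ('m \<Rightarrow> 'n) set"
  where "left_module_maps k H M N =
    {f \<in> linear_maps k M N.
       \<forall>h \<in> carrier H. \<forall>x \<in> carrier M. f (act M h x) = act N h (f x)}"

subsection \<open>The tensor product \<open>\<otimes>\<^sup>l\<close> and its associativity constraint\<close>

definition diag_act ::
  "('k, 'r) ring_scheme \<Rightarrow> ('k, 'h, 's) module_scheme \<Rightarrow> ('h \<Rightarrow> ('k, 'h, 'h) tensor)
    \<Rightarrow> ('k, 'h, 'm) hmodule \<Rightarrow> ('k, 'h, 'n) hmodule
    \<Rightarrow> 'h \<Rightarrow> ('k, 'm, 'n) tensor \<Rightarrow> ('k, 'm, 'n) tensor"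
  where "diag_act k H \<Delta> M N h u = tensor_act k H M N (act M) (act N) (\<Delta> h) u"

definition ltensor ::
  "('k, 'r) ring_scheme \<Rightarrow> ('k, 'h, 's) module_scheme \<Rightarrow> ('h \<Rightarrow> ('k, 'h, 'h) tensor)
    \<Rightarrow> ('k, 'h, 'm) hmodule \<Rightarrow> ('k, 'h, 'n) hmodule
    \<Rightarrow> ('k, 'h, ('k, 'm, 'n) tensor) hmodule"
  where "ltensor k H \<Delta> M N =
    \<lparr>carrier = diag_act k H \<Delta> M N \<one>\<^bsub>H\<^esub> ` carrier (tensor_module k M N),
     mult = undefined, one = undefined,
     zero = zero (tensor_module k M N), add = add (tensor_module k M N),
     smult = smult (tensor_module k M N), act = diag_act k H \<Delta> M N\<rparr>"

definition ltensor_map ::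
  "('k, 'r) ring_scheme \<Rightarrow> ('k, 'h, 's) module_scheme \<Rightarrow> ('h \<Rightarrow> ('k, 'h, 'h) tensor)
    \<Rightarrow> ('k, 'h, 'm) hmodule \<Rightarrow> ('k, 'h, 'm') hmodule
    \<Rightarrow> ('k, 'h, 'n) hmodule \<Rightarrow> ('k, 'h, 'n') hmodule
    \<Rightarrow> ('m \<Rightarrow> 'm') \<Rightarrow> ('n \<Rightarrow> 'n') \<Rightarrow> ('k, 'm, 'n) tensor \<Rightarrow> ('k, 'm', 'n') tensor"
  where "ltensor_map k H \<Delta> M M' N N' f g =
    restrict (tensor_map k M M' N N' f g) (carrier (ltensor k H \<Delta> M N))"

text \<open>The constraint is induced by \<^const>\<open>tensor_assoc\<close>: with \<open>\<iota>\<close> denoting the inclusions of the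
  submodules \<open>_ \<otimes>\<^sup>l _\<close> into \<open>_ \<otimes> _\<close>, it is the map \<open>x \<mapsto> y\<close> determined by
  \<open>(M \<otimes> \<iota>) y = tensor_assoc ((\<iota> \<otimes> P) x)\<close>.\<close>

definition lassoc ::
  "('k, 'r) ring_scheme \<Rightarrow> ('k, 'h, 's) module_scheme \<Rightarrow> ('h \<Rightarrow> ('k, 'h, 'h) tensor)
    \<Rightarrow> ('k, 'h, 'm) hmodule \<Rightarrow> ('k, 'h, 'n) hmodule \<Rightarrow> ('k, 'h, 'p) hmodule
    \<Rightarrow> ('k, ('k, 'm, 'n) tensor, 'p) tensor \<Rightarrow> ('k, 'm, ('k, 'n, 'p) tensor) tensor"
  where "lassoc k H \<Delta> M N P =
    (\<lambda>x \<in> carrier (ltensor k H \<Delta> (ltensor k H \<Delta> M N) P).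
       THE y. y \<in> carrier (ltensor k H \<Delta> M (ltensor k H \<Delta> N P)) \<and>
         tensor_map k M M (ltensor k H \<Delta> N P) (tensor_module k N P) (\<lambda>u. u) (\<lambda>u. u) y
         = tensor_assoc k M N P
             (tensor_map k (ltensor k H \<Delta> M N) (tensor_module k M N) P P (\<lambda>u. u) (\<lambda>u. u) x))"

subsection \<open>The unit object and the unit constraints\<close>

definition dual_module ::
  "('k, 'r) ring_scheme \<Rightarrow> ('k, 'h, 's) module_scheme \<Rightarrow> ('k, 'h \<Rightarrow> 'k) module"
  where "dual_module k H =
    \<lparr>carrier = linear_maps k H (self_module k), mult = undefined, one = undefined,
     zero = (\<lambda>x \<in> carrier H. \<zero>\<^bsub>k\<^esub>),
     add = (\<lambda>\<phi> \<psi>. \<lambda>x \<in> carrier H. \<phi> x \<oplus>\<^bsub>k\<^esub> \<psi> x),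
     smult = (\<lambda>a \<phi>. \<lambda>x \<in> carrier H. a \<otimes>\<^bsub>k\<^esub> \<phi> x)\<rparr>"

definition f_map ::
  "('k, 'r) ring_scheme \<Rightarrow> ('k, 'h, 's) module_scheme \<Rightarrow> ('h \<Rightarrow> ('k, 'h, 'h) tensor)
    \<Rightarrow> ('h \<Rightarrow> 'k) \<Rightarrow> 'h"
  where "f_map k H \<Delta> \<phi> = tensor_lift k H H H (\<lambda>x y. \<phi> x \<odot>\<^bsub>H\<^esub> y) (\<Delta> \<one>\<^bsub>H\<^esub>)"

definition f'_map ::
  "('k, 'r) ring_scheme \<Rightarrow> ('k, 'h, 's) module_scheme \<Rightarrow> ('h \<Rightarrow> ('k, 'h, 'h) tensor)
    \<Rightarrow> ('h \<Rightarrow> 'k) \<Rightarrow> 'h"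
  where "f'_map k H \<Delta> \<phi> = tensor_lift k H H H (\<lambda>x y. \<phi> y \<odot>\<^bsub>H\<^esub> x) (\<Delta> \<one>\<^bsub>H\<^esub>)"

definition g_map :: "('k, 'h, 's) module_scheme \<Rightarrow> ('h \<Rightarrow> 'k) \<Rightarrow> 'h \<Rightarrow> 'h \<Rightarrow> 'k"
  where "g_map H \<epsilon> h = (\<lambda>x \<in> carrier H. \<epsilon> (x \<otimes>\<^bsub>H\<^esub> h))"

definition lunit_module ::
  "('k, 'r) ring_scheme \<Rightarrow> ('k, 'h, 's) module_scheme \<Rightarrow> ('h \<Rightarrow> 'k)
    \<Rightarrow> ('k, 'h, 'h \<Rightarrow> 'k) hmodule"
  where "lunit_module k H \<epsilon> =
    \<lparr>carrier = g_map H \<epsilon> ` carrier H, mult = undefined, one = undefined,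
     zero = zero (dual_module k H), add = add (dual_module k H),
     smult = smult (dual_module k H),
     act = (\<lambda>h \<phi>. THE \<psi>. \<exists>h' \<in> carrier H. \<phi> = g_map H \<epsilon> h' \<and> \<psi> = g_map H \<epsilon> (h \<otimes>\<^bsub>H\<^esub> h'))\<rparr>"

definition left_unit ::
  "('k, 'r) ring_scheme \<Rightarrow> ('k, 'h, 's) module_scheme \<Rightarrow> ('h \<Rightarrow> ('k, 'h, 'h) tensor)
    \<Rightarrow> ('h \<Rightarrow> 'k) \<Rightarrow> ('k, 'h, 'm) hmodule \<Rightarrow> ('k, 'h \<Rightarrow> 'k, 'm) tensor \<Rightarrow> 'm"
  where "left_unit k H \<Delta> \<epsilon> M =
    restrict (tensor_lift k (lunit_module k H \<epsilon>) M M (\<lambda>\<phi> x. act M (f_map k H \<Delta> \<phi>) x))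
      (carrier (ltensor k H \<Delta> (lunit_module k H \<epsilon>) M))"

definition right_unit ::
  "('k, 'r) ring_scheme \<Rightarrow> ('k, 'h, 's) module_scheme \<Rightarrow> ('h \<Rightarrow> ('k, 'h, 'h) tensor)
    \<Rightarrow> ('h \<Rightarrow> 'k) \<Rightarrow> ('k, 'h, 'm) hmodule \<Rightarrow> ('k, 'm, 'h \<Rightarrow> 'k) tensor \<Rightarrow> 'm"
  where "right_unit k H \<Delta> \<epsilon> M =
    restrict (tensor_lift k M (lunit_module k H \<epsilon>) M (\<lambda>x \<phi>. act M (f'_map k H \<Delta> \<phi>) x))
      (carrier (ltensor k H \<Delta> M (lunit_module k H \<epsilon>)))"


section \<open>The category of left modules\<close>

text \<open>The objects of a category have to share one type, whereas \<^const>\<open>ltensor\<close> and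
  \<^const>\<open>lunit_module\<close> change the type of the elements.  So the category consists of all left
  modules whose elements belong to the following type, a universe over an arbitrary type \<open>'x\<close>:
  \<open>Atom\<close> embeds the modules on subsets of \<open>'x\<close>, \<open>Functional\<close> makes room for the unit object and
  \<open>Tensor\<close> for tensors of elements of the universe.  Tensor product and unit object are
  transported into the universe along injective encodings of their elements, and all
  constraints are conjugated by these encodings.\<close>

datatype ('k, 'h, 'x) universe =
    Atom 'x
  | Functional "'h \<Rightarrow> 'k"
  | Tensor "((('k, 'h, 'x) universe \<times> ('k, 'h, 'x) universe) \<times> 'k) fset"

type_synonym ('k, 'h, 'x) umodule = "('k, 'h, ('k, 'h, 'x) universe) hmodule"

definition transport :: "('m \<Rightarrow> 'n) \<Rightarrow> ('k, 'h, 'm) hmodule \<Rightarrow> ('k, 'h, 'n) hmodule"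
  where "transport e M =
    (let d = inv_into (carrier M) e in
      \<lparr>carrier = e ` carrier M, mult = undefined, one = undefined,
       zero = e \<zero>\<^bsub>M\<^esub>, add = (\<lambda>x y. e (d x \<oplus>\<^bsub>M\<^esub> d y)),
       smult = (\<lambda>a x. e (a \<odot>\<^bsub>M\<^esub> d x)), act = (\<lambda>h x. e (act M h (d x)))\<rparr>)"

text \<open>A tensor is a coset of finitely supported functions; it is encoded by the graph of a chosen
  representative, restricted to its support.  Distinct cosets are disjoint, so this is injective
  on the carrier of every \<open>tensor_module k M N\<close>.\<close>

definition tensor_code ::
  "('k, 'r) ring_scheme
    \<Rightarrow> ('k, ('k, 'h, 'x) universe, ('k, 'h, 'x) universe) tensor \<Rightarrow> ('k, 'h, 'x) universe"
  where "tensor_code k u =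
    (let c = (SOME c. c \<in> u) in Tensor (Abs_fset {(b, c b) | b. c b \<noteq> \<zero>\<^bsub>k\<^esub>}))"

definition Mod_Ob ::
  "('k, 'r) ring_scheme \<Rightarrow> ('k, 'h, 's) module_scheme \<Rightarrow> ('k, 'h, 'x) umodule set"
  where "Mod_Ob k H = {M. left_module k H M}"

definition Mod_Id ::
  "('k, 'h, 'x) umodule \<Rightarrow> ('k, 'h, 'x) universe \<Rightarrow> ('k, 'h, 'x) universe"
  where "Mod_Id M = (\<lambda>x \<in> carrier M. x)"

definition Mod_Comp ::
  "('k, 'h, 'x) umodule \<Rightarrow> ('k, 'h, 'x) umodule \<Rightarrow> ('k, 'h, 'x) umodule
    \<Rightarrow> (('k, 'h, 'x) universe \<Rightarrow> ('k, 'h, 'x) universe)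
    \<Rightarrow> (('k, 'h, 'x) universe \<Rightarrow> ('k, 'h, 'x) universe)
    \<Rightarrow> ('k, 'h, 'x) universe \<Rightarrow> ('k, 'h, 'x) universe"
  where "Mod_Comp M N P g f = compose (carrier M) g f"

definition Mod_tensor ::
  "('k, 'r) ring_scheme \<Rightarrow> ('k, 'h, 's) module_scheme \<Rightarrow> ('h \<Rightarrow> ('k, 'h, 'h) tensor)
    \<Rightarrow> ('k, 'h, 'x) umodule \<Rightarrow> ('k, 'h, 'x) umodule \<Rightarrow> ('k, 'h, 'x) umodule"
  where "Mod_tensor k H \<Delta> M N = transport (tensor_code k) (ltensor k H \<Delta> M N)"

definition tensor_decode ::
  "('k, 'r) ring_scheme \<Rightarrow> ('k, 'h, 's) module_scheme \<Rightarrow> ('h \<Rightarrow> ('k, 'h, 'h) tensor)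
    \<Rightarrow> ('k, 'h, 'x) umodule \<Rightarrow> ('k, 'h, 'x) umodule
    \<Rightarrow> ('k, 'h, 'x) universe \<Rightarrow> ('k, ('k, 'h, 'x) universe, ('k, 'h, 'x) universe) tensor"
  where "tensor_decode k H \<Delta> M N = inv_into (carrier (ltensor k H \<Delta> M N)) (tensor_code k)"

definition Mod_tensor_map ::
  "('k, 'r) ring_scheme \<Rightarrow> ('k, 'h, 's) module_scheme \<Rightarrow> ('h \<Rightarrow> ('k, 'h, 'h) tensor)
    \<Rightarrow> ('k, 'h, 'x) umodule \<Rightarrow> ('k, 'h, 'x) umodule
    \<Rightarrow> ('k, 'h, 'x) umodule \<Rightarrow> ('k, 'h, 'x) umodule
    \<Rightarrow> (('k, 'h, 'x) universe \<Rightarrow> ('k, 'h, 'x) universe)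
    \<Rightarrow> (('k, 'h, 'x) universe \<Rightarrow> ('k, 'h, 'x) universe)
    \<Rightarrow> ('k, 'h, 'x) universe \<Rightarrow> ('k, 'h, 'x) universe"
  where "Mod_tensor_map k H \<Delta> M M' N N' f g =
    (\<lambda>x \<in> carrier (Mod_tensor k H \<Delta> M N).
       tensor_code k (ltensor_map k H \<Delta> M M' N N' f g (tensor_decode k H \<Delta> M N x)))"

definition Mod_unit ::
  "('k, 'r) ring_scheme \<Rightarrow> ('k, 'h, 's) module_scheme \<Rightarrow> ('h \<Rightarrow> 'k) \<Rightarrow> ('k, 'h, 'x) umodule"
  where "Mod_unit k H \<epsilon> = transport Functional (lunit_module k H \<epsilon>)"

definition unit_decode ::
  "('k, 'r) ring_scheme \<Rightarrow> ('k, 'h, 's) module_scheme \<Rightarrow> ('h \<Rightarrow> 'k)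
    \<Rightarrow> ('k, 'h, 'x) universe \<Rightarrow> 'h \<Rightarrow> 'k"
  where "unit_decode k H \<epsilon> = inv_into (carrier (lunit_module k H \<epsilon>)) Functional"

definition Mod_assoc ::
  "('k, 'r) ring_scheme \<Rightarrow> ('k, 'h, 's) module_scheme \<Rightarrow> ('h \<Rightarrow> ('k, 'h, 'h) tensor)
    \<Rightarrow> ('k, 'h, 'x) umodule \<Rightarrow> ('k, 'h, 'x) umodule \<Rightarrow> ('k, 'h, 'x) umodule
    \<Rightarrow> ('k, 'h, 'x) universe \<Rightarrow> ('k, 'h, 'x) universe"
  where "Mod_assoc k H \<Delta> M N P =
    (let MN = Mod_tensor k H \<Delta> M N; NP = Mod_tensor k H \<Delta> N P in
      (\<lambda>x \<in> carrier (Mod_tensor k H \<Delta> MN P).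
        tensor_code k
          (ltensor_map k H \<Delta> M M (ltensor k H \<Delta> N P) NP (\<lambda>u. u) (tensor_code k)
            (lassoc k H \<Delta> M N P
              (ltensor_map k H \<Delta> MN (ltensor k H \<Delta> M N) P P (tensor_decode k H \<Delta> M N) (\<lambda>u. u)
                (tensor_decode k H \<Delta> MN P x))))))"

definition Mod_left_unit ::
  "('k, 'r) ring_scheme \<Rightarrow> ('k, 'h, 's) module_scheme \<Rightarrow> ('h \<Rightarrow> ('k, 'h, 'h) tensor)
    \<Rightarrow> ('h \<Rightarrow> 'k) \<Rightarrow> ('k, 'h, 'x) umodule
    \<Rightarrow> ('k, 'h, 'x) universe \<Rightarrow> ('k, 'h, 'x) universe"
  where "Mod_left_unit k H \<Delta> \<epsilon> M =
    (let I = Mod_unit k H \<epsilon> in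
      (\<lambda>x \<in> carrier (Mod_tensor k H \<Delta> I M).
        left_unit k H \<Delta> \<epsilon> M
          (ltensor_map k H \<Delta> I (lunit_module k H \<epsilon>) M M (unit_decode k H \<epsilon>) (\<lambda>u. u)
            (tensor_decode k H \<Delta> I M x))))"

definition Mod_right_unit ::
  "('k, 'r) ring_scheme \<Rightarrow> ('k, 'h, 's) module_scheme \<Rightarrow> ('h \<Rightarrow> ('k, 'h, 'h) tensor)
    \<Rightarrow> ('h \<Rightarrow> 'k) \<Rightarrow> ('k, 'h, 'x) umodule
    \<Rightarrow> ('k, 'h, 'x) universe \<Rightarrow> ('k, 'h, 'x) universe"
  where "Mod_right_unit k H \<Delta> \<epsilon> M =
    (let I = Mod_unit k H \<epsilon> in
      (\<lambda>x \<in> carrier (Mod_tensor k H \<Delta> M I).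
        right_unit k H \<Delta> \<epsilon> M
          (ltensor_map k H \<Delta> M M I (lunit_module k H \<epsilon>) (\<lambda>u. u) (unit_decode k H \<epsilon>)
            (tensor_decode k H \<Delta> M I x))))"

end

theory Submission
  imports Defs
begin

text \<open>On \<open>M \<otimes> N\<close> the unit of \<open>H\<close> acts through \<open>\<Delta>(1)\<close>, which need not be \<open>1 \<otimes> 1\<close>; it is an
  idempotent with image \<open>M \<otimes>\<^sup>l N\<close>. The proof has two independent ingredients.

  \<^bold>\<open>Reduction to brackets.\<close> The plain tensor product with its non-unital diagonal action is
  associative: the associator of \<open>k\<close>-modules commutes with the actions of \<open>H\<close> by coassociativity
  (\<open>tensor_assoc_equivariant\<close>). The encoded module \<open>M \<otimes>\<^sup>l N\<close> is a retract of \<open>M \<otimes> N\<close>: the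
  inclusion \<open>tensor_decode\<close> and the projection \<open>Mod_proj\<close> are linear and commute with \<open>H\<close>, and
  their composite on \<open>M \<otimes> N\<close> is the action of \<open>1\<close>. Hence \<open>M \<otimes>\<^sup>l N\<close> is generated by the brackets
  \<open>[x, y]\<close>, the projections of the pure tensors. On brackets all structure maps have the naive form:
  \<open>f \<otimes>\<^sup>l g\<close> sends \<open>[x, y]\<close> to \<open>[f x, g y]\<close>, the associativity constraint sends \<open>[[x, y], z]\<close> to
  \<open>[x, [y, z]]\<close>, and \<open>l\<close> and \<open>r\<close> send \<open>[\<phi>, x]\<close> to \<open>f(\<phi>) x\<close> and \<open>[x, \<phi>]\<close> to \<open>f'(\<phi>) x\<close>. Functoriality,
  naturality and the pentagon are read off from these formulas.

  \<^bold>\<open>Slices of the comultiplication.\<close> For \<open>h\<close> in \<open>H\<close> put \<open>\<lambda>\<^sub>h(y) = \<epsilon>(y\<^sub>1 h) y\<^sub>2\<close> and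
  \<open>\<rho>\<^sub>h(y) = \<epsilon>(y\<^sub>2 h) y\<^sub>1\<close> (\<open>slice_left\<close> and \<open>slice_right\<close>). For \<open>\<phi> = \<epsilon>(-h)\<close> one has \<open>f(\<phi>) = \<lambda>\<^sub>h(1)\<close>
  and \<open>f'(\<phi>) = \<rho>\<^sub>h(1)\<close>. Right monoidality makes \<open>\<lambda>\<^sub>h\<close> left \<open>H\<close>-linear, left monoidality does the same
  for \<open>\<rho>\<^sub>h\<close>, and coassociativity gives \<open>y\<^sub>1 \<otimes> \<lambda>\<^sub>h(y\<^sub>2) = \<rho>\<^sub>h(y\<^sub>1) \<otimes> y\<^sub>2\<close>. For \<open>y = 1\<close> these facts combine
  to \<open>[x, \<lambda>\<^sub>h(1) y] = [\<rho>\<^sub>h(1) x, y]\<close> (\<open>bracket_exchange\<close>). With \<open>y\<close> and \<open>x\<close> in arbitrary modules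
  this is the triangle identity. With \<open>x = \<epsilon>\<close> in the unit object it says
  \<open>[\<epsilon>, \<lambda>\<^sub>h(1) y] = [\<epsilon>(-h), y]\<close>, because \<open>\<rho>\<^sub>h(1) \<epsilon> = \<epsilon>(-h)\<close> by left monoidality; so
  \<open>y \<mapsto> [\<epsilon>, y]\<close> inverts \<open>l\<close>. Exchanging the sides, \<open>x \<mapsto> [x, \<epsilon>]\<close> inverts \<open>r\<close>.\<close>

section \<open>Linear maps\<close>

text \<open>Quotient modules, the unit object and the encoded modules are all known only as images of a module
  under a map that respects the operations; the axioms pass along such a surjection.\<close>

lemma module_surj_image:
  assumes M: "module k M"
    and surj: "e ` carrier M = carrier N"
    and lin: "linear_map k M N e"
    and zero: "e \<zero>\<^bsub>M\<^esub> = \<zero>\<^bsub>N\<^esub>"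
  shows "module k N"
proof -
  interpret M: module k M by (rule M)
  have add: "e x \<oplus>\<^bsub>N\<^esub> e y = e (x \<oplus>\<^bsub>M\<^esub> y)" if "x \<in> carrier M" "y \<in> carrier M" for x y
    using lin that by (simp add: linear_map_def)
  have sm: "a \<odot>\<^bsub>N\<^esub> e x = e (a \<odot>\<^bsub>M\<^esub> x)" if "a \<in> carrier k" "x \<in> carrier M" for a x
    using lin that by (simp add: linear_map_def)
  have N: "\<exists>x' \<in> carrier M. x = e x'" if "x \<in> carrier N" for x
    using that surj by blast
  have e: "e x \<in> carrier N" if "x \<in> carrier M" for x
    using that surj by blast
  show ?thesis
  proof (rule moduleI)
    show "abelian_group N"
    proof (rule abelian_groupI)
      fix x assume "x \<in> carrier N"
      then obtain x' where x': "x' \<in> carrier M" "x = e x'" using N by blast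
      show "\<exists>y \<in> carrier N. y \<oplus>\<^bsub>N\<^esub> x = \<zero>\<^bsub>N\<^esub>"
        using x' by (intro bexI[of _ "e (\<ominus>\<^bsub>M\<^esub> x')"]) (simp_all add: add e M.l_neg zero)
      show "\<zero>\<^bsub>N\<^esub> \<oplus>\<^bsub>N\<^esub> x = x"
        using x' by (simp add: zero[symmetric] add)
    next
      show "\<zero>\<^bsub>N\<^esub> \<in> carrier N" using e[of "\<zero>\<^bsub>M\<^esub>"] zero by simp
    next
      fix x y assume "x \<in> carrier N" "y \<in> carrier N"
      then obtain x' y' where "x' \<in> carrier M" "x = e x'" "y' \<in> carrier M" "y = e y'"
        using N by meson
      then show "x \<oplus>\<^bsub>N\<^esub> y \<in> carrier N" "x \<oplus>\<^bsub>N\<^esub> y = y \<oplus>\<^bsub>N\<^esub> x"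
        by (simp_all add: add e M.a_comm)
    next
      fix x y z assume "x \<in> carrier N" "y \<in> carrier N" "z \<in> carrier N"
      then obtain x' y' z' where "x' \<in> carrier M" "x = e x'" "y' \<in> carrier M" "y = e y'"
        "z' \<in> carrier M" "z = e z'" using N by meson
      then show "x \<oplus>\<^bsub>N\<^esub> y \<oplus>\<^bsub>N\<^esub> z = x \<oplus>\<^bsub>N\<^esub> (y \<oplus>\<^bsub>N\<^esub> z)"
        by (simp add: add M.a_assoc)
    qed
  next
    fix a b x assume ab: "a \<in> carrier k" "b \<in> carrier k" and "x \<in> carrier N"
    then obtain x' where x': "x' \<in> carrier M" "x = e x'" using N by blast
    show "(a \<oplus>\<^bsub>k\<^esub> b) \<odot>\<^bsub>N\<^esub> x = a \<odot>\<^bsub>N\<^esub> x \<oplus>\<^bsub>N\<^esub> b \<odot>\<^bsub>N\<^esub> x"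
      using x' ab by (simp add: sm add M.smult_l_distr)
    show "(a \<otimes>\<^bsub>k\<^esub> b) \<odot>\<^bsub>N\<^esub> x = a \<odot>\<^bsub>N\<^esub> (b \<odot>\<^bsub>N\<^esub> x)"
      using x' ab by (simp add: sm M.smult_assoc1)
  next
    fix a x y assume a: "a \<in> carrier k" and "x \<in> carrier N" "y \<in> carrier N"
    then obtain x' y' where "x' \<in> carrier M" "x = e x'" "y' \<in> carrier M" "y = e y'"
      using N by meson
    then show "a \<odot>\<^bsub>N\<^esub> (x \<oplus>\<^bsub>N\<^esub> y) = a \<odot>\<^bsub>N\<^esub> x \<oplus>\<^bsub>N\<^esub> a \<odot>\<^bsub>N\<^esub> y"
      using a by (simp add: sm add M.smult_r_distr)
  next
    fix a x assume a: "a \<in> carrier k" and "x \<in> carrier N"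
    then obtain x' where x': "x' \<in> carrier M" "x = e x'" using N by blast
    show "a \<odot>\<^bsub>N\<^esub> x \<in> carrier N" using x' a by (simp add: sm e)
  next
    fix x assume "x \<in> carrier N"
    then obtain x' where x': "x' \<in> carrier M" "x = e x'" using N by blast
    show "\<one>\<^bsub>k\<^esub> \<odot>\<^bsub>N\<^esub> x = x" using x' by (simp add: sm)
  qed (rule M.R.is_cring)
qed

locale scalar_ring =
  fixes k :: "('k, 'r) ring_scheme"
  assumes scalar_cring: "cring k"

sublocale scalar_ring \<subseteq> k: cring k by (rule scalar_cring)

context scalar_ring
begin

lemma linear_mapI:
  assumes "\<And>x. x \<in> carrier M \<Longrightarrow> f x \<in> carrier N"
    and "\<And>x y. x \<in> carrier M \<Longrightarrow> y \<in> carrier M \<Longrightarrow> f (x \<oplus>\<^bsub>M\<^esub> y) = f x \<oplus>\<^bsub>N\<^esub> f y"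
    and "\<And>a x. a \<in> carrier k \<Longrightarrow> x \<in> carrier M \<Longrightarrow> f (a \<odot>\<^bsub>M\<^esub> x) = a \<odot>\<^bsub>N\<^esub> f x"
  shows "linear_map k M N f"
  using assms by (auto simp: linear_map_def)

lemma linear_mapD:
  assumes "linear_map k M N f"
  shows "x \<in> carrier M \<Longrightarrow> f x \<in> carrier N"
    and "x \<in> carrier M \<Longrightarrow> y \<in> carrier M \<Longrightarrow> f (x \<oplus>\<^bsub>M\<^esub> y) = f x \<oplus>\<^bsub>N\<^esub> f y"
    and "a \<in> carrier k \<Longrightarrow> x \<in> carrier M \<Longrightarrow> f (a \<odot>\<^bsub>M\<^esub> x) = a \<odot>\<^bsub>N\<^esub> f x"
  using assms by (auto simp: linear_map_def)

lemma module_ops: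
  assumes "module k M"
  shows "\<zero>\<^bsub>M\<^esub> \<in> carrier M"
    and "x \<in> carrier M \<Longrightarrow> y \<in> carrier M \<Longrightarrow> x \<oplus>\<^bsub>M\<^esub> y \<in> carrier M"
    and "a \<in> carrier k \<Longrightarrow> x \<in> carrier M \<Longrightarrow> a \<odot>\<^bsub>M\<^esub> x \<in> carrier M"
proof -
  interpret module k M by (rule assms)
  show "\<zero>\<^bsub>M\<^esub> \<in> carrier M"
    "x \<in> carrier M \<Longrightarrow> y \<in> carrier M \<Longrightarrow> x \<oplus>\<^bsub>M\<^esub> y \<in> carrier M"
    "a \<in> carrier k \<Longrightarrow> x \<in> carrier M \<Longrightarrow> a \<odot>\<^bsub>M\<^esub> x \<in> carrier M" by auto
qed

lemma linear_map_zero: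
  assumes "module k M" "module k N" "linear_map k M N f"
  shows "f \<zero>\<^bsub>M\<^esub> = \<zero>\<^bsub>N\<^esub>"
proof -
  interpret M: module k M by (rule assms)
  interpret N: module k N by (rule assms)
  have "f \<zero>\<^bsub>M\<^esub> = f (\<zero>\<^bsub>k\<^esub> \<odot>\<^bsub>M\<^esub> \<zero>\<^bsub>M\<^esub>)" by simp
  also have "\<dots> = \<zero>\<^bsub>N\<^esub>"
    using linear_mapD[OF assms(3)] by (metis M.zero_closed N.smult_l_null k.zero_closed)
  finally show ?thesis .
qed

lemma linear_map_minus:
  assumes "module k M" "module k N" "linear_map k M N f" "x \<in> carrier M" "y \<in> carrier M"
  shows "f (x \<ominus>\<^bsub>M\<^esub> y) = f x \<ominus>\<^bsub>N\<^esub> f y"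
proof -
  interpret M: module k M by (rule assms)
  interpret N: module k N by (rule assms)
  note f = linear_mapD[OF assms(3)]
  have "f (\<ominus>\<^bsub>M\<^esub> y) \<oplus>\<^bsub>N\<^esub> f y = \<zero>\<^bsub>N\<^esub>"
    using f(2)[of "\<ominus>\<^bsub>M\<^esub> y" y] linear_map_zero[OF assms(1-3)] assms(5) by (simp add: M.l_neg)
  then have "f (\<ominus>\<^bsub>M\<^esub> y) = \<ominus>\<^bsub>N\<^esub> f y"
    using assms(5) f(1) by (intro N.minus_equality[symmetric]) auto
  then show ?thesis
    using assms(4,5) f by (simp add: a_minus_def)
qed

lemma linear_map_id: "linear_map k M M (\<lambda>x. x)"
  by (rule linear_mapI) auto

lemma linear_map_compose:
  assumes "linear_map k M N f" "linear_map k N P g"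
  shows "linear_map k M P (\<lambda>x. g (f x))"
  using linear_mapD[OF assms(1)] linear_mapD[OF assms(2)] by (intro linear_mapI) auto

lemma linear_map_cong:
  assumes "linear_map k M N f" "\<And>x. x \<in> carrier M \<Longrightarrow> f x = g x" "module k M"
  shows "linear_map k M N g"
  using assms(2) linear_mapD[OF assms(1)] module_ops[OF assms(3)]
  by (intro linear_mapI) (metis)+

lemma linear_map_smult_const:
  assumes "linear_map k M (self_module k) f" "module k N" "y \<in> carrier N"
  shows "linear_map k M N (\<lambda>x. f x \<odot>\<^bsub>N\<^esub> y)"
proof -
  interpret N: module k N by (rule assms)
  show ?thesis
    using linear_mapD[OF assms(1)] assms(3)
    by (intro linear_mapI) (auto simp: self_module_def N.smult_l_distr N.smult_assoc1)
qed

lemma linear_map_smult: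
  assumes "linear_map k M N f" "module k N" "a \<in> carrier k"
  shows "linear_map k M N (\<lambda>x. a \<odot>\<^bsub>N\<^esub> f x)"
proof -
  interpret N: module k N by (rule assms)
  show ?thesis
    using linear_mapD[OF assms(1)] assms(3)
    by (intro linear_mapI) (auto simp: N.smult_r_distr N.smult_assoc1[symmetric] k.m_comm)
qed

definition bilinear where
  "bilinear M N P b \<longleftrightarrow>
    (\<forall>x \<in> carrier M. linear_map k N P (b x)) \<and> (\<forall>y \<in> carrier N. linear_map k M P (\<lambda>x. b x y))"

lemma bilinearI:
  assumes "\<And>x. x \<in> carrier M \<Longrightarrow> linear_map k N P (b x)"
    and "\<And>y. y \<in> carrier N \<Longrightarrow> linear_map k M P (\<lambda>x. b x y)"
  shows "bilinear M N P b"
  using assms by (simp add: bilinear_def)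

lemma bilinearD:
  assumes "bilinear M N P b"
  shows "x \<in> carrier M \<Longrightarrow> linear_map k N P (b x)"
    and "y \<in> carrier N \<Longrightarrow> linear_map k M P (\<lambda>x. b x y)"
    and "x \<in> carrier M \<Longrightarrow> y \<in> carrier N \<Longrightarrow> b x y \<in> carrier P"
  using assms by (auto simp: bilinear_def linear_map_def)

lemma bilinear_compose:
  assumes "bilinear M N P b" "linear_map k M' M f" "linear_map k N' N g" "linear_map k P P' h"
  shows "bilinear M' N' P' (\<lambda>x y. h (b (f x) (g y)))"
proof (rule bilinearI)
  fix x assume "x \<in> carrier M'"
  then have "f x \<in> carrier M" by (rule linear_mapD[OF assms(2)])
  then show "linear_map k N' P' (\<lambda>y. h (b (f x) (g y)))"
    using linear_map_compose[OF linear_map_compose[OF assms(3) bilinearD(1)[OF assms(1)]] assms(4)]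
    by blast
next
  fix y assume "y \<in> carrier N'"
  then have "g y \<in> carrier N" by (rule linear_mapD[OF assms(3)])
  then show "linear_map k M' P' (\<lambda>x. h (b (f x) (g y)))"
    using linear_map_compose[OF linear_map_compose[OF assms(2) bilinearD(2)[OF assms(1)]] assms(4)]
    by blast
qed

section \<open>Free modules and quotients\<close>

abbreviation "supp c \<equiv> {b. c b \<noteq> \<zero>\<^bsub>k\<^esub>}"

lemma free_module_simps [simp]:
  "c \<in> carrier (free_module k B) \<longleftrightarrow> (\<forall>b. c b \<in> carrier k) \<and> finite (supp c) \<and> supp c \<subseteq> B"
  "c \<oplus>\<^bsub>free_module k B\<^esub> d = (\<lambda>b. c b \<oplus>\<^bsub>k\<^esub> d b)"
  "\<zero>\<^bsub>free_module k B\<^esub> = (\<lambda>b. \<zero>\<^bsub>k\<^esub>)"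
  "a \<odot>\<^bsub>free_module k B\<^esub> c = (\<lambda>b. a \<otimes>\<^bsub>k\<^esub> c b)"
  by (simp_all add: free_module_def)

lemma module_free: "module k (free_module k B)"
proof (rule moduleI)
  have fin_add: "finite (supp (\<lambda>b. c b \<oplus>\<^bsub>k\<^esub> d b)) \<and> supp (\<lambda>b. c b \<oplus>\<^bsub>k\<^esub> d b) \<subseteq> B"
    if "c \<in> carrier (free_module k B)" "d \<in> carrier (free_module k B)" for c d
  proof -
    have "supp (\<lambda>b. c b \<oplus>\<^bsub>k\<^esub> d b) \<subseteq> supp c \<union> supp d" by auto
    then show ?thesis using that by (auto intro: finite_subset)
  qed
  show "abelian_group (free_module k B)"
  proof (rule abelian_groupI)
    fix c assume c: "c \<in> carrier (free_module k B)"
    have s: "supp (\<lambda>b. \<ominus>\<^bsub>k\<^esub> c b) \<subseteq> supp c" by auto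
    have "(\<lambda>b. \<ominus>\<^bsub>k\<^esub> c b) \<in> carrier (free_module k B)"
      using finite_subset[OF s] c s by (auto intro: k.a_inv_closed)
    then show "\<exists>d \<in> carrier (free_module k B). d \<oplus>\<^bsub>free_module k B\<^esub> c = \<zero>\<^bsub>free_module k B\<^esub>"
      by (rule bexI[rotated]) (use c in \<open>simp add: k.l_neg\<close>)
  next
    fix c d assume "c \<in> carrier (free_module k B)" "d \<in> carrier (free_module k B)"
    then show "c \<oplus>\<^bsub>free_module k B\<^esub> d \<in> carrier (free_module k B)"
      using fin_add[of c d] by simp
  qed (auto simp: k.a_assoc intro!: ext k.a_comm)
next
  fix a c assume "a \<in> carrier k" and c: "c \<in> carrier (free_module k B)"
  moreover have "supp (\<lambda>b. a \<otimes>\<^bsub>k\<^esub> c b) \<subseteq> supp c" using \<open>a \<in> carrier k\<close> by auto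
  ultimately show "a \<odot>\<^bsub>free_module k B\<^esub> c \<in> carrier (free_module k B)"
    by (auto intro: finite_subset)
qed (simp_all add: k.l_distr k.r_distr k.m_assoc scalar_cring)

lemma free_basis_closed [simp]:
  assumes "b \<in> B"
  shows "free_basis k b \<in> carrier (free_module k B)"
proof -
  have "supp (free_basis k b) \<subseteq> {b}" by (auto simp: free_basis_def)
  then show ?thesis using assms by (auto intro: finite_subset simp: free_basis_def)
qed

lemma free_module_induct [consumes 1, case_names zero add]:
  assumes "c \<in> carrier (free_module k B)"
    and zero: "P (\<lambda>b. \<zero>\<^bsub>k\<^esub>)"
    and add: "\<And>a b c. a \<in> carrier k \<Longrightarrow> b \<in> B \<Longrightarrow> c \<in> carrier (free_module k B) \<Longrightarrow> P c
      \<Longrightarrow> P (a \<odot>\<^bsub>free_module k B\<^esub> free_basis k b \<oplus>\<^bsub>free_module k B\<^esub> c)"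
  shows "P c"
proof -
  have "finite A \<Longrightarrow> \<forall>c. c \<in> carrier (free_module k B) \<longrightarrow> supp c = A \<longrightarrow> P c" for A
  proof (induction A rule: finite_induct)
    case empty
    have "P c" if "supp c = {}" for c
    proof -
      have "c = (\<lambda>b. \<zero>\<^bsub>k\<^esub>)" using that by auto
      then show ?thesis using zero by simp
    qed
    then show ?case by blast
  next
    case (insert b A)
    show ?case
    proof (intro allI impI)
      fix c assume c: "c \<in> carrier (free_module k B)" "supp c = insert b A"
      define c' where "c' = c(b := \<zero>\<^bsub>k\<^esub>)"
      have "supp c' = A" using c(2) insert.hyps by (auto simp: c'_def)
      moreover have c': "c' \<in> carrier (free_module k B)"
        using c \<open>supp c' = A\<close> insert.hyps(1) by (auto simp: c'_def)
      ultimately have "P c'" using insert.IH by blast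
      moreover have "c = c b \<odot>\<^bsub>free_module k B\<^esub> free_basis k b \<oplus>\<^bsub>free_module k B\<^esub> c'"
        using c by (auto simp: c'_def free_basis_def fun_eq_iff)
      moreover have "b \<in> B" "c b \<in> carrier k" using c by auto
      ultimately show "P c" using add[of "c b" b c'] c' by metis
    qed
  qed
  then show ?thesis using assms(1) by auto
qed

definition free_lift where
  "free_lift P \<phi> c = finsum P (\<lambda>b. c b \<odot>\<^bsub>P\<^esub> \<phi> b) (supp c)"

lemma free_lift_linear:
  assumes P: "module k P" and \<phi>: "\<phi> \<in> B \<rightarrow> carrier P"
  shows "linear_map k (free_module k B) P (free_lift P \<phi>)"
    and "b \<in> B \<Longrightarrow> free_lift P \<phi> (free_basis k b) = \<phi> b"
proof -
  interpret P: module k P by (rule P)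
  let ?F = "free_module k B"
  interpret F: module k ?F by (rule module_free)
  have cl: "c b \<odot>\<^bsub>P\<^esub> \<phi> b \<in> carrier P" if "c \<in> carrier ?F" "b \<in> B" for c b
    using that \<phi> by auto
  \<comment> \<open>The support may be enlarged, so that two sums can be compared on a common index set.\<close>
  have ext: "free_lift P \<phi> c = finsum P (\<lambda>b. c b \<odot>\<^bsub>P\<^esub> \<phi> b) A"
    if "c \<in> carrier ?F" "finite A" "A \<subseteq> B" "supp c \<subseteq> A" for c A
    unfolding free_lift_def
    by (rule P.add.finprod_mono_neutral_cong_left) (use that \<phi> in \<open>auto simp: Pi_iff subset_iff\<close>)
  show "linear_map k ?F P (free_lift P \<phi>)"
  proof (rule linear_mapI)
    fix c assume c: "c \<in> carrier ?F"
    show "free_lift P \<phi> c \<in> carrier P"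
      unfolding free_lift_def by (rule P.finsum_closed) (use c cl[OF c] in auto)
  next
    fix c d assume c: "c \<in> carrier ?F" and d: "d \<in> carrier ?F"
    let ?A = "supp c \<union> supp d"
    have A: "finite ?A" "?A \<subseteq> B" using c d by auto
    have cd: "c \<oplus>\<^bsub>?F\<^esub> d \<in> carrier ?F" using c d by (rule F.a_closed)
    have supp_add: "supp (c \<oplus>\<^bsub>?F\<^esub> d) \<subseteq> ?A" by auto
    have "free_lift P \<phi> (c \<oplus>\<^bsub>?F\<^esub> d) = finsum P (\<lambda>b. (c b \<oplus>\<^bsub>k\<^esub> d b) \<odot>\<^bsub>P\<^esub> \<phi> b) ?A"
      using ext[OF cd A supp_add] by simp
    also have "\<dots> = finsum P (\<lambda>b. c b \<odot>\<^bsub>P\<^esub> \<phi> b \<oplus>\<^bsub>P\<^esub> d b \<odot>\<^bsub>P\<^esub> \<phi> b) ?A"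
      using A cl[OF c] cl[OF d] c d \<phi>
      by (intro P.finsum_cong') (auto simp: Pi_iff subset_iff intro!: P.smult_l_distr)
    also have "\<dots> = finsum P (\<lambda>b. c b \<odot>\<^bsub>P\<^esub> \<phi> b) ?A \<oplus>\<^bsub>P\<^esub> finsum P (\<lambda>b. d b \<odot>\<^bsub>P\<^esub> \<phi> b) ?A"
      using A cl[OF c] cl[OF d] by (intro P.finsum_addf) blast+
    finally show "free_lift P \<phi> (c \<oplus>\<^bsub>?F\<^esub> d) = free_lift P \<phi> c \<oplus>\<^bsub>P\<^esub> free_lift P \<phi> d"
      using ext[OF c A Un_upper1] ext[OF d A Un_upper2] by simp
  next
    fix a c assume a: "a \<in> carrier k" and c: "c \<in> carrier ?F"
    have A: "finite (supp c)" "supp c \<subseteq> B" using c by auto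
    have ac: "a \<odot>\<^bsub>?F\<^esub> c \<in> carrier ?F" using a c by (rule F.smult_closed)
    have supp_smult: "supp (a \<odot>\<^bsub>?F\<^esub> c) \<subseteq> supp c" using a by auto
    have "free_lift P \<phi> (a \<odot>\<^bsub>?F\<^esub> c) = finsum P (\<lambda>b. (a \<otimes>\<^bsub>k\<^esub> c b) \<odot>\<^bsub>P\<^esub> \<phi> b) (supp c)"
      using ext[OF ac A supp_smult] by simp
    also have "\<dots> = finsum P (\<lambda>b. a \<odot>\<^bsub>P\<^esub> (c b \<odot>\<^bsub>P\<^esub> \<phi> b)) (supp c)"
      using A cl[OF c] c a \<phi>
      by (intro P.finsum_cong') (auto simp: Pi_iff subset_iff intro!: P.smult_assoc1)
    also have "\<dots> = a \<odot>\<^bsub>P\<^esub> finsum P (\<lambda>b. c b \<odot>\<^bsub>P\<^esub> \<phi> b) (supp c)"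
      using A cl[OF c] a by (intro P.finsum_smult_ldistr[symmetric]) blast+
    finally show "free_lift P \<phi> (a \<odot>\<^bsub>?F\<^esub> c) = a \<odot>\<^bsub>P\<^esub> free_lift P \<phi> c"
      by (simp add: free_lift_def)
  qed
  assume b: "b \<in> B"
  then have "free_lift P \<phi> (free_basis k b) = finsum P (\<lambda>b'. free_basis k b b' \<odot>\<^bsub>P\<^esub> \<phi> b') {b}"
    by (intro ext free_basis_closed) (auto simp: free_basis_def)
  also have "\<dots> = \<phi> b"
    using b \<phi> by (auto simp: free_basis_def Pi_iff)
  finally show "free_lift P \<phi> (free_basis k b) = \<phi> b" .
qed

lemma submodule_span:
  assumes M: "module k M" and G: "G \<subseteq> carrier M"
  shows "submodule (span_module k M G) k M"
proof -
  interpret M: module k M by (rule M)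
  have mem: "x \<in> span_module k M G \<longleftrightarrow> (\<forall>S. submodule S k M \<longrightarrow> G \<subseteq> S \<longrightarrow> x \<in> S)" for x
    by (auto simp: span_module_def)
  have z: "\<zero>\<^bsub>M\<^esub> \<in> S" if "submodule S k M" for S
    using subgroup.one_closed[OF submodule.axioms(1)[OF that]] by simp
  show ?thesis
  proof (rule M.submoduleI)
    show "span_module k M G \<subseteq> carrier M"
      using M.carrier_is_submodule G mem by blast
  next
    fix x assume "x \<in> span_module k M G"
    then show "\<ominus>\<^bsub>M\<^esub> x \<in> span_module k M G"
      unfolding mem using M.submoduleE(3) by meson
  next
    fix x y assume "x \<in> span_module k M G" "y \<in> span_module k M G"
    then show "x \<oplus>\<^bsub>M\<^esub> y \<in> span_module k M G"
      unfolding mem using M.submoduleE(5) by meson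
  next
    fix a x assume "a \<in> carrier k" "x \<in> span_module k M G"
    then show "a \<odot>\<^bsub>M\<^esub> x \<in> span_module k M G"
      unfolding mem using M.submoduleE(4) by meson
  qed (use mem z in auto)
qed

lemma span_incl: "G \<subseteq> span_module k M G"
  by (auto simp: span_module_def)

lemma span_least: "submodule S k M \<Longrightarrow> G \<subseteq> S \<Longrightarrow> span_module k M G \<subseteq> S"
  by (auto simp: span_module_def)

lemma submodule_kernel:
  assumes M: "module k M" and N: "module k N" and f: "linear_map k M N f"
  shows "submodule {x \<in> carrier M. f x = \<zero>\<^bsub>N\<^esub>} k M"
proof -
  interpret M: module k M by (rule M)
  interpret N: module k N by (rule N)
  have z: "f \<zero>\<^bsub>M\<^esub> = \<zero>\<^bsub>N\<^esub>" by (rule linear_map_zero[OF M N f])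
  show ?thesis
  proof (rule M.submoduleI)
    fix x assume "x \<in> {x \<in> carrier M. f x = \<zero>\<^bsub>N\<^esub>}"
    then have x: "x \<in> carrier M" "f x = \<zero>\<^bsub>N\<^esub>" by auto
    have "f (\<ominus>\<^bsub>M\<^esub> x) = f (\<zero>\<^bsub>M\<^esub> \<ominus>\<^bsub>M\<^esub> x)" using x by (simp add: a_minus_def)
    also have "\<dots> = \<zero>\<^bsub>N\<^esub>" using linear_map_minus[OF M N f M.zero_closed x(1)] x z by (simp add: a_minus_def)
    finally show "\<ominus>\<^bsub>M\<^esub> x \<in> {x \<in> carrier M. f x = \<zero>\<^bsub>N\<^esub>}" using x by simp
  qed (use z linear_mapD[OF f] in auto)
qed

lemma coset_eq_iff:
  assumes M: "module k M" and S: "submodule S k M" and x: "x \<in> carrier M" "y \<in> carrier M"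
  shows "S +>\<^bsub>M\<^esub> x = S +>\<^bsub>M\<^esub> y \<longleftrightarrow> x \<ominus>\<^bsub>M\<^esub> y \<in> S"
proof -
  interpret M: module k M by (rule M)
  interpret S: abelian_subgroup S M
    by (intro abelian_subgroupI3 additive_subgroup.intro submodule.axioms[OF S] module.axioms[OF M])
  have "x \<ominus>\<^bsub>M\<^esub> y \<in> S \<longleftrightarrow> x \<in> S +>\<^bsub>M\<^esub> y"
    using S.a_rcos_module[OF x(2,1)] by (simp add: a_minus_def)
  also have "\<dots> \<longleftrightarrow> S +>\<^bsub>M\<^esub> x = S +>\<^bsub>M\<^esub> y"
    using M.a_repr_independence[of x S y] S.a_rcos_self[of x] x S.a_subgroup by metis
  finally show ?thesis by simp
qed

lemma quotient_module_facts:
  assumes M: "module k M" and S: "submodule S k M"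
  shows "module k (quotient_module M S)"
    and "linear_map k M (quotient_module M S) (\<lambda>x. S +>\<^bsub>M\<^esub> x)"
    and "carrier (quotient_module M S) = (\<lambda>x. S +>\<^bsub>M\<^esub> x) ` carrier M"
proof -
  interpret M: module k M by (rule M)
  interpret S: abelian_subgroup S M
    by (intro abelian_subgroupI3 additive_subgroup.intro submodule.axioms[OF S] module.axioms[OF M])
  show carr: "carrier (quotient_module M S) = (\<lambda>x. S +>\<^bsub>M\<^esub> x) ` carrier M"
    by (auto simp: quotient_module_def A_RCOSETS_def')
  show lin: "linear_map k M (quotient_module M S) (\<lambda>x. S +>\<^bsub>M\<^esub> x)"
  proof (rule linear_mapI)
    fix x y assume "x \<in> carrier M" "y \<in> carrier M"
    then show "S +>\<^bsub>M\<^esub> (x \<oplus>\<^bsub>M\<^esub> y) = (S +>\<^bsub>M\<^esub> x) \<oplus>\<^bsub>quotient_module M S\<^esub> (S +>\<^bsub>M\<^esub> y)"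
      by (simp add: quotient_module_def S.a_rcos_sum)
  next
    fix a x assume a: "a \<in> carrier k" and x: "x \<in> carrier M"
    \<comment> \<open>Scalar multiplication of cosets is a union over all representatives; each of them
      contributes the same coset.\<close>
    have "S +>\<^bsub>M\<^esub> (a \<odot>\<^bsub>M\<^esub> y) = S +>\<^bsub>M\<^esub> (a \<odot>\<^bsub>M\<^esub> x)" if y: "y \<in> S +>\<^bsub>M\<^esub> x" for y
    proof -
      have yc: "y \<in> carrier M" using S.a_elemrcos_carrier[OF x y] .
      have "y \<ominus>\<^bsub>M\<^esub> x \<in> S" using S.a_rcos_module[OF x yc] y by (simp add: a_minus_def)
      then have "a \<odot>\<^bsub>M\<^esub> (y \<ominus>\<^bsub>M\<^esub> x) \<in> S" by (rule submodule.smult_closed[OF S a])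
      then have "a \<odot>\<^bsub>M\<^esub> y \<ominus>\<^bsub>M\<^esub> a \<odot>\<^bsub>M\<^esub> x \<in> S"
        using a x yc by (simp add: a_minus_def M.smult_r_distr M.smult_r_minus)
      then show ?thesis using coset_eq_iff[OF M S] a x yc by simp
    qed
    then have "(\<Union>y \<in> S +>\<^bsub>M\<^esub> x. S +>\<^bsub>M\<^esub> (a \<odot>\<^bsub>M\<^esub> y)) = S +>\<^bsub>M\<^esub> (a \<odot>\<^bsub>M\<^esub> x)"
      by (intro UN_constant_eq[OF S.a_rcos_self[OF x]] ballI)
    then show "S +>\<^bsub>M\<^esub> (a \<odot>\<^bsub>M\<^esub> x) = a \<odot>\<^bsub>quotient_module M S\<^esub> (S +>\<^bsub>M\<^esub> x)"
      by (simp add: quotient_module_def)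
  qed (simp add: carr)
  have "S +>\<^bsub>M\<^esub> \<zero>\<^bsub>M\<^esub> = \<zero>\<^bsub>quotient_module M S\<^esub>"
    using S.a_rcos_const[OF S.zero_closed] by (simp add: quotient_module_def)
  then show "module k (quotient_module M S)"
    using module_surj_image[OF M carr[symmetric] lin] by simp
qed

end

section \<open>The universal property of the tensor product\<close>

context scalar_ring
begin

abbreviation "tens \<equiv> tensor_module k"
abbreviation "pure \<equiv> pure_tensor k"
abbreviation "tmap \<equiv> tensor_map k"
abbreviation "tlift \<equiv> tensor_lift k"

declare free_module_simps [simp del]

abbreviation "free_pairs M N \<equiv> free_module k (carrier M \<times> carrier N)"

text \<open>The relations are used in two ways: as an upper bound for the kernel, through the next lemma, and
  as a source of equations between pure tensors, through \<open>tensor_relationsI\<close>.\<close>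

lemma tensor_relations_subset:
  assumes "\<And>x x' y. x \<in> carrier M \<Longrightarrow> x' \<in> carrier M \<Longrightarrow> y \<in> carrier N \<Longrightarrow>
      free_basis k (x \<oplus>\<^bsub>M\<^esub> x', y) \<ominus>\<^bsub>free_pairs M N\<^esub>
        (free_basis k (x, y) \<oplus>\<^bsub>free_pairs M N\<^esub> free_basis k (x', y)) \<in> S"
    and "\<And>x y y'. x \<in> carrier M \<Longrightarrow> y \<in> carrier N \<Longrightarrow> y' \<in> carrier N \<Longrightarrow>
      free_basis k (x, y \<oplus>\<^bsub>N\<^esub> y') \<ominus>\<^bsub>free_pairs M N\<^esub>
        (free_basis k (x, y) \<oplus>\<^bsub>free_pairs M N\<^esub> free_basis k (x, y')) \<in> S"
    and "\<And>a x y. a \<in> carrier k \<Longrightarrow> x \<in> carrier M \<Longrightarrow> y \<in> carrier N \<Longrightarrow>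
      free_basis k (a \<odot>\<^bsub>M\<^esub> x, y) \<ominus>\<^bsub>free_pairs M N\<^esub>
        a \<odot>\<^bsub>free_pairs M N\<^esub> free_basis k (x, y) \<in> S"
    and "\<And>a x y. a \<in> carrier k \<Longrightarrow> x \<in> carrier M \<Longrightarrow> y \<in> carrier N \<Longrightarrow>
      free_basis k (x, a \<odot>\<^bsub>N\<^esub> y) \<ominus>\<^bsub>free_pairs M N\<^esub>
        a \<odot>\<^bsub>free_pairs M N\<^esub> free_basis k (x, y) \<in> S"
  shows "tensor_relations k M N \<subseteq> S"
  unfolding tensor_relations_def Let_def
  by (intro Un_least subsetI; elim CollectE exE conjE; hypsubst; rule assms; assumption)

lemma tensor_relationsI:
  shows "x \<in> carrier M \<Longrightarrow> y \<in> carrier N \<Longrightarrow> x' \<in> carrier M \<Longrightarrow>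
      free_basis k (x \<oplus>\<^bsub>M\<^esub> x', y) \<ominus>\<^bsub>free_pairs M N\<^esub>
        (free_basis k (x, y) \<oplus>\<^bsub>free_pairs M N\<^esub> free_basis k (x', y))
      \<in> tensor_relations k M N"
    and "x \<in> carrier M \<Longrightarrow> y \<in> carrier N \<Longrightarrow> y' \<in> carrier N \<Longrightarrow>
      free_basis k (x, y \<oplus>\<^bsub>N\<^esub> y') \<ominus>\<^bsub>free_pairs M N\<^esub>
        (free_basis k (x, y) \<oplus>\<^bsub>free_pairs M N\<^esub> free_basis k (x, y'))
      \<in> tensor_relations k M N"
    and "x \<in> carrier M \<Longrightarrow> y \<in> carrier N \<Longrightarrow> a \<in> carrier k \<Longrightarrow>
      free_basis k (a \<odot>\<^bsub>M\<^esub> x, y) \<ominus>\<^bsub>free_pairs M N\<^esub>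
        a \<odot>\<^bsub>free_pairs M N\<^esub> free_basis k (x, y)
      \<in> tensor_relations k M N"
    and "x \<in> carrier M \<Longrightarrow> y \<in> carrier N \<Longrightarrow> a \<in> carrier k \<Longrightarrow>
      free_basis k (x, a \<odot>\<^bsub>N\<^esub> y) \<ominus>\<^bsub>free_pairs M N\<^esub>
        a \<odot>\<^bsub>free_pairs M N\<^esub> free_basis k (x, y)
      \<in> tensor_relations k M N"
  unfolding tensor_relations_def Let_def
  subgoal
    by (rule UnI1, rule UnI1, rule UnI1, intro CollectI exI conjI, (rule refl | assumption)+)
  subgoal
    by (rule UnI1, rule UnI1, rule UnI2, intro CollectI exI conjI, (rule refl | assumption)+)
  subgoal
    by (rule UnI1, rule UnI2, intro CollectI exI conjI, (rule refl | assumption)+)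
  subgoal
    by (rule UnI2, intro CollectI exI conjI, (rule refl | assumption)+)
  done

lemma tensor_kernel_submodule:
  assumes M: "module k M" and N: "module k N"
  shows "submodule (tensor_kernel k M N) k (free_pairs M N)"
  unfolding tensor_kernel_def
proof (rule submodule_span[OF module_free])
  interpret M: module k M by (rule M)
  interpret N: module k N by (rule N)
  interpret F: module k "free_pairs M N" by (rule module_free)
  have \<delta>: "free_basis k (x, y) \<in> carrier (free_pairs M N)"
    if "x \<in> carrier M" "y \<in> carrier N" for x y
    using that by (intro free_basis_closed) auto
  show "tensor_relations k M N \<subseteq> carrier (free_pairs M N)"
    by (rule tensor_relations_subset; intro F.minus_closed F.a_closed F.smult_closed \<delta>
        M.a_closed N.a_closed M.smult_closed N.smult_closed; assumption)
qed

lemma tensor_module_projection: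
  assumes M: "module k M" and N: "module k N"
  defines "F \<equiv> free_pairs M N"
  shows "module k (tens M N)"
    and "linear_map k F (tens M N) (\<lambda>c. tensor_kernel k M N +>\<^bsub>F\<^esub> c)"
    and "carrier (tens M N) = (\<lambda>c. tensor_kernel k M N +>\<^bsub>F\<^esub> c) ` carrier F"
  unfolding F_def tensor_module_def
  by (fact quotient_module_facts[OF module_free tensor_kernel_submodule[OF M N]])+

lemmas module_tensor = tensor_module_projection(1)

lemma pure_tensor_bilinear:
  assumes M: "module k M" and N: "module k N"
  shows "bilinear M N (tens M N) (pure M N)"
proof -
  interpret M: module k M by (rule M)
  interpret N: module k N by (rule N)
  let ?F = "free_pairs M N"
  interpret F: module k ?F by (rule module_free)
  note q = linear_mapD[OF tensor_module_projection(2)[OF M N]]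
  have eq: "tensor_kernel k M N +>\<^bsub>?F\<^esub> u = tensor_kernel k M N +>\<^bsub>?F\<^esub> v"
    if "u \<ominus>\<^bsub>?F\<^esub> v \<in> tensor_relations k M N" "u \<in> carrier ?F" "v \<in> carrier ?F" for u v
    unfolding coset_eq_iff[OF module_free tensor_kernel_submodule[OF M N] that(2,3)]
    using subsetD[OF span_incl that(1)] by (simp only: tensor_kernel_def)
  have b: "free_basis k (x, y) \<in> carrier ?F" if "x \<in> carrier M" "y \<in> carrier N" for x y
    using that by (intro free_basis_closed) auto
  show ?thesis
  proof (rule bilinearI)
    fix x assume x: "x \<in> carrier M"
    show "linear_map k N (tens M N) (pure M N x)"
      unfolding pure_tensor_def
    proof (rule linear_mapI)
      fix y y' assume y: "y \<in> carrier N" "y' \<in> carrier N"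
      show "tensor_kernel k M N +>\<^bsub>?F\<^esub> free_basis k (x, y \<oplus>\<^bsub>N\<^esub> y') =
        (tensor_kernel k M N +>\<^bsub>?F\<^esub> free_basis k (x, y)) \<oplus>\<^bsub>tens M N\<^esub>
        (tensor_kernel k M N +>\<^bsub>?F\<^esub> free_basis k (x, y'))"
        unfolding q(2)[OF b[OF x y(1)] b[OF x y(2)], symmetric]
        by (rule eq[OF tensor_relationsI(2)[OF x y]]; intro b F.a_closed N.a_closed x y)
    next
      fix a y assume a: "a \<in> carrier k" and y: "y \<in> carrier N"
      show "tensor_kernel k M N +>\<^bsub>?F\<^esub> free_basis k (x, a \<odot>\<^bsub>N\<^esub> y) =
        a \<odot>\<^bsub>tens M N\<^esub> (tensor_kernel k M N +>\<^bsub>?F\<^esub> free_basis k (x, y))"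
        unfolding q(3)[OF a b[OF x y], symmetric]
        by (rule eq[OF tensor_relationsI(4)[OF x y a]]; intro b F.smult_closed N.smult_closed x y a)
    qed (intro q(1) b x)
  next
    fix y assume y: "y \<in> carrier N"
    show "linear_map k M (tens M N) (\<lambda>x. pure M N x y)"
      unfolding pure_tensor_def
    proof (rule linear_mapI)
      fix x x' assume x: "x \<in> carrier M" "x' \<in> carrier M"
      show "tensor_kernel k M N +>\<^bsub>?F\<^esub> free_basis k (x \<oplus>\<^bsub>M\<^esub> x', y) =
        (tensor_kernel k M N +>\<^bsub>?F\<^esub> free_basis k (x, y)) \<oplus>\<^bsub>tens M N\<^esub>
        (tensor_kernel k M N +>\<^bsub>?F\<^esub> free_basis k (x', y))"
        unfolding q(2)[OF b[OF x(1) y] b[OF x(2) y], symmetric]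
        by (rule eq[OF tensor_relationsI(1)[OF x(1) y x(2)]]; intro b F.a_closed M.a_closed x y)
    next
      fix a x assume a: "a \<in> carrier k" and x: "x \<in> carrier M"
      show "tensor_kernel k M N +>\<^bsub>?F\<^esub> free_basis k (a \<odot>\<^bsub>M\<^esub> x, y) =
        a \<odot>\<^bsub>tens M N\<^esub> (tensor_kernel k M N +>\<^bsub>?F\<^esub> free_basis k (x, y))"
        unfolding q(3)[OF a b[OF x y], symmetric]
        by (rule eq[OF tensor_relationsI(3)[OF x y a]]; intro b F.smult_closed M.smult_closed x y a)
    qed (intro q(1) b y)
  qed
qed

lemmas pure_tensor_closed = bilinearD(3)[OF pure_tensor_bilinear]

lemma tensor_induct [consumes 3, case_names pure add]:
  assumes M: "module k M" and N: "module k N" and u: "u \<in> carrier (tens M N)"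
    and pure: "\<And>x y. x \<in> carrier M \<Longrightarrow> y \<in> carrier N \<Longrightarrow> P (pure M N x y)"
    and add: "\<And>u v. u \<in> carrier (tens M N) \<Longrightarrow> v \<in> carrier (tens M N)
      \<Longrightarrow> P u \<Longrightarrow> P v \<Longrightarrow> P (u \<oplus>\<^bsub>tens M N\<^esub> v)"
  shows "P u"
proof -
  let ?F = "free_pairs M N" and ?T = "tens M N"
  interpret M: module k M by (rule M)
  interpret N: module k N by (rule N)
  interpret F: module k ?F by (rule module_free)
  note proj = tensor_module_projection[OF M N]
  note q = linear_mapD[OF proj(2)]
  obtain c where c: "c \<in> carrier ?F" "u = tensor_kernel k M N +>\<^bsub>?F\<^esub> c"
    using u proj(3) by blast
  have "P (tensor_kernel k M N +>\<^bsub>?F\<^esub> c)"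
    using c(1)
  proof (induction rule: free_module_induct)
    case zero
    have "tensor_kernel k M N +>\<^bsub>?F\<^esub> \<zero>\<^bsub>?F\<^esub> = \<zero>\<^bsub>?T\<^esub>"
      by (rule linear_map_zero[OF module_free proj(1,2)])
    also have "\<dots> = pure M N \<zero>\<^bsub>M\<^esub> \<zero>\<^bsub>N\<^esub>"
      using linear_map_zero[OF N proj(1) bilinearD(1)[OF pure_tensor_bilinear[OF M N] M.zero_closed]]
      by simp
    finally show ?case using pure by (simp add: free_module_simps)
  next
    case (add a b d)
    obtain x y where b: "b = (x, y)" and xy: "x \<in> carrier M" "y \<in> carrier N" using add.hyps by auto
    have \<delta>: "free_basis k b \<in> carrier ?F" using add.hyps by (intro free_basis_closed) auto
    have "tensor_kernel k M N +>\<^bsub>?F\<^esub> (a \<odot>\<^bsub>?F\<^esub> free_basis k b) = a \<odot>\<^bsub>?T\<^esub> pure M N x y"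
      using q(3)[OF add.hyps(1) \<delta>] by (simp add: pure_tensor_def b)
    also have "\<dots> = pure M N (a \<odot>\<^bsub>M\<^esub> x) y"
      using linear_mapD(3)[OF bilinearD(2)[OF pure_tensor_bilinear[OF M N] xy(2)] add.hyps(1) xy(1)]
      by simp
    finally have "P (tensor_kernel k M N +>\<^bsub>?F\<^esub> (a \<odot>\<^bsub>?F\<^esub> free_basis k b))"
      using pure add.hyps(1) xy by simp
    then show ?case
      using assms(5) q(2)[OF F.smult_closed[OF add.hyps(1) \<delta>] add.hyps(3)] q(1) add.IH add.hyps
        F.smult_closed[OF add.hyps(1) \<delta>] by metis
  qed
  then show ?thesis by (simp add: c)
qed

lemma tensor_map_eqI:
  assumes M: "module k M" and N: "module k N"
    and f: "linear_map k (tens M N) P f" and g: "linear_map k (tens M N) P g"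
    and eq: "\<And>x y. x \<in> carrier M \<Longrightarrow> y \<in> carrier N
      \<Longrightarrow> f (pure M N x y) = g (pure M N x y)"
    and u: "u \<in> carrier (tens M N)"
  shows "f u = g u"
  using M N u
proof (induction rule: tensor_induct)
  case (pure x y)
  then show ?case by (rule eq)
next
  case (add u v)
  then show ?case by (simp add: linear_mapD(2)[OF f] linear_mapD(2)[OF g])
qed

lemma tensor_bilinear_eqI:
  assumes M: "module k M" and N: "module k N" and M': "module k M'" and N': "module k N'"
    and f: "bilinear (tens M N) (tens M' N') P f"
    and g: "bilinear (tens M N) (tens M' N') P g"
    and eq: "\<And>x y x' y'. x \<in> carrier M \<Longrightarrow> y \<in> carrier N \<Longrightarrow> x' \<in> carrier M' \<Longrightarrow> y' \<in> carrier N'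
      \<Longrightarrow> f (pure M N x y) (pure M' N' x' y') =
        g (pure M N x y) (pure M' N' x' y')"
    and u: "u \<in> carrier (tens M N)" and v: "v \<in> carrier (tens M' N')"
  shows "f u v = g u v"
proof (rule tensor_map_eqI[OF M N bilinearD(2)[OF f v] bilinearD(2)[OF g v] _ u])
  fix x y assume xy: "x \<in> carrier M" "y \<in> carrier N"
  note p = pure_tensor_closed[OF M N xy]
  show "f (pure M N x y) v = g (pure M N x y) v"
    by (rule tensor_map_eqI[OF M' N' bilinearD(1)[OF f p] bilinearD(1)[OF g p] _ v])
      (rule eq[OF xy])
qed

text \<open>The linear extension of \<open>b\<close> to the free module kills the relations, so it takes the same value on
  all representatives of a tensor and descends to the quotient.\<close>

lemma tensor_lift_exists:
  assumes M: "module k M" and N: "module k N" and P: "module k P" and b: "bilinear M N P b"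
  shows "\<exists>f \<in> linear_maps k (tens M N) P.
    \<forall>x \<in> carrier M. \<forall>y \<in> carrier N. f (pure M N x y) = b x y"
proof -
  let ?F = "free_pairs M N" and ?T = "tens M N"
  let ?K = "tensor_kernel k M N"
  interpret M: module k M by (rule M)
  interpret N: module k N by (rule N)
  interpret P: module k P by (rule P)
  interpret F: module k ?F by (rule module_free)
  define \<phi> where "\<phi> = (\<lambda>(x, y). b x y)"
  define L where "L = free_lift P \<phi>"
  have \<phi>: "\<phi> \<in> carrier M \<times> carrier N \<rightarrow> carrier P"
    using bilinearD(3)[OF b] by (auto simp: \<phi>_def)
  have L: "linear_map k ?F P L"
    unfolding L_def by (rule free_lift_linear(1)[OF P \<phi>])
  note l = linear_mapD[OF L]
  have L\<delta>: "L (free_basis k (x, y)) = b x y" if "x \<in> carrier M" "y \<in> carrier N" for x y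
    using free_lift_linear(2)[OF P \<phi>, of "(x, y)"] that by (simp add: L_def \<phi>_def)
  have \<delta>: "free_basis k (x, y) \<in> carrier ?F" if "x \<in> carrier M" "y \<in> carrier N" for x y
    using that by (intro free_basis_closed) auto
  note L_minus = linear_map_minus[OF module_free P L]
  note b1 = linear_mapD[OF bilinearD(1)[OF b]] and b2 = linear_mapD[OF bilinearD(2)[OF b]]
  have rel: "r \<in> carrier ?F" if "r \<in> tensor_relations k M N" for r
    using subsetD[OF F.submoduleE(1)[OF tensor_kernel_submodule[OF M N]]] subsetD[OF span_incl that]
    unfolding tensor_kernel_def .
  have self: "p \<ominus>\<^bsub>P\<^esub> p = \<zero>\<^bsub>P\<^esub>" if "p \<in> carrier P" for p
    using that by (simp add: a_minus_def P.r_neg)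
  have "tensor_relations k M N \<subseteq> {r. r \<in> tensor_relations k M N \<longrightarrow> L r = \<zero>\<^bsub>P\<^esub>}"
    by (rule tensor_relations_subset; intro CollectI impI)
      (simp_all add: L_minus l(1-3) L\<delta> \<delta> F.a_closed F.smult_closed b1 b2 self)
  then have "tensor_relations k M N \<subseteq> {c \<in> carrier ?F. L c = \<zero>\<^bsub>P\<^esub>}"
    using rel by blast
  then have "?K \<subseteq> {c \<in> carrier ?F. L c = \<zero>\<^bsub>P\<^esub>}"
    unfolding tensor_kernel_def by (intro span_least submodule_kernel[OF module_free P L])
  then have LK: "L c = \<zero>\<^bsub>P\<^esub>" if "c \<in> ?K" for c using that by blast
  note proj = tensor_module_projection[OF M N]
  note q = linear_mapD[OF proj(2)]
  interpret K: abelian_subgroup ?K ?F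
    by (intro abelian_subgroupI3 additive_subgroup.intro module.axioms[OF module_free]
        submodule.axioms[OF tensor_kernel_submodule[OF M N]])
  define f where "f = (\<lambda>X \<in> carrier ?T. L (SOME c. c \<in> X))"
  have f: "f (?K +>\<^bsub>?F\<^esub> c) = L c" if c: "c \<in> carrier ?F" for c
  proof -
    define d where "d = (SOME d. d \<in> ?K +>\<^bsub>?F\<^esub> c)"
    have d: "d \<in> ?K +>\<^bsub>?F\<^esub> c"
      unfolding d_def by (rule someI[of "\<lambda>d. d \<in> ?K +>\<^bsub>?F\<^esub> c"]) (rule K.a_rcos_self[OF c])
    have dc: "d \<in> carrier ?F" using K.a_elemrcos_carrier[OF c d] .
    have "d \<ominus>\<^bsub>?F\<^esub> c \<in> ?K" using K.a_rcos_module[OF c dc] d by (simp only: a_minus_def)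
    then have "L d \<ominus>\<^bsub>P\<^esub> L c = \<zero>\<^bsub>P\<^esub>" using LK L_minus[OF dc c] by simp
    moreover have "L d = (L d \<ominus>\<^bsub>P\<^esub> L c) \<oplus>\<^bsub>P\<^esub> L c"
      using l(1)[OF c] l(1)[OF dc] by (simp add: a_minus_def P.a_assoc P.l_neg)
    ultimately have "L d = L c" using l(1)[OF c] by simp
    then show ?thesis using proj(3) c by (simp add: f_def d_def)
  qed
  have "linear_map k ?T P f"
  proof (rule linear_mapI)
    fix X assume "X \<in> carrier ?T"
    then obtain c where c: "c \<in> carrier ?F" "X = ?K +>\<^bsub>?F\<^esub> c" using proj(3) by blast
    show "f X \<in> carrier P" unfolding c(2) f[OF c(1)] by (rule l(1)[OF c(1)])
    fix Y assume "Y \<in> carrier ?T"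
    then obtain d where d: "d \<in> carrier ?F" "Y = ?K +>\<^bsub>?F\<^esub> d" using proj(3) by blast
    show "f (X \<oplus>\<^bsub>?T\<^esub> Y) = f X \<oplus>\<^bsub>P\<^esub> f Y"
      unfolding c(2) d(2) f[OF c(1)] f[OF d(1)] q(2)[OF c(1) d(1), symmetric]
        f[OF F.a_closed[OF c(1) d(1)]] by (rule l(2)[OF c(1) d(1)])
  next
    fix a X assume a: "a \<in> carrier k" and "X \<in> carrier ?T"
    then obtain c where c: "c \<in> carrier ?F" "X = ?K +>\<^bsub>?F\<^esub> c" using proj(3) by blast
    show "f (a \<odot>\<^bsub>?T\<^esub> X) = a \<odot>\<^bsub>P\<^esub> f X"
      unfolding c(2) f[OF c(1)] q(3)[OF a c(1), symmetric] f[OF F.smult_closed[OF a c(1)]]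
      by (rule l(3)[OF a c(1)])
  qed
  moreover have "f \<in> extensional (carrier ?T)" by (simp add: f_def)
  moreover have "f (pure M N x y) = b x y" if "x \<in> carrier M" "y \<in> carrier N" for x y
    unfolding pure_tensor_def f[OF \<delta>[OF that]] by (rule L\<delta>[OF that])
  ultimately show ?thesis by (auto simp: linear_maps_def)
qed

lemma tensor_lift_facts:
  assumes M: "module k M" and N: "module k N" and P: "module k P" and b: "bilinear M N P b"
  shows "tlift M N P b \<in> linear_maps k (tens M N) P
    \<and> (\<forall>x \<in> carrier M. \<forall>y \<in> carrier N. tlift M N P b (pure M N x y) = b x y)"
proof -
  obtain f where f: "f \<in> linear_maps k (tens M N) P"
    "\<forall>x \<in> carrier M. \<forall>y \<in> carrier N. f (pure M N x y) = b x y"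
    using tensor_lift_exists[OF assms] by blast
  have ex1: "\<exists>!f. f \<in> linear_maps k (tens M N) P \<and>
    (\<forall>x \<in> carrier M. \<forall>y \<in> carrier N. f (pure M N x y) = b x y)"
  proof (rule ex1I[of _ f])
    show "f \<in> linear_maps k (tens M N) P \<and>
      (\<forall>x \<in> carrier M. \<forall>y \<in> carrier N. f (pure M N x y) = b x y)"
      by (rule conjI[OF f])
  next
    fix g assume g: "g \<in> linear_maps k (tens M N) P \<and>
      (\<forall>x \<in> carrier M. \<forall>y \<in> carrier N. g (pure M N x y) = b x y)"
    show "g = f"
    proof (rule extensionalityI)
      show "g \<in> extensional (carrier (tens M N))"
        "f \<in> extensional (carrier (tens M N))"
        using f g by (auto simp: linear_maps_def)
      fix u assume "u \<in> carrier (tens M N)"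
      then show "g u = f u"
        using f g by - (rule tensor_map_eqI[OF M N, of P g f], simp_all add: linear_maps_def)
    qed
  qed
  show ?thesis
    using theI'[OF ex1] unfolding tensor_lift_def .
qed

lemma tensor_lift_linear:
  assumes "module k M" "module k N" "module k P" "bilinear M N P b"
  shows "linear_map k (tens M N) P (tlift M N P b)"
  using tensor_lift_facts[OF assms] by (simp add: linear_maps_def)

lemma tensor_lift_pure:
  assumes "module k M" "module k N" "module k P" "bilinear M N P b"
    and "x \<in> carrier M" "y \<in> carrier N"
  shows "tlift M N P b (pure M N x y) = b x y"
  using tensor_lift_facts[OF assms(1-4)] assms(5,6) by simp

lemma tensor_lift_unique:
  assumes M: "module k M" and N: "module k N" and P: "module k P"
    and f: "linear_map k (tens M N) P f"
    and eq: "\<And>x y. x \<in> carrier M \<Longrightarrow> y \<in> carrier N \<Longrightarrow> f (pure M N x y) = b x y"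
    and u: "u \<in> carrier (tens M N)"
  shows "tlift M N P b u = f u"
proof -
  have B: "bilinear M N P (\<lambda>x y. f (pure M N x y))"
    by (rule bilinear_compose[OF pure_tensor_bilinear[OF M N] linear_map_id linear_map_id f])
  have b: "bilinear M N P b"
  proof (rule bilinearI)
    show "linear_map k N P (b x)" if "x \<in> carrier M" for x
      by (rule linear_map_cong[OF bilinearD(1)[OF B that] _ N]) (rule eq[OF that])
    show "linear_map k M P (\<lambda>x. b x y)" if "y \<in> carrier N" for y
      by (rule linear_map_cong[OF bilinearD(2)[OF B that] _ M]) (rule eq[OF _ that])
  qed
  show ?thesis
    by (rule tensor_map_eqI[OF M N tensor_lift_linear[OF M N P b] f _ u])
      (simp add: tensor_lift_pure[OF M N P b] eq)
qed

lemma tensor_lift_cong: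
  assumes "\<And>x y. x \<in> carrier M \<Longrightarrow> y \<in> carrier N \<Longrightarrow> b x y = b' x y"
  shows "tlift M N P b = tlift M N P b'"
  unfolding tensor_lift_def by (simp add: assms cong: ball_cong)

text \<open>In a nested Sweedler sum the bilinear map of the inner sum contains components of the outer one.
  Linearity in such a parameter is what allows the outer sum to be lifted in turn.\<close>

lemma tensor_lift_linear_parameter:
  assumes M: "module k M" and N: "module k N" and P: "module k P" and W: "module k W"
    and b: "\<And>w. w \<in> carrier W \<Longrightarrow> bilinear M N P (b w)"
    and lin: "\<And>x y. x \<in> carrier M \<Longrightarrow> y \<in> carrier N \<Longrightarrow> linear_map k W P (\<lambda>w. b w x y)"
    and u: "u \<in> carrier (tens M N)"
  shows "linear_map k W P (\<lambda>w. tlift M N P (b w) u)"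
proof -
  interpret P: module k P by (rule P)
  interpret W: module k W by (rule W)
  note L = tensor_lift_linear[OF M N P b]
  note l = linear_mapD[OF L] and lp = tensor_lift_pure[OF M N P b]
  show ?thesis
    using M N u
  proof (induction rule: tensor_induct)
    case (pure x y)
    then show ?case
      by (intro linear_map_cong[OF lin[OF pure] _ W]) (simp add: lp)
  next
    case (add u v)
    show ?case
    proof (rule linear_mapI)
      fix w assume "w \<in> carrier W"
      then show "tlift M N P (b w) (u \<oplus>\<^bsub>tens M N\<^esub> v) \<in> carrier P"
        using l(1) l(2) add by simp
    next
      fix w w' assume w: "w \<in> carrier W" "w' \<in> carrier W"
      show "tlift M N P (b (w \<oplus>\<^bsub>W\<^esub> w')) (u \<oplus>\<^bsub>tens M N\<^esub> v) =
        tlift M N P (b w) (u \<oplus>\<^bsub>tens M N\<^esub> v) \<oplus>\<^bsub>P\<^esub>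
        tlift M N P (b w') (u \<oplus>\<^bsub>tens M N\<^esub> v)"
        using w add l(1) linear_mapD(2)[OF add.IH(1) w] linear_mapD(2)[OF add.IH(2) w]
        by (simp add: l(2) P.a_ac)
    next
      fix a w assume a: "a \<in> carrier k" and w: "w \<in> carrier W"
      show "tlift M N P (b (a \<odot>\<^bsub>W\<^esub> w)) (u \<oplus>\<^bsub>tens M N\<^esub> v) =
        a \<odot>\<^bsub>P\<^esub> tlift M N P (b w) (u \<oplus>\<^bsub>tens M N\<^esub> v)"
        using a w add l(1) linear_mapD(3)[OF add.IH(1) a w] linear_mapD(3)[OF add.IH(2) a w]
        by (simp add: l(2) P.smult_r_distr)
    qed
  qed
qed

section \<open>Functoriality and associativity of the tensor product\<close>

lemma tensor_map_bilinear:
  assumes "module k M'" "module k N'" "linear_map k M M' f" "linear_map k N N' g"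
  shows "bilinear M N (tens M' N') (\<lambda>x y. pure M' N' (f x) (g y))"
  using bilinear_compose[OF pure_tensor_bilinear[OF assms(1,2)] assms(3,4) linear_map_id] .

lemma tensor_map_linear:
  assumes "module k M" "module k N" "module k M'" "module k N'"
    and "linear_map k M M' f" "linear_map k N N' g"
  shows "linear_map k (tens M N) (tens M' N') (tmap M M' N N' f g)"
  unfolding tensor_map_def
  by (intro tensor_lift_linear tensor_map_bilinear module_tensor assms)

lemma tensor_map_pure:
  assumes "module k M" "module k N" "module k M'" "module k N'"
    and "linear_map k M M' f" "linear_map k N N' g" "x \<in> carrier M" "y \<in> carrier N"
  shows "tmap M M' N N' f g (pure M N x y) = pure M' N' (f x) (g y)"
  unfolding tensor_map_def
  by (intro tensor_lift_pure tensor_map_bilinear module_tensor assms)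

lemma tensor_map_cong:
  assumes "\<And>x. x \<in> carrier M \<Longrightarrow> f x = f' x" "\<And>y. y \<in> carrier N \<Longrightarrow> g y = g' y"
  shows "tmap M M' N N' f g = tmap M M' N N' f' g'"
  unfolding tensor_map_def by (rule tensor_lift_cong) (simp add: assms)

lemma tensor_map_id:
  assumes "module k M" "module k N" "u \<in> carrier (tens M N)"
  shows "tmap M M N N (\<lambda>x. x) (\<lambda>y. y) u = u"
  unfolding tensor_map_def
  by (rule tensor_lift_unique[OF assms(1,2) _ linear_map_id])
    (simp_all add: module_tensor assms)

lemma tensor_map_compose:
  assumes "module k M" "module k N" "module k M'" "module k N'" "module k M''" "module k N''"
    and "linear_map k M M' f" "linear_map k N N' g" "linear_map k M' M'' f'" "linear_map k N' N'' g'"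
    and "u \<in> carrier (tens M N)"
  shows "tmap M' M'' N' N'' f' g' (tmap M M' N N' f g u) =
    tmap M M'' N N'' (\<lambda>x. f' (f x)) (\<lambda>y. g' (g y)) u"
proof -
  have "linear_map k (tens M N) (tens M'' N'')
      (\<lambda>u. tmap M' M'' N' N'' f' g' (tmap M M' N N' f g u))"
    using linear_map_compose[OF tensor_map_linear[OF assms(1-4,7,8)] tensor_map_linear[OF assms(3-6,9,10)]] .
  moreover have "linear_map k (tens M N) (tens M'' N'')
      (tmap M M'' N N'' (\<lambda>x. f' (f x)) (\<lambda>y. g' (g y)))"
    by (intro tensor_map_linear linear_map_compose[OF assms(7,9)] linear_map_compose[OF assms(8,10)] assms)
  ultimately show ?thesis
    by (rule tensor_map_eqI[OF assms(1,2) _ _ _ assms(11)])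
      (simp add: tensor_map_pure assms linear_mapD(1)[OF assms(7)] linear_mapD(1)[OF assms(8)]
        linear_map_compose[OF assms(7,9)] linear_map_compose[OF assms(8,10)])
qed

text \<open>The inverse of \<^const>\<open>tensor_assoc\<close>.\<close>

definition tensor_unassoc where
  "tensor_unassoc M N P =
    (let MN = tens M N; MNP = tens MN P in
      tlift M (tens N P) MNP
        (\<lambda>x. tlift N P MNP (\<lambda>y z. pure MN P (pure M N x y) z)))"

lemma tensor_assoc_bilinear:
  assumes M: "module k M" and N: "module k N" and P: "module k P"
  defines "MNP \<equiv> tens M (tens N P)"
  shows "z \<in> carrier P \<Longrightarrow>
      bilinear M N MNP (\<lambda>x y. pure M (tens N P) x (pure N P y z))"
    and "bilinear (tens M N) P MNP (\<lambda>u z. tlift M N MNP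
      (\<lambda>x y. pure M (tens N P) x (pure N P y z)) u)"
proof -
  note mods = M N P module_tensor[OF N P] module_tensor[OF M module_tensor[OF N P]]
  show *: "bilinear M N MNP (\<lambda>x y. pure M (tens N P) x (pure N P y z))"
    if "z \<in> carrier P" for z
    unfolding MNP_def
    by (rule bilinear_compose[OF pure_tensor_bilinear[OF M module_tensor[OF N P]] linear_map_id
          bilinearD(2)[OF pure_tensor_bilinear[OF N P] that] linear_map_id])
  show "bilinear (tens M N) P MNP (\<lambda>u z. tlift M N MNP
      (\<lambda>x y. pure M (tens N P) x (pure N P y z)) u)"
  proof (rule bilinearI)
    fix u assume "u \<in> carrier (tens M N)"
    then show "linear_map k P MNP (\<lambda>z. tlift M N MNP
        (\<lambda>x y. pure M (tens N P) x (pure N P y z)) u)"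
    proof (intro tensor_lift_linear_parameter * M N P)
      show "module k MNP" using mods by (simp add: MNP_def)
      fix x y assume "x \<in> carrier M" "y \<in> carrier N"
      then show "linear_map k P MNP
          (\<lambda>w. pure M (tens N P) x (pure N P y w))"
        unfolding MNP_def
        by (intro linear_map_compose[OF bilinearD(1)[OF pure_tensor_bilinear[OF N P]]
              bilinearD(1)[OF pure_tensor_bilinear[OF M module_tensor[OF N P]]]])
    qed
  next
    fix z assume "z \<in> carrier P"
    then show "linear_map k (tens M N) MNP (\<lambda>u. tlift M N MNP
        (\<lambda>x y. pure M (tens N P) x (pure N P y z)) u)"
      using tensor_lift_linear[OF M N _ *] mods by (simp add: MNP_def)
  qed
qed

lemma tensor_assoc_linear:
  assumes M: "module k M" and N: "module k N" and P: "module k P"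
  shows "linear_map k (tens (tens M N) P)
    (tens M (tens N P)) (tensor_assoc k M N P)"
  unfolding tensor_assoc_def Let_def
  by (intro tensor_lift_linear module_tensor tensor_assoc_bilinear(2)[OF M N P] assms)

lemma tensor_assoc_pure:
  assumes M: "module k M" and N: "module k N" and P: "module k P"
    and x: "x \<in> carrier M" and y: "y \<in> carrier N" and z: "z \<in> carrier P"
  shows "tensor_assoc k M N P (pure (tens M N) P (pure M N x y) z) =
    pure M (tens N P) x (pure N P y z)"
  unfolding tensor_assoc_def Let_def
  using tensor_lift_pure[OF module_tensor[OF M N] P module_tensor[OF M module_tensor[OF N P]]
      tensor_assoc_bilinear(2)[OF M N P] pure_tensor_closed[OF M N x y] z]
    tensor_lift_pure[OF M N module_tensor[OF M module_tensor[OF N P]]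
      tensor_assoc_bilinear(1)[OF M N P z] x y]
  by simp

lemma tensor_unassoc_bilinear:
  assumes M: "module k M" and N: "module k N" and P: "module k P"
  defines "MNP \<equiv> tens (tens M N) P"
  shows "x \<in> carrier M \<Longrightarrow>
      bilinear N P MNP (\<lambda>y z. pure (tens M N) P (pure M N x y) z)"
    and "bilinear M (tens N P) MNP (\<lambda>x. tlift N P MNP
      (\<lambda>y z. pure (tens M N) P (pure M N x y) z))"
proof -
  note mods = M N P module_tensor[OF M N] module_tensor[OF module_tensor[OF M N] P]
  show *: "bilinear N P MNP (\<lambda>y z. pure (tens M N) P (pure M N x y) z)"
    if "x \<in> carrier M" for x
    unfolding MNP_def
    by (rule bilinear_compose[OF pure_tensor_bilinear[OF module_tensor[OF M N] P]
          bilinearD(1)[OF pure_tensor_bilinear[OF M N] that] linear_map_id linear_map_id])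
  show "bilinear M (tens N P) MNP (\<lambda>x. tlift N P MNP
      (\<lambda>y z. pure (tens M N) P (pure M N x y) z))"
  proof (rule bilinearI)
    fix u assume "u \<in> carrier (tens N P)"
    then show "linear_map k M MNP (\<lambda>x. tlift N P MNP
        (\<lambda>y z. pure (tens M N) P (pure M N x y) z) u)"
    proof (intro tensor_lift_linear_parameter * M N P)
      show "module k MNP" using mods by (simp add: MNP_def)
      fix y z assume "y \<in> carrier N" "z \<in> carrier P"
      then show "linear_map k M MNP
          (\<lambda>w. pure (tens M N) P (pure M N w y) z)"
        unfolding MNP_def
        by (intro linear_map_compose[OF bilinearD(2)[OF pure_tensor_bilinear[OF M N]]
              bilinearD(2)[OF pure_tensor_bilinear[OF module_tensor[OF M N] P]]])
    qed
  next
    fix x assume "x \<in> carrier M"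
    then show "linear_map k (tens N P) MNP (tlift N P MNP
        (\<lambda>y z. pure (tens M N) P (pure M N x y) z))"
      using tensor_lift_linear[OF N P _ *] mods by (simp add: MNP_def)
  qed
qed

lemma tensor_unassoc_linear:
  assumes M: "module k M" and N: "module k N" and P: "module k P"
  shows "linear_map k (tens M (tens N P))
    (tens (tens M N) P) (tensor_unassoc M N P)"
  unfolding tensor_unassoc_def Let_def
  by (intro tensor_lift_linear module_tensor tensor_unassoc_bilinear(2)[OF M N P] assms)

lemma tensor_unassoc_pure:
  assumes M: "module k M" and N: "module k N" and P: "module k P"
    and x: "x \<in> carrier M" and y: "y \<in> carrier N" and z: "z \<in> carrier P"
  shows "tensor_unassoc M N P (pure M (tens N P) x (pure N P y z)) =
    pure (tens M N) P (pure M N x y) z"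
  unfolding tensor_unassoc_def Let_def
  using tensor_lift_pure[OF M module_tensor[OF N P] module_tensor[OF module_tensor[OF M N] P]
      tensor_unassoc_bilinear(2)[OF M N P] x pure_tensor_closed[OF N P y z]]
    tensor_lift_pure[OF N P module_tensor[OF module_tensor[OF M N] P]
      tensor_unassoc_bilinear(1)[OF M N P x] y z]
  by simp

lemma tensor_map_eqI_left:
  assumes M: "module k M" and N: "module k N" and P: "module k P" and Q: "module k Q"
    and f: "linear_map k (tens (tens M N) P) Q f"
    and g: "linear_map k (tens (tens M N) P) Q g"
    and eq: "\<And>x y z. x \<in> carrier M \<Longrightarrow> y \<in> carrier N \<Longrightarrow> z \<in> carrier P
      \<Longrightarrow> f (pure (tens M N) P (pure M N x y) z) =
        g (pure (tens M N) P (pure M N x y) z)"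
    and u: "u \<in> carrier (tens (tens M N) P)"
  shows "f u = g u"
proof (rule tensor_map_eqI[OF module_tensor[OF M N] P f g _ u])
  fix v z assume v: "v \<in> carrier (tens M N)" and z: "z \<in> carrier P"
  note lin = bilinearD(2)[OF pure_tensor_bilinear[OF module_tensor[OF M N] P] z]
  show "f (pure (tens M N) P v z) = g (pure (tens M N) P v z)"
    by (rule tensor_map_eqI[OF M N linear_map_compose[OF lin f] linear_map_compose[OF lin g] _ v])
      (rule eq[OF _ _ z])
qed

lemma tensor_map_eqI_right:
  assumes M: "module k M" and N: "module k N" and P: "module k P" and Q: "module k Q"
    and f: "linear_map k (tens M (tens N P)) Q f"
    and g: "linear_map k (tens M (tens N P)) Q g"
    and eq: "\<And>x y z. x \<in> carrier M \<Longrightarrow> y \<in> carrier N \<Longrightarrow> z \<in> carrier P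
      \<Longrightarrow> f (pure M (tens N P) x (pure N P y z)) =
        g (pure M (tens N P) x (pure N P y z))"
    and u: "u \<in> carrier (tens M (tens N P))"
  shows "f u = g u"
proof (rule tensor_map_eqI[OF M module_tensor[OF N P] f g _ u])
  fix x v assume x: "x \<in> carrier M" and v: "v \<in> carrier (tens N P)"
  note lin = bilinearD(1)[OF pure_tensor_bilinear[OF M module_tensor[OF N P]] x]
  show "f (pure M (tens N P) x v) = g (pure M (tens N P) x v)"
    by (rule tensor_map_eqI[OF N P linear_map_compose[OF lin f] linear_map_compose[OF lin g] _ v])
      (rule eq[OF x])
qed

lemma tensor_unassoc_assoc:
  assumes M: "module k M" and N: "module k N" and P: "module k P"
    and u: "u \<in> carrier (tens (tens M N) P)"
  shows "tensor_unassoc M N P (tensor_assoc k M N P u) = u"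
  by (rule tensor_map_eqI_left[OF M N P module_tensor[OF module_tensor[OF M N] P]
        linear_map_compose[OF tensor_assoc_linear[OF M N P] tensor_unassoc_linear[OF M N P]]
        linear_map_id _ u])
    (simp add: tensor_assoc_pure tensor_unassoc_pure M N P)

lemma tensor_assoc_unassoc:
  assumes M: "module k M" and N: "module k N" and P: "module k P"
    and u: "u \<in> carrier (tens M (tens N P))"
  shows "tensor_assoc k M N P (tensor_unassoc M N P u) = u"
  by (rule tensor_map_eqI_right[OF M N P module_tensor[OF M module_tensor[OF N P]]
        linear_map_compose[OF tensor_unassoc_linear[OF M N P] tensor_assoc_linear[OF M N P]]
        linear_map_id _ u])
    (simp add: tensor_assoc_pure tensor_unassoc_pure M N P)

end

section \<open>Actions of a prebialgebra on tensor products\<close>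

context scalar_ring
begin

lemma module_self: "module k (self_module k)"
proof (rule moduleI)
  show "abelian_group (self_module k)"
  proof (rule abelian_groupI)
    fix x assume "x \<in> carrier (self_module k)"
    then show "\<exists>y \<in> carrier (self_module k). y \<oplus>\<^bsub>self_module k\<^esub> x = \<zero>\<^bsub>self_module k\<^esub>"
      by (intro bexI[of _ "\<ominus>\<^bsub>k\<^esub> x"]) (simp_all add: self_module_def k.l_neg)
  qed (simp_all add: self_module_def k.a_ac)
qed (auto simp: self_module_def k.l_distr k.r_distr k.m_assoc scalar_cring)

lemma self_module_simps [simp]:
  "carrier (self_module k) = carrier k" "x \<odot>\<^bsub>self_module k\<^esub> y = x \<otimes>\<^bsub>k\<^esub> y"
  "x \<oplus>\<^bsub>self_module k\<^esub> y = x \<oplus>\<^bsub>k\<^esub> y"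
  by (simp_all add: self_module_def)

lemma tensor_assoc_natural:
  assumes M: "module k M" and N: "module k N" and P: "module k P"
    and M': "module k M'" and N': "module k N'" and P': "module k P'"
    and f: "linear_map k M M' f" and g: "linear_map k N N' g" and h: "linear_map k P P' h"
    and u: "u \<in> carrier (tens (tens M N) P)"
  shows "tensor_assoc k M' N' P' (tmap (tens M N) (tens M' N') P P'
      (tmap M M' N N' f g) h u) =
    tmap M M' (tens N P) (tens N' P') f (tmap N N' P P' g h)
      (tensor_assoc k M N P u)"
proof -
  note mods = M N P M' N' P' module_tensor[OF M N] module_tensor[OF N P] module_tensor[OF M' N']
    module_tensor[OF N' P']
  note fg = tensor_map_linear[OF M N M' N' f g] and gh = tensor_map_linear[OF N P N' P' g h]
  note L = linear_map_compose[OF tensor_map_linear[OF mods(7) P mods(9) P' fg h]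
      tensor_assoc_linear[OF M' N' P']]
  note R = linear_map_compose[OF tensor_assoc_linear[OF M N P]
      tensor_map_linear[OF M mods(8) M' mods(10) f gh]]
  show ?thesis
    by (rule tensor_map_eqI_left[OF M N P module_tensor[OF M' mods(10)] L R _ u])
      (simp add: tensor_map_pure tensor_assoc_pure mods fg gh f g h pure_tensor_closed
        linear_mapD(1)[OF f] linear_mapD(1)[OF g] linear_mapD(1)[OF h])
qed

end

sublocale prebialgebra \<subseteq> scalar_ring k by (rule scalar_ring.intro[OF k_cring])

sublocale prebialgebra \<subseteq> H: ring H by (rule H_ring)

context prebialgebra
begin

abbreviation unit_H ("1\<^sub>H") where "1\<^sub>H \<equiv> \<one>\<^bsub>H\<^esub>"
abbreviation mult_H (infixl "\<cdot>" 70) where "x \<cdot> y \<equiv> x \<otimes>\<^bsub>H\<^esub> y"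
abbreviation "lmod \<equiv> left_module k H"
abbreviation "lten \<equiv> ltensor k H \<Delta>"
abbreviation "Ten \<equiv> Mod_tensor k H \<Delta>"
abbreviation "TenMap \<equiv> Mod_tensor_map k H \<Delta>"
abbreviation "Assoc \<equiv> Mod_assoc k H \<Delta>"
abbreviation "LUnit \<equiv> Mod_left_unit k H \<Delta> \<epsilon>"
abbreviation "RUnit \<equiv> Mod_right_unit k H \<Delta> \<epsilon>"
abbreviation "decode \<equiv> tensor_decode k H \<Delta>"

abbreviation HH where "HH \<equiv> tens H H"

lemmas module_HH = module_tensor[OF H_module H_module]

lemmas comult_closed = linear_mapD(1)[OF comult_linear]

lemma counit_closed: "x \<in> carrier H \<Longrightarrow> \<epsilon> x \<in> carrier k"
  using linear_mapD(1)[OF counit_linear] by simp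

lemma counit_mult_closed: "a \<in> carrier H \<Longrightarrow> b \<in> carrier H \<Longrightarrow> \<epsilon> (a \<cdot> b) \<in> carrier k"
  by (simp add: counit_closed)

lemma mult_bilinear: "bilinear H H H (mult H)"
  by (intro bilinearI linear_mapI)
    (auto simp: H.l_distr H.r_distr smult_mult_left[symmetric] smult_mult_right[symmetric])

text \<open>An action whose unit may act as any idempotent. The diagonal action on \<open>M \<otimes> N\<close> is of this kind
  even when \<open>M\<close> and \<open>N\<close> are unital, so iterated tensor products need this generality.\<close>

definition semiaction where
  "semiaction M \<mu> \<longleftrightarrow> bilinear H M M \<mu> \<and>
    (\<forall>h \<in> carrier H. \<forall>h' \<in> carrier H. \<forall>x \<in> carrier M. \<mu> (h \<cdot> h') x = \<mu> h (\<mu> h' x))"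

lemma semiactionD:
  assumes "semiaction M \<mu>"
  shows "bilinear H M M \<mu>"
    and "h \<in> carrier H \<Longrightarrow> h' \<in> carrier H \<Longrightarrow> x \<in> carrier M \<Longrightarrow> \<mu> (h \<cdot> h') x = \<mu> h (\<mu> h' x)"
  using assms by (auto simp: semiaction_def)

lemmas semiaction_closed = bilinearD(3)[OF semiactionD(1)]

lemma mult_semiaction: "semiaction H (mult H)"
  by (simp add: semiaction_def mult_bilinear H.m_assoc)

lemma tensor_act_bilinear:
  assumes M: "module k M" and N: "module k N"
    and \<mu>: "bilinear H M M \<mu>" and \<nu>: "bilinear H N N \<nu>"
  shows "bilinear HH (tens M N) (tens M N) (tensor_act k H M N \<mu> \<nu>)"
    and "u \<in> carrier (tens M N) \<Longrightarrow>
      bilinear H H (tens M N) (\<lambda>a b. tmap M M N N (\<mu> a) (\<nu> b) u)"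
proof -
  note MN = module_tensor[OF M N]
  show *: "bilinear H H (tens M N) (\<lambda>a b. tmap M M N N (\<mu> a) (\<nu> b) u)"
    if u: "u \<in> carrier (tens M N)" for u
  proof (rule bilinearI)
    fix a assume a: "a \<in> carrier H"
    show "linear_map k H (tens M N) (\<lambda>b. tmap M M N N (\<mu> a) (\<nu> b) u)"
      unfolding tensor_map_def
    proof (rule tensor_lift_linear_parameter[OF M N MN H_module _ _ u])
      show "bilinear M N (tens M N) (\<lambda>x y. pure M N (\<mu> a x) (\<nu> b y))"
        if b: "b \<in> carrier H" for b
        by (rule tensor_map_bilinear[OF M N bilinearD(1)[OF \<mu> a] bilinearD(1)[OF \<nu> b]])
      fix x y assume x: "x \<in> carrier M" and y: "y \<in> carrier N"
      show "linear_map k H (tens M N) (\<lambda>b. pure M N (\<mu> a x) (\<nu> b y))"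
        by (rule linear_map_compose[OF bilinearD(2)[OF \<nu> y]
              bilinearD(1)[OF pure_tensor_bilinear[OF M N] bilinearD(3)[OF \<mu> a x]]])
    qed
  next
    fix b assume b: "b \<in> carrier H"
    show "linear_map k H (tens M N) (\<lambda>a. tmap M M N N (\<mu> a) (\<nu> b) u)"
      unfolding tensor_map_def
    proof (rule tensor_lift_linear_parameter[OF M N MN H_module _ _ u])
      show "bilinear M N (tens M N) (\<lambda>x y. pure M N (\<mu> a x) (\<nu> b y))"
        if a: "a \<in> carrier H" for a
        by (rule tensor_map_bilinear[OF M N bilinearD(1)[OF \<mu> a] bilinearD(1)[OF \<nu> b]])
      fix x y assume x: "x \<in> carrier M" and y: "y \<in> carrier N"
      show "linear_map k H (tens M N) (\<lambda>a. pure M N (\<mu> a x) (\<nu> b y))"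
        by (rule linear_map_compose[OF bilinearD(2)[OF \<mu> x]
              bilinearD(2)[OF pure_tensor_bilinear[OF M N] bilinearD(3)[OF \<nu> b y]]])
    qed
  qed
  show "bilinear HH (tens M N) (tens M N) (tensor_act k H M N \<mu> \<nu>)"
    unfolding tensor_act_def
  proof (rule bilinearI)
    fix w assume w: "w \<in> carrier HH"
    show "linear_map k (tens M N) (tens M N) (\<lambda>u. tlift H H
        (tens M N) (\<lambda>a b. tmap M M N N (\<mu> a) (\<nu> b) u) w)"
    proof (rule tensor_lift_linear_parameter[OF H_module H_module MN MN * _ w])
      fix a b assume a: "a \<in> carrier H" and b: "b \<in> carrier H"
      show "linear_map k (tens M N) (tens M N)
          (tmap M M N N (\<mu> a) (\<nu> b))"
        by (rule tensor_map_linear[OF M N M N bilinearD(1)[OF \<mu> a] bilinearD(1)[OF \<nu> b]])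
    qed
  next
    fix u assume u: "u \<in> carrier (tens M N)"
    show "linear_map k HH (tens M N) (tlift H H
        (tens M N) (\<lambda>a b. tmap M M N N (\<mu> a) (\<nu> b) u))"
      by (rule tensor_lift_linear[OF H_module H_module MN *[OF u]])
  qed
qed

lemma tensor_act_pure_left:
  assumes "module k M" "module k N" "bilinear H M M \<mu>" "bilinear H N N \<nu>"
    and "a \<in> carrier H" "b \<in> carrier H" "u \<in> carrier (tens M N)"
  shows "tensor_act k H M N \<mu> \<nu> (pure H H a b) u = tmap M M N N (\<mu> a) (\<nu> b) u"
  unfolding tensor_act_def
  by (rule tensor_lift_pure[OF H_module H_module module_tensor[OF assms(1,2)]
        tensor_act_bilinear(2)[OF assms(1-4,7)] assms(5,6)])

lemma tensor_act_pure:
  assumes "module k M" "module k N" "bilinear H M M \<mu>" "bilinear H N N \<nu>"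
    and "a \<in> carrier H" "b \<in> carrier H" "x \<in> carrier M" "y \<in> carrier N"
  shows "tensor_act k H M N \<mu> \<nu> (pure H H a b) (pure M N x y) =
    pure M N (\<mu> a x) (\<nu> b y)"
  using tensor_act_pure_left[OF assms(1-6) pure_tensor_closed[OF assms(1,2,7,8)]]
    tensor_map_pure[OF assms(1,2,1,2) bilinearD(1)[OF assms(3,5)] bilinearD(1)[OF assms(4,6)]
      assms(7,8)] by simp

text \<open>For fixed \<open>x\<close> and \<open>y\<close> the orbit map \<open>w \<mapsto> w \<cdot> (x \<otimes> y)\<close> is the tensor product of the orbit maps of
  \<open>x\<close> and \<open>y\<close>. This reduces computations with the diagonal action to functoriality of \<open>\<otimes>\<close>.\<close>

lemma tensor_act_pure_right:
  assumes M: "module k M" and N: "module k N"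
    and \<mu>: "bilinear H M M \<mu>" and \<nu>: "bilinear H N N \<nu>"
    and x: "x \<in> carrier M" and y: "y \<in> carrier N"
  shows "tensor_act k H M N \<mu> \<nu> w (pure M N x y) =
    tmap H M H N (\<lambda>a. \<mu> a x) (\<lambda>b. \<nu> b y) w"
proof -
  have "tlift H H (tens M N)
      (\<lambda>a b. tmap M M N N (\<mu> a) (\<nu> b) (pure M N x y)) =
    tlift H H (tens M N) (\<lambda>a b. pure M N (\<mu> a x) (\<nu> b y))"
    by (rule tensor_lift_cong)
      (rule tensor_map_pure[OF M N M N bilinearD(1)[OF \<mu>] bilinearD(1)[OF \<nu>] x y])
  then show ?thesis
    by (simp only: tensor_act_def tensor_map_def[of k H M H N])
qed

text \<open>Since \<open>\<Delta>\<close> is multiplicative, this is associativity of the diagonal action.\<close>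

lemma tensor_act_mult:
  assumes M: "module k M" and N: "module k N" and \<mu>: "semiaction M \<mu>" and \<nu>: "semiaction N \<nu>"
    and w: "w \<in> carrier HH" and w': "w' \<in> carrier HH" and u: "u \<in> carrier (tens M N)"
  shows "tensor_act k H M N \<mu> \<nu> (tensor_act k H H H (mult H) (mult H) w w') u =
    tensor_act k H M N \<mu> \<nu> w (tensor_act k H M N \<mu> \<nu> w' u)"
proof -
  note mu = semiactionD[OF \<mu>] and nu = semiactionD[OF \<nu>]
  note B = tensor_act_bilinear(1)[OF M N mu(1) nu(1)]
  note BH = tensor_act_bilinear(1)[OF H_module H_module mult_bilinear mult_bilinear]
  note pure = tensor_act_pure[OF M N mu(1) nu(1)]
    tensor_act_pure[OF H_module H_module mult_bilinear mult_bilinear]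
  note PHH = pure_tensor_closed[OF H_module H_module]
  note mem = semiaction_closed[OF \<mu>] semiaction_closed[OF \<nu>]
  show ?thesis
  proof (rule tensor_bilinear_eqI[OF H_module H_module H_module H_module
        bilinear_compose[OF BH linear_map_id linear_map_id bilinearD(2)[OF B u]]
        bilinear_compose[OF B linear_map_id bilinearD(2)[OF B u] linear_map_id] _ w w'])
    fix a b c d assume ab: "a \<in> carrier H" "b \<in> carrier H" and cd: "c \<in> carrier H" "d \<in> carrier H"
    note acts = bilinearD(1)[OF B PHH[OF ab]] bilinearD(1)[OF B PHH[OF cd]]
    show "tensor_act k H M N \<mu> \<nu> (tensor_act k H H H (mult H) (mult H) (pure H H a b)
        (pure H H c d)) u = tensor_act k H M N \<mu> \<nu> (pure H H a b)
        (tensor_act k H M N \<mu> \<nu> (pure H H c d) u)"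
      by (rule tensor_map_eqI[OF M N bilinearD(1)[OF B bilinearD(3)[OF BH PHH[OF ab] PHH[OF cd]]]
            linear_map_compose[OF acts(2,1)] _ u])
        (simp add: pure ab cd mem mu(2) nu(2))
  qed
qed

lemma tensor_act_natural:
  assumes M: "module k M" and N: "module k N" and M': "module k M'" and N': "module k N'"
    and \<mu>: "bilinear H M M \<mu>" and \<nu>: "bilinear H N N \<nu>"
    and \<mu>': "bilinear H M' M' \<mu>'" and \<nu>': "bilinear H N' N' \<nu>'"
    and f: "linear_map k M M' f" and g: "linear_map k N N' g"
    and feq: "\<And>h x. h \<in> carrier H \<Longrightarrow> x \<in> carrier M \<Longrightarrow> f (\<mu> h x) = \<mu>' h (f x)"
    and geq: "\<And>h x. h \<in> carrier H \<Longrightarrow> x \<in> carrier N \<Longrightarrow> g (\<nu> h x) = \<nu>' h (g x)"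
    and w: "w \<in> carrier HH" and u: "u \<in> carrier (tens M N)"
  shows "tmap M M' N N' f g (tensor_act k H M N \<mu> \<nu> w u) =
    tensor_act k H M' N' \<mu>' \<nu>' w (tmap M M' N N' f g u)"
proof -
  note B = tensor_act_bilinear(1)[OF M N \<mu> \<nu>] and B' = tensor_act_bilinear(1)[OF M' N' \<mu>' \<nu>']
  note fg = tensor_map_linear[OF M N M' N' f g]
  show ?thesis
    by (rule tensor_bilinear_eqI[OF H_module H_module M N
          bilinear_compose[OF B linear_map_id linear_map_id fg]
          bilinear_compose[OF B' linear_map_id fg linear_map_id] _ w u])
      (simp add: tensor_act_pure[OF M N \<mu> \<nu>] tensor_act_pure[OF M' N' \<mu>' \<nu>']
        tensor_map_pure[OF M N M' N' f g] linear_mapD(1)[OF f] linear_mapD(1)[OF g]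
        bilinearD(3)[OF \<mu>] bilinearD(3)[OF \<nu>] feq geq)
qed

text \<open>The diagonal action \<open>h \<cdot> (x \<otimes> y) = h\<^sub>(\<^sub>1\<^sub>) x \<otimes> h\<^sub>(\<^sub>2\<^sub>) y\<close>; unlike in
  \<^const>\<open>diag_act\<close> the actions are given separately from the modules, so that it can be iterated
  without first restricting to \<open>\<otimes>\<^sup>l\<close>.\<close>

definition dact where
  "dact M N \<mu> \<nu> h u = tensor_act k H M N \<mu> \<nu> (\<Delta> h) u"

lemma diag_act_dact: "diag_act k H \<Delta> M N = dact M N (act M) (act N)"
  by (intro ext) (simp add: diag_act_def dact_def)

lemma dact_semiaction:
  assumes M: "module k M" and N: "module k N" and \<mu>: "semiaction M \<mu>" and \<nu>: "semiaction N \<nu>"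
  shows "semiaction (tens M N) (dact M N \<mu> \<nu>)"
proof -
  note B = tensor_act_bilinear(1)[OF M N semiactionD(1)[OF \<mu>] semiactionD(1)[OF \<nu>]]
  have "bilinear H (tens M N) (tens M N) (dact M N \<mu> \<nu>)"
    unfolding dact_def[abs_def]
    by (rule bilinear_compose[OF B comult_linear linear_map_id linear_map_id])
  moreover have "dact M N \<mu> \<nu> (h \<cdot> h') u = dact M N \<mu> \<nu> h (dact M N \<mu> \<nu> h' u)"
    if "h \<in> carrier H" "h' \<in> carrier H" "u \<in> carrier (tens M N)" for h h' u
    unfolding dact_def comult_mult[OF that(1,2)]
    by (rule tensor_act_mult[OF M N \<mu> \<nu> comult_closed[OF that(1)] comult_closed[OF that(2)] that(3)])
  ultimately show ?thesis
    unfolding semiaction_def by blast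
qed

lemma dact_pure:
  assumes "module k M" "module k N" "semiaction M \<mu>" "semiaction N \<nu>"
    and "x \<in> carrier M" "y \<in> carrier N"
  shows "dact M N \<mu> \<nu> h (pure M N x y) =
    tmap H M H N (\<lambda>a. \<mu> a x) (\<lambda>b. \<nu> b y) (\<Delta> h)"
  unfolding dact_def
  by (rule tensor_act_pure_right[OF assms(1,2) semiactionD(1)[OF assms(3)]
        semiactionD(1)[OF assms(4)] assms(5,6)])

lemma dact_natural:
  assumes "module k M" "module k N" "module k M'" "module k N'"
    and "semiaction M \<mu>" "semiaction N \<nu>" "semiaction M' \<mu>'" "semiaction N' \<nu>'"
    and "linear_map k M M' f" "linear_map k N N' g"
    and "\<And>h x. h \<in> carrier H \<Longrightarrow> x \<in> carrier M \<Longrightarrow> f (\<mu> h x) = \<mu>' h (f x)"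
    and "\<And>h x. h \<in> carrier H \<Longrightarrow> x \<in> carrier N \<Longrightarrow> g (\<nu> h x) = \<nu>' h (g x)"
    and "h \<in> carrier H" "u \<in> carrier (tens M N)"
  shows "tmap M M' N N' f g (dact M N \<mu> \<nu> h u) =
    dact M' N' \<mu>' \<nu>' h (tmap M M' N N' f g u)"
  unfolding dact_def
  by (rule tensor_act_natural[OF assms(1-4) semiactionD(1)[OF assms(5)] semiactionD(1)[OF assms(6)]
        semiactionD(1)[OF assms(7)] semiactionD(1)[OF assms(8)] assms(9,10) _ _
        comult_closed[OF assms(13)] assms(14)])
    (use assms(11,12) in blast)+

text \<open>Acting with \<open>h\<close> on \<open>(x \<otimes> y) \<otimes> z\<close> is the image of \<open>(\<Delta> \<otimes> id) \<Delta>(h)\<close> under the tensor product of the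
  three orbit maps. Naturality moves the associator to \<open>(\<Delta> \<otimes> id) \<Delta>(h)\<close>, where coassociativity
  applies.\<close>

lemma tensor_assoc_equivariant:
  assumes M: "module k M" and N: "module k N" and P: "module k P"
    and \<mu>: "semiaction M \<mu>" and \<nu>: "semiaction N \<nu>" and \<rho>: "semiaction P \<rho>"
    and h: "h \<in> carrier H" and u: "u \<in> carrier (tens (tens M N) P)"
  shows "tensor_assoc k M N P (dact (tens M N) P (dact M N \<mu> \<nu>) \<rho> h u) =
    dact M (tens N P) \<mu> (dact N P \<nu> \<rho>) h (tensor_assoc k M N P u)"
proof -
  note MN = module_tensor[OF M N] and NP = module_tensor[OF N P]
  note sMN = dact_semiaction[OF M N \<mu> \<nu>] and sNP = dact_semiaction[OF N P \<nu> \<rho>]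
  note sL = dact_semiaction[OF MN P sMN \<rho>] and sR = dact_semiaction[OF M NP \<mu> sNP]
  note A = tensor_assoc_linear[OF M N P]
  have pure: "tensor_assoc k M N P (dact (tens M N) P (dact M N \<mu> \<nu>) \<rho> h
      (pure (tens M N) P (pure M N x y) z)) =
    dact M (tens N P) \<mu> (dact N P \<nu> \<rho>) h
      (pure M (tens N P) x (pure N P y z))"
    if x: "x \<in> carrier M" and y: "y \<in> carrier N" and z: "z \<in> carrier P" for x y z
  proof -
    let ?f = "\<lambda>a. \<mu> a x" and ?g = "\<lambda>b. \<nu> b y" and ?r = "\<lambda>c. \<rho> c z"
    note f = bilinearD(2)[OF semiactionD(1)[OF \<mu>] x]
    note g = bilinearD(2)[OF semiactionD(1)[OF \<nu>] y]
    note r = bilinearD(2)[OF semiactionD(1)[OF \<rho>] z]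
    note fg = tensor_map_linear[OF H_module H_module M N f g]
    note gr = tensor_map_linear[OF H_module H_module N P g r]
    note \<Delta>h = comult_closed[OF h]
    have "dact (tens M N) P (dact M N \<mu> \<nu>) \<rho> h
        (pure (tens M N) P (pure M N x y) z) =
      tmap H (tens M N) H P (\<lambda>a. tmap H M H N ?f ?g (\<Delta> a)) ?r (\<Delta> h)"
      using dact_pure[OF MN P sMN \<rho> pure_tensor_closed[OF M N x y] z] dact_pure[OF M N \<mu> \<nu> x y]
      by simp
    also have "\<dots> = tmap HH (tens M N) H P (tmap H M H N ?f ?g) ?r
        (tmap H HH H H \<Delta> (\<lambda>c. c) (\<Delta> h))"
      by (rule tensor_map_compose[OF H_module H_module module_HH H_module MN P
            comult_linear linear_map_id fg r \<Delta>h, symmetric])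
    finally have "tensor_assoc k M N P (dact (tens M N) P (dact M N \<mu> \<nu>) \<rho> h
        (pure (tens M N) P (pure M N x y) z)) =
      tmap H M HH (tens N P) ?f (tmap H N H P ?g ?r)
        (tensor_assoc k H H H (tmap H HH H H \<Delta> (\<lambda>c. c) (\<Delta> h)))"
      using tensor_assoc_natural[OF H_module H_module H_module M N P f g r
          linear_mapD(1)[OF tensor_map_linear[OF H_module H_module module_HH H_module
              comult_linear linear_map_id] \<Delta>h]] by simp
    also have "\<dots> = tmap H M HH (tens N P) ?f (tmap H N H P ?g ?r)
        (tmap H H H HH (\<lambda>a. a) \<Delta> (\<Delta> h))"
      by (simp only: coassoc[OF h])
    also have "\<dots> = tmap H M H (tens N P) ?f
        (\<lambda>a. tmap H N H P ?g ?r (\<Delta> a)) (\<Delta> h)"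
      by (rule tensor_map_compose[OF H_module H_module H_module module_HH M NP
            linear_map_id comult_linear f gr \<Delta>h])
    also have "\<dots> = dact M (tens N P) \<mu> (dact N P \<nu> \<rho>) h
      (pure M (tens N P) x (pure N P y z))"
      using dact_pure[OF M NP \<mu> sNP x pure_tensor_closed[OF N P y z]] dact_pure[OF N P \<nu> \<rho> y z]
      by simp
    finally show ?thesis .
  qed
  show ?thesis
    by (rule tensor_map_eqI_left[OF M N P module_tensor[OF M NP]
          linear_map_compose[OF bilinearD(1)[OF semiactionD(1)[OF sL] h] A]
          linear_map_compose[OF A bilinearD(1)[OF semiactionD(1)[OF sR] h]] _ u])
      (simp add: pure tensor_assoc_pure[OF M N P])
qed

lemma tensor_unassoc_equivariant:
  assumes M: "module k M" and N: "module k N" and P: "module k P"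
    and \<mu>: "semiaction M \<mu>" and \<nu>: "semiaction N \<nu>" and \<rho>: "semiaction P \<rho>"
    and h: "h \<in> carrier H" and u: "u \<in> carrier (tens M (tens N P))"
  shows "tensor_unassoc M N P (dact M (tens N P) \<mu> (dact N P \<nu> \<rho>) h u) =
    dact (tens M N) P (dact M N \<mu> \<nu>) \<rho> h (tensor_unassoc M N P u)"
proof -
  note MN = module_tensor[OF M N]
  note sL = dact_semiaction[OF MN P dact_semiaction[OF M N \<mu> \<nu>] \<rho>]
  have v: "tensor_unassoc M N P u \<in> carrier (tens (tens M N) P)"
    by (rule linear_mapD(1)[OF tensor_unassoc_linear[OF M N P] u])
  show ?thesis
    using tensor_assoc_equivariant[OF M N P \<mu> \<nu> \<rho> h v] tensor_assoc_unassoc[OF M N P u]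
      tensor_unassoc_assoc[OF M N P semiaction_closed[OF sL h v]] by simp
qed

section \<open>Slices of the comultiplication\<close>

text \<open>The slice maps \<open>\<lambda>\<^sub>h = (\<epsilon>(-h) \<otimes> id) \<Delta>\<close> and \<open>\<rho>\<^sub>h = (id \<otimes> \<epsilon>(-h)) \<Delta>\<close>.\<close>

definition slice_left where
  "slice_left h y = tlift H H H (\<lambda>a b. \<epsilon> (a \<cdot> h) \<odot>\<^bsub>H\<^esub> b) (\<Delta> y)"

definition slice_right where
  "slice_right h y = tlift H H H (\<lambda>a b. \<epsilon> (b \<cdot> h) \<odot>\<^bsub>H\<^esub> a) (\<Delta> y)"

lemma counit_mult_linear:
  "h \<in> carrier H \<Longrightarrow> linear_map k H (self_module k) (\<lambda>x. \<epsilon> (x \<cdot> h))"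
  "h \<in> carrier H \<Longrightarrow> linear_map k H (self_module k) (\<lambda>x. \<epsilon> (h \<cdot> x))"
  by (rule linear_map_compose[OF bilinearD(2)[OF mult_bilinear] counit_linear], assumption)
    (rule linear_map_compose[OF bilinearD(1)[OF mult_bilinear] counit_linear])

lemma functional_bilinear:
  assumes "module k M" "module k N" "linear_map k M (self_module k) \<phi>"
  shows "bilinear M N N (\<lambda>x y. \<phi> x \<odot>\<^bsub>N\<^esub> y)" "bilinear N M N (\<lambda>x y. \<phi> y \<odot>\<^bsub>N\<^esub> x)"
proof -
  have s: "\<phi> x \<in> carrier k" if "x \<in> carrier M" for x
    using linear_mapD(1)[OF assms(3) that] by simp
  show "bilinear M N N (\<lambda>x y. \<phi> x \<odot>\<^bsub>N\<^esub> y)" "bilinear N M N (\<lambda>x y. \<phi> y \<odot>\<^bsub>N\<^esub> x)"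
    by (intro bilinearI linear_map_smult[OF linear_map_id assms(2) s]
        linear_map_smult_const[OF assms(3,2)]; assumption)+
qed

lemmas lift_left_linear =
  tensor_lift_linear[OF H_module H_module H_module functional_bilinear(1)[OF H_module H_module]]
lemmas lift_left_pure =
  tensor_lift_pure[OF H_module H_module H_module functional_bilinear(1)[OF H_module H_module]]
lemmas lift_right_linear =
  tensor_lift_linear[OF H_module H_module H_module functional_bilinear(2)[OF H_module H_module]]
lemmas lift_right_pure =
  tensor_lift_pure[OF H_module H_module H_module functional_bilinear(2)[OF H_module H_module]]

lemma slice_linear:
  assumes "h \<in> carrier H"
  shows "linear_map k H H (slice_left h)" "linear_map k H H (slice_right h)"
  unfolding slice_left_def slice_right_def
  by (rule linear_map_compose[OF comult_linear lift_left_linear[OF counit_mult_linear(1)[OF assms]]])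
    (rule linear_map_compose[OF comult_linear lift_right_linear[OF counit_mult_linear(1)[OF assms]]])

lemmas slice_closed = slice_linear[THEN linear_mapD(1)]

lemma slice_one:
  assumes "y \<in> carrier H"
  shows "slice_left 1\<^sub>H y = y" "slice_right 1\<^sub>H y = y"
proof -
  have "tlift H H H (\<lambda>a b. \<epsilon> (a \<cdot> 1\<^sub>H) \<odot>\<^bsub>H\<^esub> b) =
      tlift H H H (\<lambda>a b. \<epsilon> a \<odot>\<^bsub>H\<^esub> b)"
    "tlift H H H (\<lambda>a b. \<epsilon> (b \<cdot> 1\<^sub>H) \<odot>\<^bsub>H\<^esub> a) =
      tlift H H H (\<lambda>a b. \<epsilon> b \<odot>\<^bsub>H\<^esub> a)"
    by (rule tensor_lift_cong, simp)+
  then show "slice_left 1\<^sub>H y = y" "slice_right 1\<^sub>H y = y"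
    using counit_left[OF assms] counit_right[OF assms]
    by (simp_all add: slice_left_def slice_right_def)
qed

lemma f_map_g_map:
  assumes "h \<in> carrier H"
  shows "f_map k H \<Delta> (g_map H \<epsilon> h) = slice_left h 1\<^sub>H"
    and "f'_map k H \<Delta> (g_map H \<epsilon> h) = slice_right h 1\<^sub>H"
  unfolding f_map_def f'_map_def slice_left_def slice_right_def
  by (rule fun_cong[OF tensor_lift_cong], simp add: g_map_def)+

text \<open>By coassociativity both sides are \<open>y\<^sub>1 \<otimes> \<epsilon>(y\<^sub>2 h) y\<^sub>3\<close>.\<close>

lemma slice_exchange:
  assumes h: "h \<in> carrier H" and y: "y \<in> carrier H"
  shows "tmap H H H H (\<lambda>a. a) (slice_left h) (\<Delta> y) =
    tmap H H H H (slice_right h) (\<lambda>b. b) (\<Delta> y)"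
proof -
  let ?L = "tlift H H H (\<lambda>a b. \<epsilon> (a \<cdot> h) \<odot>\<^bsub>H\<^esub> b)"
  let ?R = "tlift H H H (\<lambda>a b. \<epsilon> (b \<cdot> h) \<odot>\<^bsub>H\<^esub> a)"
  let ?\<Theta> = "tmap H H HH H (\<lambda>a. a) ?L"
  let ?D = "tmap H HH H H \<Delta> (\<lambda>c. c)"
  note mods = H_module module_HH
  note e = counit_mult_linear(1)[OF h]
  note L = lift_left_linear[OF e] and R = lift_right_linear[OF e]
  note A = tensor_assoc_linear[OF H_module H_module H_module]
  note \<Theta> = tensor_map_linear[OF H_module module_HH H_module H_module linear_map_id L]
  note D = tensor_map_linear[OF H_module H_module module_HH H_module comult_linear linear_map_id]
  note B = pure_tensor_bilinear[OF H_module H_module]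
  note B' = pure_tensor_bilinear[OF module_HH H_module]
  have step: "?\<Theta> (tensor_assoc k H H H (pure HH H v c)) = pure H H (?R v) c"
    if v: "v \<in> carrier HH" and c: "c \<in> carrier H" for v c
  proof (rule tensor_map_eqI[OF H_module H_module
        linear_map_compose[OF linear_map_compose[OF bilinearD(2)[OF B' c] A] \<Theta>]
        linear_map_compose[OF R bilinearD(2)[OF B c]] _ v])
    fix a b assume ab: "a \<in> carrier H" "b \<in> carrier H"
    have s: "\<epsilon> (b \<cdot> h) \<in> carrier k" using ab h by (simp add: counit_closed)
    show "?\<Theta> (tensor_assoc k H H H (pure HH H (pure H H a b) c)) =
        pure H H (?R (pure H H a b)) c"
      using ab c h s linear_mapD(3)[OF bilinearD(1)[OF B ab(1)] s c]
        linear_mapD(3)[OF bilinearD(2)[OF B c] s ab(1)]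
      by (simp add: tensor_assoc_pure mods pure_tensor_closed lift_left_pure[OF e]
          lift_right_pure[OF e] tensor_map_pure[OF H_module module_HH H_module H_module linear_map_id L])
  qed
  have "tmap H H H H (\<lambda>a. a) (slice_left h) (\<Delta> y) =
      ?\<Theta> (tmap H H H HH (\<lambda>a. a) \<Delta> (\<Delta> y))"
    unfolding slice_left_def
    by (rule tensor_map_compose[OF H_module H_module H_module module_HH H_module H_module
          linear_map_id comult_linear linear_map_id L comult_closed[OF y], symmetric])
  also have "\<dots> = ?\<Theta> (tensor_assoc k H H H (?D (\<Delta> y)))"
    by (simp only: coassoc[OF y])
  also have "\<dots> = tmap H H H H (slice_right h) (\<lambda>b. b) (\<Delta> y)"
    by (rule tensor_map_eqI[OF H_module H_module
          linear_map_compose[OF linear_map_compose[OF D A] \<Theta>]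
          tensor_map_linear[OF H_module H_module H_module H_module slice_linear(2)[OF h]
            linear_map_id] _ comult_closed[OF y]])
      (simp add: tensor_map_pure[OF H_module H_module module_HH H_module comult_linear linear_map_id]
        tensor_map_pure[OF H_module H_module H_module H_module slice_linear(2)[OF h] linear_map_id]
        step comult_closed slice_right_def)
  finally show ?thesis .
qed

end

context monoidal_prebialgebra
begin

text \<open>In Sweedler notation, right monoidality gives
  \<open>\<epsilon>(x\<^sub>1 y\<^sub>1 h) x\<^sub>2 y\<^sub>2 = \<epsilon>(y\<^sub>1 h) \<epsilon>(x\<^sub>1 y\<^sub>2) x\<^sub>2 y\<^sub>3\<close>, and \<open>\<epsilon>(x\<^sub>1 y\<^sub>2) x\<^sub>2 y\<^sub>3 = x y\<^sub>2\<close> by the counit axiom for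
  \<open>\<Delta>(x y\<^sub>2) = \<Delta>(x) \<Delta>(y\<^sub>2)\<close>. The middle expression is the value of \<open>\<Psi>\<close> at \<open>w = \<Delta>(x)\<close> on the twofold
  comultiplication of \<open>y\<close>; keeping \<open>w\<close> a free argument of \<open>\<Psi>\<close> avoids exchanging two sums.\<close>

lemma slice_left_mult:
  assumes h: "h \<in> carrier H" and x: "x \<in> carrier H" and y: "y \<in> carrier H"
  shows "slice_left h (x \<cdot> y) = x \<cdot> slice_left h y"
proof -
  let ?mul = "tensor_act k H H H (mult H) (mult H)"
  let ?E = "tlift H H H (\<lambda>a b. \<epsilon> a \<odot>\<^bsub>H\<^esub> b)"
  let ?L = "tlift H H H (\<lambda>a b. \<epsilon> (a \<cdot> h) \<odot>\<^bsub>H\<^esub> b)"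
  let ?\<Psi> = "\<lambda>w. tlift H HH H (\<lambda>a v. \<epsilon> (a \<cdot> h) \<odot>\<^bsub>H\<^esub> ?E (?mul w v))"
  let ?D = "tmap H HH H H \<Delta> (\<lambda>c. c)" and ?D' = "tmap H H H HH (\<lambda>a. a) \<Delta>"
  note MH = H_module and MHH = module_HH
  note e = counit_mult_linear(1)[OF h]
  note E = lift_left_linear[OF counit_linear] and L = lift_left_linear[OF e]
  note mul = tensor_act_bilinear(1)[OF MH MH mult_bilinear mult_bilinear]
  note mul_pure = tensor_act_pure[OF MH MH mult_bilinear mult_bilinear]
  note A = tensor_assoc_linear[OF MH MH MH]
  note D = tensor_map_linear[OF MH MH MHH MH comult_linear linear_map_id]
  note D' = tensor_map_linear[OF MH MH MH MHH linear_map_id comult_linear]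
  note B' = pure_tensor_bilinear[OF MHH MH]
  note PHH = pure_tensor_closed[OF MH MH]
  have bil: "bilinear H HH H (\<lambda>a v. \<epsilon> (a \<cdot> h) \<odot>\<^bsub>H\<^esub> ?E (?mul w v))"
    if w: "w \<in> carrier HH" for w
    by (rule bilinear_compose[OF functional_bilinear(1)[OF MH MH e] linear_map_id
          linear_map_compose[OF bilinearD(1)[OF mul w] E] linear_map_id])
  note \<Psi> = tensor_lift_linear[OF MH MHH MH bil] and \<Psi>_pure = tensor_lift_pure[OF MH MHH MH bil]
  \<comment> \<open>Both sides of coassociativity are fed to \<open>\<Psi>\<close>. For \<open>(id \<otimes> \<Delta>) \<Delta>(y)\<close> the counit absorbs
    the second comultiplication.\<close>
  have right: "?\<Psi> (\<Delta> x) (?D' (\<Delta> y)) = x \<cdot> ?L (\<Delta> y)"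
  proof (rule tensor_map_eqI[OF MH MH linear_map_compose[OF D' \<Psi>[OF comult_closed[OF x]]]
        linear_map_compose[OF L bilinearD(1)[OF mult_bilinear x]] _ comult_closed[OF y]])
    fix a t assume at: "a \<in> carrier H" "t \<in> carrier H"
    have "?E (?mul (\<Delta> x) (\<Delta> t)) = x \<cdot> t"
      using counit_left[of "x \<cdot> t"] comult_mult[OF x at(2)] x at by simp
    then show "?\<Psi> (\<Delta> x) (?D' (pure H H a t)) = x \<cdot> ?L (pure H H a t)"
      using at x h
      by (simp add: tensor_map_pure[OF MH MH MH MHH linear_map_id comult_linear] comult_closed
          \<Psi>_pure lift_left_pure[OF e] smult_mult_right counit_mult_closed)
  qed
  \<comment> \<open>For \<open>(\<Delta> \<otimes> id) \<Delta>(y)\<close> the monoidality of the counit absorbs it.\<close>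
  have s_pure: "?\<Psi> (pure H H p q) (tensor_assoc k H H H (pure HH H (\<Delta> s) c)) =
      \<epsilon> (p \<cdot> s \<cdot> h) \<odot>\<^bsub>H\<^esub> (q \<cdot> c)"
    if p: "p \<in> carrier H" and q: "q \<in> carrier H" and s: "s \<in> carrier H" and c: "c \<in> carrier H"
    for p q s c
  proof -
    let ?R = "tlift H H (self_module k)
      (\<lambda>a b. \<epsilon> (p \<cdot> b) \<otimes>\<^bsub>k\<^esub> \<epsilon> (a \<cdot> h))"
    have bR: "bilinear H H (self_module k) (\<lambda>a b. \<epsilon> (p \<cdot> b) \<otimes>\<^bsub>k\<^esub> \<epsilon> (a \<cdot> h))"
      using bilinear_compose[OF functional_bilinear(2)[OF MH module_self counit_mult_linear(2)[OF p]]
          e linear_map_id linear_map_id] by simp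
    note R = tensor_lift_linear[OF MH MH module_self bR]
    have "?\<Psi> (pure H H p q) (tensor_assoc k H H H (pure HH H (\<Delta> s) c)) =
        ?R (\<Delta> s) \<odot>\<^bsub>H\<^esub> (q \<cdot> c)"
    proof (rule tensor_map_eqI[OF MH MH
          linear_map_compose[OF linear_map_compose[OF bilinearD(2)[OF B' c] A] \<Psi>[OF PHH[OF p q]]]
          linear_map_smult_const[OF R MH H.m_closed[OF q c]] _ comult_closed[OF s]])
      fix a b assume ab: "a \<in> carrier H" "b \<in> carrier H"
      have "\<epsilon> (a \<cdot> h) \<odot>\<^bsub>H\<^esub> (\<epsilon> (p \<cdot> b) \<odot>\<^bsub>H\<^esub> (q \<cdot> c)) =
          (\<epsilon> (p \<cdot> b) \<otimes>\<^bsub>k\<^esub> \<epsilon> (a \<cdot> h)) \<odot>\<^bsub>H\<^esub> (q \<cdot> c)"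
        using counit_mult_closed[OF ab(1) h] counit_mult_closed[OF p ab(2)] q c
        by (simp add: module.smult_assoc1[OF MH, symmetric] k.m_comm)
      then show "?\<Psi> (pure H H p q)
          (tensor_assoc k H H H (pure HH H (pure H H a b) c)) =
        ?R (pure H H a b) \<odot>\<^bsub>H\<^esub> (q \<cdot> c)"
        using ab p q c
        by (simp add: tensor_assoc_pure MH \<Psi>_pure PHH mul_pure lift_left_pure[OF counit_linear]
            tensor_lift_pure[OF MH MH module_self bR])
    qed
    then show ?thesis by (simp only: right_monoidal[OF p s h])
  qed
  have step: "?\<Psi> w (tensor_assoc k H H H (pure HH H (\<Delta> s) c)) =
      ?L (?mul w (pure H H s c))"
    if w: "w \<in> carrier HH" and s: "s \<in> carrier H" and c: "c \<in> carrier H" for w s c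
  proof (rule tensor_map_eqI[OF MH MH _
        linear_map_compose[OF bilinearD(2)[OF mul PHH[OF s c]] L] _ w])
    have T: "tensor_assoc k H H H (pure HH H (\<Delta> s) c) \<in> carrier (tens H HH)"
      by (rule linear_mapD(1)[OF A pure_tensor_closed[OF MHH MH comult_closed[OF s] c]])
    show "linear_map k HH H (\<lambda>w. ?\<Psi> w (tensor_assoc k H H H (pure HH H (\<Delta> s) c)))"
    proof (rule tensor_lift_linear_parameter[OF MH MHH MH MHH bil _ T])
      fix a v assume a: "a \<in> carrier H" and v: "v \<in> carrier HH"
      show "linear_map k HH H (\<lambda>w. \<epsilon> (a \<cdot> h) \<odot>\<^bsub>H\<^esub> ?E (?mul w v))"
        by (rule linear_map_smult[OF linear_map_compose[OF bilinearD(2)[OF mul v] E] MH counit_mult_closed[OF a h]])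
    qed
    fix p q assume pq: "p \<in> carrier H" "q \<in> carrier H"
    show "?\<Psi> (pure H H p q) (tensor_assoc k H H H (pure HH H (\<Delta> s) c)) =
      ?L (?mul (pure H H p q) (pure H H s c))"
      using s_pure[OF pq s c] pq s c by (simp add: mul_pure lift_left_pure[OF e])
  qed
  have left: "?\<Psi> (\<Delta> x) (tensor_assoc k H H H (?D (\<Delta> y))) = ?L (?mul (\<Delta> x) (\<Delta> y))"
    by (rule tensor_map_eqI[OF MH MH
          linear_map_compose[OF linear_map_compose[OF D A] \<Psi>[OF comult_closed[OF x]]]
          linear_map_compose[OF bilinearD(1)[OF mul comult_closed[OF x]] L] _ comult_closed[OF y]])
      (simp add: tensor_map_pure[OF MH MH MHH MH comult_linear linear_map_id]
        step[OF comult_closed[OF x]])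
  show ?thesis
    using left right coassoc[OF y] comult_mult[OF x y] by (simp add: slice_left_def)
qed

text \<open>The mirror image, from left monoidality:
  \<open>\<epsilon>(x\<^sub>2 y\<^sub>2 h) x\<^sub>1 y\<^sub>1 = \<epsilon>(x\<^sub>2 y\<^sub>2) \<epsilon>(y\<^sub>3 h) x\<^sub>1 y\<^sub>1 = x y\<^sub>1 \<epsilon>(y\<^sub>2 h)\<close>.\<close>

lemma slice_right_mult:
  assumes h: "h \<in> carrier H" and x: "x \<in> carrier H" and y: "y \<in> carrier H"
  shows "slice_right h (x \<cdot> y) = x \<cdot> slice_right h y"
proof -
  let ?mul = "tensor_act k H H H (mult H) (mult H)"
  let ?E = "tlift H H H (\<lambda>a b. \<epsilon> b \<odot>\<^bsub>H\<^esub> a)"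
  let ?L = "tlift H H H (\<lambda>a b. \<epsilon> (b \<cdot> h) \<odot>\<^bsub>H\<^esub> a)"
  let ?\<Psi> = "\<lambda>w. tlift HH H H (\<lambda>v c. \<epsilon> (c \<cdot> h) \<odot>\<^bsub>H\<^esub> ?E (?mul w v))"
  let ?D = "tmap H HH H H \<Delta> (\<lambda>c. c)" and ?D' = "tmap H H H HH (\<lambda>a. a) \<Delta>"
  note MH = H_module and MHH = module_HH
  note e = counit_mult_linear(1)[OF h]
  note E = lift_right_linear[OF counit_linear] and L = lift_right_linear[OF e]
  note mul = tensor_act_bilinear(1)[OF MH MH mult_bilinear mult_bilinear]
  note mul_pure = tensor_act_pure[OF MH MH mult_bilinear mult_bilinear]
  note A = tensor_unassoc_linear[OF MH MH MH]
  note D = tensor_map_linear[OF MH MH MHH MH comult_linear linear_map_id]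
  note D' = tensor_map_linear[OF MH MH MH MHH linear_map_id comult_linear]
  note B' = pure_tensor_bilinear[OF MH MHH]
  note PHH = pure_tensor_closed[OF MH MH]
  have bil: "bilinear HH H H (\<lambda>v c. \<epsilon> (c \<cdot> h) \<odot>\<^bsub>H\<^esub> ?E (?mul w v))"
    if w: "w \<in> carrier HH" for w
    by (rule bilinear_compose[OF functional_bilinear(2)[OF MH MH e]
          linear_map_compose[OF bilinearD(1)[OF mul w] E] linear_map_id linear_map_id])
  note \<Psi> = tensor_lift_linear[OF MHH MH MH bil] and \<Psi>_pure = tensor_lift_pure[OF MHH MH MH bil]
  have left: "?\<Psi> (\<Delta> x) (?D (\<Delta> y)) = x \<cdot> ?L (\<Delta> y)"
  proof (rule tensor_map_eqI[OF MH MH linear_map_compose[OF D \<Psi>[OF comult_closed[OF x]]]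
        linear_map_compose[OF L bilinearD(1)[OF mult_bilinear x]] _ comult_closed[OF y]])
    fix t c assume tc: "t \<in> carrier H" "c \<in> carrier H"
    have "?E (?mul (\<Delta> x) (\<Delta> t)) = x \<cdot> t"
      using counit_right[of "x \<cdot> t"] comult_mult[OF x tc(1)] x tc by simp
    then show "?\<Psi> (\<Delta> x) (?D (pure H H t c)) = x \<cdot> ?L (pure H H t c)"
      using tc x h
      by (simp add: tensor_map_pure[OF MH MH MHH MH comult_linear linear_map_id] comult_closed
          \<Psi>_pure lift_right_pure[OF e] smult_mult_right counit_mult_closed)
  qed
  have s_pure: "?\<Psi> (pure H H p q) (tensor_unassoc H H H (pure H HH a (\<Delta> s))) =
      \<epsilon> (q \<cdot> s \<cdot> h) \<odot>\<^bsub>H\<^esub> (p \<cdot> a)"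
    if p: "p \<in> carrier H" and q: "q \<in> carrier H" and s: "s \<in> carrier H" and a: "a \<in> carrier H"
    for p q s a
  proof -
    let ?R = "tlift H H (self_module k)
      (\<lambda>b c. \<epsilon> (q \<cdot> b) \<otimes>\<^bsub>k\<^esub> \<epsilon> (c \<cdot> h))"
    have bR: "bilinear H H (self_module k) (\<lambda>b c. \<epsilon> (q \<cdot> b) \<otimes>\<^bsub>k\<^esub> \<epsilon> (c \<cdot> h))"
      using bilinear_compose[OF functional_bilinear(1)[OF MH module_self counit_mult_linear(2)[OF q]]
          linear_map_id e linear_map_id] by simp
    note R = tensor_lift_linear[OF MH MH module_self bR]
    have "?\<Psi> (pure H H p q) (tensor_unassoc H H H (pure H HH a (\<Delta> s))) =
        ?R (\<Delta> s) \<odot>\<^bsub>H\<^esub> (p \<cdot> a)"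
    proof (rule tensor_map_eqI[OF MH MH
          linear_map_compose[OF linear_map_compose[OF bilinearD(1)[OF B' a] A] \<Psi>[OF PHH[OF p q]]]
          linear_map_smult_const[OF R MH H.m_closed[OF p a]] _ comult_closed[OF s]])
      fix b c assume bc: "b \<in> carrier H" "c \<in> carrier H"
      have "\<epsilon> (c \<cdot> h) \<odot>\<^bsub>H\<^esub> (\<epsilon> (q \<cdot> b) \<odot>\<^bsub>H\<^esub> (p \<cdot> a)) =
          (\<epsilon> (q \<cdot> b) \<otimes>\<^bsub>k\<^esub> \<epsilon> (c \<cdot> h)) \<odot>\<^bsub>H\<^esub> (p \<cdot> a)"
        using counit_mult_closed[OF bc(2) h] counit_mult_closed[OF q bc(1)] p a
        by (simp add: module.smult_assoc1[OF MH, symmetric] k.m_comm)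
      then show "?\<Psi> (pure H H p q)
          (tensor_unassoc H H H (pure H HH a (pure H H b c))) =
        ?R (pure H H b c) \<odot>\<^bsub>H\<^esub> (p \<cdot> a)"
        using bc p q a
        by (simp add: tensor_unassoc_pure MH \<Psi>_pure PHH mul_pure lift_right_pure[OF counit_linear]
            tensor_lift_pure[OF MH MH module_self bR])
    qed
    then show ?thesis by (simp only: left_monoidal[OF q s h])
  qed
  have step: "?\<Psi> w (tensor_unassoc H H H (pure H HH a (\<Delta> s))) =
      ?L (?mul w (pure H H a s))"
    if w: "w \<in> carrier HH" and s: "s \<in> carrier H" and a: "a \<in> carrier H" for w s a
  proof (rule tensor_map_eqI[OF MH MH _
        linear_map_compose[OF bilinearD(2)[OF mul PHH[OF a s]] L] _ w])
    have T: "tensor_unassoc H H H (pure H HH a (\<Delta> s)) \<in> carrier (tens HH H)"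
      by (rule linear_mapD(1)[OF A pure_tensor_closed[OF MH MHH a comult_closed[OF s]]])
    show "linear_map k HH H (\<lambda>w. ?\<Psi> w (tensor_unassoc H H H (pure H HH a (\<Delta> s))))"
    proof (rule tensor_lift_linear_parameter[OF MHH MH MH MHH bil _ T])
      fix v c assume v: "v \<in> carrier HH" and c: "c \<in> carrier H"
      show "linear_map k HH H (\<lambda>w. \<epsilon> (c \<cdot> h) \<odot>\<^bsub>H\<^esub> ?E (?mul w v))"
        by (rule linear_map_smult[OF linear_map_compose[OF bilinearD(2)[OF mul v] E] MH counit_mult_closed[OF c h]])
    qed
    fix p q assume pq: "p \<in> carrier H" "q \<in> carrier H"
    show "?\<Psi> (pure H H p q) (tensor_unassoc H H H (pure H HH a (\<Delta> s))) =
      ?L (?mul (pure H H p q) (pure H H a s))"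
      using s_pure[OF pq s a] pq s a by (simp add: mul_pure lift_right_pure[OF e])
  qed
  have right: "?\<Psi> (\<Delta> x) (tensor_unassoc H H H (?D' (\<Delta> y))) = ?L (?mul (\<Delta> x) (\<Delta> y))"
    by (rule tensor_map_eqI[OF MH MH
          linear_map_compose[OF linear_map_compose[OF D' A] \<Psi>[OF comult_closed[OF x]]]
          linear_map_compose[OF bilinearD(1)[OF mul comult_closed[OF x]] L] _ comult_closed[OF y]])
      (simp add: tensor_map_pure[OF MH MH MH MHH linear_map_id comult_linear]
        step[OF comult_closed[OF x]])
  have "tensor_unassoc H H H (?D' (\<Delta> y)) = ?D (\<Delta> y)"
    using tensor_unassoc_assoc[OF MH MH MH linear_mapD(1)[OF D comult_closed[OF y]]]
    by (simp only: coassoc[OF y])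
  then show ?thesis
    using left right comult_mult[OF x y] by (simp add: slice_right_def)
qed

lemma g_map_eqI:
  assumes "\<And>x. x \<in> carrier H \<Longrightarrow> \<epsilon> (x \<cdot> h) = \<epsilon> (x \<cdot> h')"
  shows "g_map H \<epsilon> h = g_map H \<epsilon> h'"
  unfolding g_map_def by (rule restrict_ext) (rule assms)

text \<open>Evaluated at \<open>x\<close>, this is left monoidality: \<open>\<epsilon>(x y\<^sub>1) \<epsilon>(y\<^sub>2 h) = \<epsilon>(x y h)\<close>. The next lemma is right
  monoidality in the same way.\<close>

lemma g_map_slice_right:
  assumes h: "h \<in> carrier H" and y: "y \<in> carrier H"
  shows "g_map H \<epsilon> (slice_right h y) = g_map H \<epsilon> (y \<cdot> h)"
proof (rule g_map_eqI)
  fix x assume x: "x \<in> carrier H"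
  let ?R = "tlift H H H (\<lambda>a b. \<epsilon> (b \<cdot> h) \<odot>\<^bsub>H\<^esub> a)"
  note e = counit_mult_linear(1)[OF h]
  have "tlift H H (self_module k)
      (\<lambda>a b. \<epsilon> (x \<cdot> a) \<otimes>\<^bsub>k\<^esub> \<epsilon> (b \<cdot> h)) (\<Delta> y) = \<epsilon> (x \<cdot> ?R (\<Delta> y))"
  proof (rule tensor_lift_unique[OF H_module H_module module_self
        linear_map_compose[OF lift_right_linear[OF e] counit_mult_linear(2)[OF x]] _ comult_closed[OF y]])
    fix a b assume ab: "a \<in> carrier H" "b \<in> carrier H"
    then show "\<epsilon> (x \<cdot> ?R (pure H H a b)) = \<epsilon> (x \<cdot> a) \<otimes>\<^bsub>k\<^esub> \<epsilon> (b \<cdot> h)"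
      using x h linear_mapD(3)[OF counit_mult_linear(2)[OF x] counit_mult_closed[OF ab(2) h] ab(1)]
      by (simp add: lift_right_pure[OF e] counit_mult_closed k.m_comm)
  qed
  then show "\<epsilon> (x \<cdot> slice_right h y) = \<epsilon> (x \<cdot> (y \<cdot> h))"
    using left_monoidal[OF x y h] x y h by (simp add: slice_right_def H.m_assoc)
qed

lemma g_map_slice_left:
  assumes h: "h \<in> carrier H" and y: "y \<in> carrier H"
  shows "g_map H \<epsilon> (slice_left h y) = g_map H \<epsilon> (y \<cdot> h)"
proof (rule g_map_eqI)
  fix x assume x: "x \<in> carrier H"
  let ?L = "tlift H H H (\<lambda>a b. \<epsilon> (a \<cdot> h) \<odot>\<^bsub>H\<^esub> b)"
  note e = counit_mult_linear(1)[OF h]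
  have "tlift H H (self_module k)
      (\<lambda>a b. \<epsilon> (x \<cdot> b) \<otimes>\<^bsub>k\<^esub> \<epsilon> (a \<cdot> h)) (\<Delta> y) = \<epsilon> (x \<cdot> ?L (\<Delta> y))"
  proof (rule tensor_lift_unique[OF H_module H_module module_self
        linear_map_compose[OF lift_left_linear[OF e] counit_mult_linear(2)[OF x]] _ comult_closed[OF y]])
    fix a b assume ab: "a \<in> carrier H" "b \<in> carrier H"
    then show "\<epsilon> (x \<cdot> ?L (pure H H a b)) = \<epsilon> (x \<cdot> b) \<otimes>\<^bsub>k\<^esub> \<epsilon> (a \<cdot> h)"
      using x h linear_mapD(3)[OF counit_mult_linear(2)[OF x] counit_mult_closed[OF ab(1) h] ab(2)]
      by (simp add: lift_left_pure[OF e] counit_mult_closed k.m_comm)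
  qed
  then show "\<epsilon> (x \<cdot> slice_left h y) = \<epsilon> (x \<cdot> (y \<cdot> h))"
    using right_monoidal[OF x y h] x y h by (simp add: slice_left_def H.m_assoc)
qed

end

section \<open>Left modules, their tensor products and encodings\<close>

context prebialgebra
begin

lemma left_module_iff:
  "lmod M \<longleftrightarrow>
    module k M \<and> semiaction M (act M) \<and> (\<forall>x \<in> carrier M. act M 1\<^sub>H x = x)"
  by (auto simp: left_module_def semiaction_def bilinear_def)

lemma left_moduleD:
  assumes "lmod M"
  shows "module k M" "semiaction M (act M)" "x \<in> carrier M \<Longrightarrow> act M 1\<^sub>H x = x"
  using assms by (auto simp: left_module_iff)

lemma act_closed:
  "lmod M \<Longrightarrow> h \<in> carrier H \<Longrightarrow> x \<in> carrier M \<Longrightarrow> act M h x \<in> carrier M"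
  by (rule semiaction_closed[OF left_moduleD(2)])

lemma left_module_mapsD:
  assumes "f \<in> left_module_maps k H M N"
  shows "linear_map k M N f" "f \<in> extensional (carrier M)"
    "h \<in> carrier H \<Longrightarrow> x \<in> carrier M \<Longrightarrow> f (act M h x) = act N h (f x)"
  using assms by (auto simp: left_module_maps_def linear_maps_def)

lemma left_module_mapsI:
  assumes "linear_map k M N f" "f \<in> extensional (carrier M)"
    "\<And>h x. h \<in> carrier H \<Longrightarrow> x \<in> carrier M \<Longrightarrow> f (act M h x) = act N h (f x)"
  shows "f \<in> left_module_maps k H M N"
  using assms by (auto simp: left_module_maps_def linear_maps_def)

lemma left_module_surj_image:
  assumes M: "module k M" and \<mu>: "semiaction M \<mu>"
    and surj: "e ` carrier M = carrier N" and lin: "linear_map k M N e"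
    and zero: "e \<zero>\<^bsub>M\<^esub> = \<zero>\<^bsub>N\<^esub>"
    and equiv: "\<And>h x. h \<in> carrier H \<Longrightarrow> x \<in> carrier M \<Longrightarrow> act N h (e x) = e (\<mu> h x)"
    and unit: "\<And>x. x \<in> carrier M \<Longrightarrow> e (\<mu> 1\<^sub>H x) = e x"
  shows "lmod N"
proof -
  have modN: "module k N" by (rule module_surj_image[OF M surj lin zero])
  have ex: "\<exists>x' \<in> carrier M. x = e x'" if "x \<in> carrier N" for x
    using that surj by blast
  note mem = semiaction_closed[OF \<mu>] and e = linear_mapD[OF lin]
  note m1 = linear_mapD[OF bilinearD(1)[OF semiactionD(1)[OF \<mu>]]]
  note Mops = module_ops[OF M]
  have "bilinear H N N (act N)"
  proof (rule bilinearI)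
    fix h assume h: "h \<in> carrier H"
    show "linear_map k N N (act N h)"
    proof (rule linear_mapI)
      fix x assume "x \<in> carrier N"
      then obtain x' where x: "x' \<in> carrier M" "x = e x'" using ex by blast
      show "act N h x \<in> carrier N" using x h by (simp add: equiv e(1) mem)
      fix y assume "y \<in> carrier N"
      then obtain y' where y: "y' \<in> carrier M" "y = e y'" using ex by blast
      show "act N h (x \<oplus>\<^bsub>N\<^esub> y) = act N h x \<oplus>\<^bsub>N\<^esub> act N h y"
        using x y h by (simp add: equiv e(2)[symmetric] mem Mops m1(2))
    next
      fix a x assume a: "a \<in> carrier k" and "x \<in> carrier N"
      then obtain x' where x: "x' \<in> carrier M" "x = e x'" using ex by blast
      show "act N h (a \<odot>\<^bsub>N\<^esub> x) = a \<odot>\<^bsub>N\<^esub> act N h x"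
        using x a h by (simp add: equiv e(3)[symmetric] mem Mops m1(3))
    qed
  next
    fix x assume "x \<in> carrier N"
    then obtain x' where x: "x' \<in> carrier M" "x = e x'" using ex by blast
    show "linear_map k H N (\<lambda>h. act N h x)"
    proof (rule linear_map_cong[OF _ _ H_module])
      show "linear_map k H N (\<lambda>h. e (\<mu> h x'))"
        by (rule linear_map_compose[OF bilinearD(2)[OF semiactionD(1)[OF \<mu>] x(1)] lin])
    qed (simp add: x equiv)
  qed
  moreover have "act N (h \<cdot> h') x = act N h (act N h' x)"
    if h: "h \<in> carrier H" "h' \<in> carrier H" and xN: "x \<in> carrier N" for h h' x
  proof -
    obtain x' where x: "x' \<in> carrier M" "x = e x'" using ex[OF xN] by blast
    show ?thesis
      using x h by (simp add: equiv mem semiactionD(2)[OF \<mu>])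
  qed
  moreover have "act N 1\<^sub>H x = x" if xN: "x \<in> carrier N" for x
  proof -
    obtain x' where x: "x' \<in> carrier M" "x = e x'" using ex[OF xN] by blast
    show ?thesis using x by (simp add: equiv unit)
  qed
  ultimately show ?thesis
    using modN by (simp add: left_module_iff semiaction_def)
qed

lemma transport_simps:
  assumes "inj_on e (carrier L)"
  shows "carrier (transport e L) = e ` carrier L"
    "\<zero>\<^bsub>transport e L\<^esub> = e \<zero>\<^bsub>L\<^esub>"
    "x \<in> carrier L \<Longrightarrow> y \<in> carrier L \<Longrightarrow> e x \<oplus>\<^bsub>transport e L\<^esub> e y = e (x \<oplus>\<^bsub>L\<^esub> y)"
    "x \<in> carrier L \<Longrightarrow> a \<odot>\<^bsub>transport e L\<^esub> e x = e (a \<odot>\<^bsub>L\<^esub> x)"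
    "x \<in> carrier L \<Longrightarrow> act (transport e L) h (e x) = e (act L h x)"
  using assms by (simp_all add: transport_def Let_def)

lemma transport_left_module:
  assumes L: "lmod L" and inj: "inj_on e (carrier L)"
  shows "lmod (transport e L)"
    and "linear_map k L (transport e L) e"
    and "linear_map k (transport e L) L (inv_into (carrier L) e)"
proof -
  note s = transport_simps[OF inj] and ops = module_ops[OF left_moduleD(1)[OF L]]
  show lin: "linear_map k L (transport e L) e"
    by (rule linear_mapI) (simp_all add: s)
  show "lmod (transport e L)"
    by (rule left_module_surj_image[OF left_moduleD(1,2)[OF L] s(1)[symmetric] lin])
      (simp_all add: s left_moduleD(3)[OF L])
  show "linear_map k (transport e L) L (inv_into (carrier L) e)"
    by (rule linear_mapI) (auto simp: s inj ops)
qed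

subsection \<open>The image of the unit\<close>

lemma dact_one:
  assumes M: "lmod M" and N: "lmod N"
  defines "D \<equiv> dact M N (act M) (act N)"
  assumes h: "h \<in> carrier H" and u: "u \<in> carrier (tens M N)"
  shows "D h (D 1\<^sub>H u) = D h u" "D 1\<^sub>H (D h u) = D h u" "D h u \<in> carrier (tens M N)"
proof -
  note D = dact_semiaction[OF left_moduleD(1)[OF M] left_moduleD(1)[OF N]
      left_moduleD(2)[OF M] left_moduleD(2)[OF N], folded D_def]
  show "D h (D 1\<^sub>H u) = D h u" "D 1\<^sub>H (D h u) = D h u"
    using semiactionD(2)[OF D h H.one_closed u] semiactionD(2)[OF D H.one_closed h u] h by simp_all
  show "D h u \<in> carrier (tens M N)"
    by (rule semiaction_closed[OF D h u])
qed

lemma ltensor_simps: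
  "carrier (lten M N) =
    dact M N (act M) (act N) 1\<^sub>H ` carrier (tens M N)"
  "\<zero>\<^bsub>lten M N\<^esub> = \<zero>\<^bsub>tens M N\<^esub>"
  "x \<oplus>\<^bsub>lten M N\<^esub> y = x \<oplus>\<^bsub>tens M N\<^esub> y"
  "a \<odot>\<^bsub>lten M N\<^esub> x = a \<odot>\<^bsub>tens M N\<^esub> x"
  "act (lten M N) = dact M N (act M) (act N)"
  by (simp_all add: ltensor_def diag_act_dact)

lemma ltensor_mem_iff:
  assumes M: "lmod M" and N: "lmod N"
  shows "u \<in> carrier (lten M N) \<longleftrightarrow>
    u \<in> carrier (tens M N) \<and> dact M N (act M) (act N) 1\<^sub>H u = u"
  using dact_one[OF M N H.one_closed] by (force simp: ltensor_simps)

lemma ltensor_left_module: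
  assumes M: "lmod M" and N: "lmod N"
  defines "D \<equiv> dact M N (act M) (act N)"
  shows "lmod (lten M N)"
    and "linear_map k (tens M N) (lten M N) (D 1\<^sub>H)"
    and "linear_map k (lten M N) (tens M N) (\<lambda>u. u)"
proof -
  note T = module_tensor[OF left_moduleD(1)[OF M] left_moduleD(1)[OF N]]
  note D = dact_semiaction[OF left_moduleD(1)[OF M] left_moduleD(1)[OF N]
      left_moduleD(2)[OF M] left_moduleD(2)[OF N], folded D_def]
  note d1 = dact_one[OF M N, folded D_def]
  note D1 = bilinearD(1)[OF semiactionD(1)[OF D] H.one_closed]
  note s = ltensor_simps[of M N, folded D_def]
  show lin: "linear_map k (tens M N) (lten M N) (D 1\<^sub>H)"
    using linear_mapD[OF D1] by (intro linear_mapI) (simp_all add: s)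
  show "linear_map k (lten M N) (tens M N) (\<lambda>u. u)"
    using ltensor_mem_iff[OF M N] by (intro linear_mapI) (simp_all add: s(2-))
  show "lmod (lten M N)"
    by (rule left_module_surj_image[OF T D s(1)[symmetric] lin])
      (simp_all add: s d1 linear_map_zero[OF T T D1])
qed

text \<open>An equivariant map preserves the vectors fixed by \<open>1\<close>, and \<open>\<otimes>\<^sup>l\<close> consists of these.\<close>

lemma ltensor_tensor_map:
  assumes M: "lmod M" and N: "lmod N"
    and M': "lmod M'" and N': "lmod N'"
    and f: "linear_map k M M' f" and g: "linear_map k N N' g"
    and feq: "\<And>h x. h \<in> carrier H \<Longrightarrow> x \<in> carrier M \<Longrightarrow> f (act M h x) = act M' h (f x)"
    and geq: "\<And>h x. h \<in> carrier H \<Longrightarrow> x \<in> carrier N \<Longrightarrow> g (act N h x) = act N' h (g x)"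
    and u: "u \<in> carrier (lten M N)"
  shows "tmap M M' N N' f g u \<in> carrier (lten M' N')"
proof -
  note m = left_moduleD(1)[OF M] left_moduleD(1)[OF N] left_moduleD(1)[OF M'] left_moduleD(1)[OF N']
  note s = left_moduleD(2)[OF M] left_moduleD(2)[OF N] left_moduleD(2)[OF M'] left_moduleD(2)[OF N']
  have u': "u \<in> carrier (tens M N)" "dact M N (act M) (act N) 1\<^sub>H u = u"
    using u by (simp_all add: ltensor_mem_iff[OF M N])
  have "tmap M M' N N' f g (dact M N (act M) (act N) 1\<^sub>H u) =
      dact M' N' (act M') (act N') 1\<^sub>H (tmap M M' N N' f g u)"
    by (rule dact_natural[OF m s f g _ _ H.one_closed u'(1)]) (simp_all add: feq geq)
  then show ?thesis
    using linear_mapD(1)[OF tensor_map_linear[OF m f g] u'(1)]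
    by (simp add: ltensor_mem_iff[OF M' N'] u'(2))
qed

text \<open>A finitely supported function is recovered from its graph over the support, and a tensor from any
  of its representatives.\<close>

lemma tensor_code_inj:
  assumes M: "module k M" and N: "module k N"
  shows "inj_on (tensor_code k) (carrier (tens M N))"
proof (rule inj_onI)
  let ?F = "free_pairs M N" and ?K = "tensor_kernel k M N"
  interpret F: module k ?F by (rule module_free)
  interpret K: abelian_subgroup ?K ?F
    by (intro abelian_subgroupI3 additive_subgroup.intro module.axioms[OF module_free]
        submodule.axioms[OF tensor_kernel_submodule[OF M N]])
  note carr = tensor_module_projection(3)[OF M N]
  have rep: "(SOME c. c \<in> u) \<in> carrier ?F \<and> ?K +>\<^bsub>?F\<^esub> (SOME c. c \<in> u) = u"
    if uc: "u \<in> carrier (tens M N)" for u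
  proof -
    obtain c where c: "c \<in> carrier ?F" "u = ?K +>\<^bsub>?F\<^esub> c" using uc carr by blast
    define d where "d = (SOME c. c \<in> u)"
    have d: "d \<in> ?K +>\<^bsub>?F\<^esub> c"
      unfolding d_def c(2) by (rule someI[of "\<lambda>d. d \<in> ?K +>\<^bsub>?F\<^esub> c"]) (rule K.a_rcos_self[OF c(1)])
    have "d \<in> carrier ?F" by (rule K.a_elemrcos_carrier[OF c(1) d])
    moreover have "?K +>\<^bsub>?F\<^esub> d = u"
      unfolding c(2) by (rule F.a_repr_independence[OF d c(1) K.a_subgroup, symmetric])
    ultimately show ?thesis by (simp only: d_def)
  qed
  fix u v assume uv: "u \<in> carrier (tens M N)" "v \<in> carrier (tens M N)"
    and eq: "tensor_code k u = tensor_code k v"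
  define c where "c = (SOME c. c \<in> u)"
  define d where "d = (SOME c. c \<in> v)"
  have c: "c \<in> carrier ?F" "?K +>\<^bsub>?F\<^esub> c = u" and d: "d \<in> carrier ?F" "?K +>\<^bsub>?F\<^esub> d = v"
    using rep uv by (auto simp: c_def d_def)
  have fin: "finite {(b, c b) | b. c b \<noteq> \<zero>\<^bsub>k\<^esub>}" if "c \<in> carrier ?F" for c
  proof -
    have "{(b, c b) | b. c b \<noteq> \<zero>\<^bsub>k\<^esub>} = (\<lambda>b. (b, c b)) ` {b. c b \<noteq> \<zero>\<^bsub>k\<^esub>}" by auto
    then show ?thesis using that by (simp add: free_module_simps)
  qed
  have "Abs_fset {(b, c b) | b. c b \<noteq> \<zero>\<^bsub>k\<^esub>} = Abs_fset {(b, d b) | b. d b \<noteq> \<zero>\<^bsub>k\<^esub>}"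
    using eq by (simp add: tensor_code_def Let_def c_def d_def)
  then have graphs: "{(b, c b) | b. c b \<noteq> \<zero>\<^bsub>k\<^esub>} = {(b, d b) | b. d b \<noteq> \<zero>\<^bsub>k\<^esub>}"
    using fin[OF c(1)] fin[OF d(1)] by (simp add: Abs_fset_inject)
  have mem: "v = c b \<and> c b \<noteq> \<zero>\<^bsub>k\<^esub> \<longleftrightarrow> v = d b \<and> d b \<noteq> \<zero>\<^bsub>k\<^esub>" for b v
    using arg_cong[OF graphs, of "\<lambda>A. (b, v) \<in> A"] by blast
  have "c b = d b" for b
    using mem[of "c b" b] mem[of "d b" b] by metis
  then have "c = d" by (rule ext)
  then show "u = v" using c(2) d(2) by argo
qed

subsection \<open>The retraction of \<open>M \<otimes> N\<close> onto the encoded \<open>M \<otimes>\<^sup>l N\<close>\<close>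

abbreviation "act2 M N \<equiv> dact M N (act M) (act N)"

text \<open>The projection onto the encoded module \<open>M \<otimes>\<^sup>l N\<close>; the inclusion in the other direction is
  \<^const>\<open>tensor_decode\<close>.\<close>

definition Mod_proj ::
  "('k, 'h, 'x) umodule \<Rightarrow> ('k, 'h, 'x) umodule
    \<Rightarrow> ('k, ('k, 'h, 'x) universe, ('k, 'h, 'x) universe) tensor \<Rightarrow> ('k, 'h, 'x) universe"
  where "Mod_proj M N u = tensor_code k (act2 M N 1\<^sub>H u)"

text \<open>The brackets generate \<open>M \<otimes>\<^sup>l N\<close> and satisfy \<open>[1\<^sub>1 x, 1\<^sub>2 y] = [x, y]\<close>.\<close>

definition bracket where "bracket M N x y = Mod_proj M N (pure M N x y)"

context
  fixes M N :: "('k, 'h, 'x) umodule"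
  assumes M: "lmod M" and N: "lmod N"
begin

lemma tensor_code_inj_ltensor: "inj_on (tensor_code k) (carrier (lten M N))"
  by (rule inj_on_subset[OF tensor_code_inj[OF left_moduleD(1)[OF M] left_moduleD(1)[OF N]]])
    (use ltensor_mem_iff[OF M N] in blast)

lemma Mod_tensor_left_module: "lmod (Ten M N)"
  unfolding Mod_tensor_def
  by (rule transport_left_module(1)[OF ltensor_left_module(1)[OF M N] tensor_code_inj_ltensor])

lemma Mod_proj_linear:
  "linear_map k (tens M N) (Ten M N) (Mod_proj M N)"
  unfolding Mod_tensor_def Mod_proj_def[abs_def]
  by (rule linear_map_compose[OF ltensor_left_module(2)[OF M N]
        transport_left_module(2)[OF ltensor_left_module(1)[OF M N] tensor_code_inj_ltensor]])

lemma tensor_decode_linear_ltensor: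
  "linear_map k (Ten M N) (lten M N) (decode M N)"
  unfolding Mod_tensor_def tensor_decode_def
  by (rule transport_left_module(3)[OF ltensor_left_module(1)[OF M N] tensor_code_inj_ltensor])

lemma tensor_decode_linear:
  "linear_map k (Ten M N) (tens M N) (decode M N)"
  by (rule linear_map_compose[OF tensor_decode_linear_ltensor ltensor_left_module(3)[OF M N]])

lemma tensor_code_linear:
  "linear_map k (lten M N) (Ten M N) (tensor_code k)"
  unfolding Mod_tensor_def
  by (rule transport_left_module(2)[OF ltensor_left_module(1)[OF M N] tensor_code_inj_ltensor])

lemma tensor_decode_fixed:
  assumes "x \<in> carrier (Ten M N)"
  shows "act2 M N 1\<^sub>H (decode M N x) = decode M N x"
  using linear_mapD(1)[OF tensor_decode_linear_ltensor assms] by (simp add: ltensor_mem_iff[OF M N])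

lemma tensor_decode_code:
  "u \<in> carrier (lten M N) \<Longrightarrow> decode M N (tensor_code k u) = u"
  by (simp add: tensor_decode_def tensor_code_inj_ltensor)

lemma tensor_code_decode:
  "x \<in> carrier (Ten M N) \<Longrightarrow> tensor_code k (decode M N x) = x"
  unfolding tensor_decode_def
  by (rule f_inv_into_f) (simp add: Mod_tensor_def transport_simps[OF tensor_code_inj_ltensor])

lemma Mod_proj_decode:
  "x \<in> carrier (Ten M N) \<Longrightarrow> Mod_proj M N (decode M N x) = x"
  by (simp add: Mod_proj_def tensor_decode_fixed tensor_code_decode)

lemma tensor_decode_proj:
  assumes "u \<in> carrier (tens M N)"
  shows "decode M N (Mod_proj M N u) = act2 M N 1\<^sub>H u"
  unfolding Mod_proj_def
  by (rule tensor_decode_code) (rule linear_mapD(1)[OF ltensor_left_module(2)[OF M N] assms])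

lemma Mod_tensor_act_code:
  assumes "u \<in> carrier (lten M N)"
  shows "act (Ten M N) h (tensor_code k u) = tensor_code k (act2 M N h u)"
  using assms by (simp add: Mod_tensor_def transport_simps[OF tensor_code_inj_ltensor] ltensor_simps)

lemma Mod_proj_act:
  assumes h: "h \<in> carrier H" and u: "u \<in> carrier (tens M N)"
  shows "Mod_proj M N (act2 M N h u) = act (Ten M N) h (Mod_proj M N u)"
  using Mod_tensor_act_code[OF linear_mapD(1)[OF ltensor_left_module(2)[OF M N] u], of h]
    dact_one[OF M N h u]
  by (simp add: Mod_proj_def)

lemma Mod_proj_act_one:
  assumes u: "u \<in> carrier (tens M N)"
  shows "Mod_proj M N (act2 M N 1\<^sub>H u) = Mod_proj M N u"
  by (simp add: Mod_proj_def dact_one[OF M N H.one_closed u])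

lemma tensor_decode_act:
  assumes h: "h \<in> carrier H" and x: "x \<in> carrier (Ten M N)"
  shows "decode M N (act (Ten M N) h x) =
    act2 M N h (decode M N x)"
proof -
  let ?u = "decode M N x"
  have u: "?u \<in> carrier (tens M N)" by (rule linear_mapD(1)[OF tensor_decode_linear x])
  have "act (Ten M N) h x = Mod_proj M N (act2 M N h ?u)"
    using Mod_proj_act[OF h u] Mod_proj_decode[OF x] by simp
  then show ?thesis
    using tensor_decode_proj dact_one[OF M N h u] by simp
qed

lemma bracket_bilinear: "bilinear M N (Ten M N) (bracket M N)"
  unfolding bracket_def[abs_def]
  by (rule bilinear_compose[OF pure_tensor_bilinear[OF left_moduleD(1)[OF M] left_moduleD(1)[OF N]]
        linear_map_id linear_map_id Mod_proj_linear])

lemmas bracket_closed = bilinearD(3)[OF bracket_bilinear]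

lemma Mod_tensor_eqI:
  assumes f: "linear_map k (Ten M N) P f" and g: "linear_map k (Ten M N) P g"
    and eq: "\<And>x y. x \<in> carrier M \<Longrightarrow> y \<in> carrier N \<Longrightarrow> f (bracket M N x y) = g (bracket M N x y)"
    and z: "z \<in> carrier (Ten M N)"
  shows "f z = g z"
proof -
  have "f (Mod_proj M N u) = g (Mod_proj M N u)" if u: "u \<in> carrier (tens M N)" for u
    by (rule tensor_map_eqI[OF left_moduleD(1)[OF M] left_moduleD(1)[OF N]
          linear_map_compose[OF Mod_proj_linear f] linear_map_compose[OF Mod_proj_linear g] _ u])
      (rule eq[unfolded bracket_def])
  from this[OF linear_mapD(1)[OF tensor_decode_linear z]] show ?thesis
    by (simp add: Mod_proj_decode[OF z])
qed

lemma tensor_decode_bracket: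
  "x \<in> carrier M \<Longrightarrow> y \<in> carrier N \<Longrightarrow>
    decode M N (bracket M N x y) = act2 M N 1\<^sub>H (pure M N x y)"
  unfolding bracket_def
  by (rule tensor_decode_proj)
    (rule pure_tensor_closed[OF left_moduleD(1)[OF M] left_moduleD(1)[OF N]])

end

subsection \<open>The tensor product of morphisms\<close>

lemma tensor_map_act2:
  assumes M: "lmod M" and N: "lmod N"
    and M': "lmod M'" and N': "lmod N'"
    and f: "f \<in> left_module_maps k H M M'" and g: "g \<in> left_module_maps k H N N'"
    and h: "h \<in> carrier H" and u: "u \<in> carrier (tens M N)"
  shows "tmap M M' N N' f g (act2 M N h u) = act2 M' N' h (tmap M M' N N' f g u)"
  by (rule dact_natural[OF left_moduleD(1)[OF M] left_moduleD(1)[OF N] left_moduleD(1)[OF M']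
        left_moduleD(1)[OF N'] left_moduleD(2)[OF M] left_moduleD(2)[OF N] left_moduleD(2)[OF M']
        left_moduleD(2)[OF N'] left_module_mapsD(1)[OF f] left_module_mapsD(1)[OF g] _ _ h u])
    (simp_all add: left_module_mapsD(3)[OF f] left_module_mapsD(3)[OF g])

lemma Mod_tensor_map_eq:
  assumes M: "lmod M" and N: "lmod N"
    and M': "lmod M'" and N': "lmod N'"
    and f: "f \<in> left_module_maps k H M M'" and g: "g \<in> left_module_maps k H N N'"
    and x: "x \<in> carrier (Ten M N)"
  shows "TenMap M M' N N' f g x =
    Mod_proj M' N' (tmap M M' N N' f g (decode M N x))"
proof -
  let ?u = "decode M N x"
  have u: "?u \<in> carrier (lten M N)"
    by (rule linear_mapD(1)[OF tensor_decode_linear_ltensor[OF M N] x])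
  have "tmap M M' N N' f g ?u \<in> carrier (lten M' N')"
    by (rule ltensor_tensor_map[OF M N M' N' left_module_mapsD(1)[OF f] left_module_mapsD(1)[OF g] _ _ u])
      (simp_all add: left_module_mapsD(3)[OF f] left_module_mapsD(3)[OF g])
  then show ?thesis
    using u x by (simp add: Mod_tensor_map_def ltensor_map_def Mod_proj_def ltensor_mem_iff[OF M' N'])
qed

lemma Mod_tensor_map_hom:
  assumes M: "lmod M" and N: "lmod N"
    and M': "lmod M'" and N': "lmod N'"
    and f: "f \<in> left_module_maps k H M M'" and g: "g \<in> left_module_maps k H N N'"
  shows "TenMap M M' N N' f g \<in>
      left_module_maps k H (Ten M N) (Ten M' N')"
    and "x \<in> carrier M \<Longrightarrow> y \<in> carrier N \<Longrightarrow>
      TenMap M M' N N' f g (bracket M N x y) = bracket M' N' (f x) (g y)"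
proof -
  note m = left_moduleD(1)[OF M] left_moduleD(1)[OF N] left_moduleD(1)[OF M'] left_moduleD(1)[OF N']
  note fl = left_module_mapsD(1)[OF f] and gl = left_module_mapsD(1)[OF g]
  note fg = tensor_map_linear[OF m fl gl]
  note nat = tensor_map_act2[OF M N M' N' f g]
  note eq = Mod_tensor_map_eq[OF M N M' N' f g]
  note dec = linear_mapD(1)[OF tensor_decode_linear[OF M N]]
  note MT = Mod_tensor_left_module[OF M N]
  show "TenMap M M' N N' f g \<in>
      left_module_maps k H (Ten M N) (Ten M' N')"
  proof (rule left_module_mapsI)
    show "linear_map k (Ten M N) (Ten M' N')
        (TenMap M M' N N' f g)"
      by (rule linear_map_cong[OF linear_map_compose[OF linear_map_compose[OF
                tensor_decode_linear[OF M N] fg] Mod_proj_linear[OF M' N']] eq[symmetric]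
            left_moduleD(1)[OF MT]])
    show "TenMap M M' N N' f g \<in> extensional (carrier (Ten M N))"
      by (simp add: Mod_tensor_map_def)
    fix h x assume h: "h \<in> carrier H" and x: "x \<in> carrier (Ten M N)"
    show "TenMap M M' N N' f g (act (Ten M N) h x) =
        act (Ten M' N') h (TenMap M M' N N' f g x)"
      by (simp add: eq x act_closed[OF MT h x] tensor_decode_act[OF M N h x] nat[OF h dec[OF x]]
          Mod_proj_act[OF M' N' h linear_mapD(1)[OF fg dec[OF x]]])
  qed
  show "TenMap M M' N N' f g (bracket M N x y) = bracket M' N' (f x) (g y)"
    if x: "x \<in> carrier M" and y: "y \<in> carrier N"
  proof -
    note pt = pure_tensor_closed[OF m(1,2) x y]
    show ?thesis
      using eq[OF bracket_closed[OF M N x y]] tensor_decode_bracket[OF M N x y]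
        nat[OF H.one_closed pt] tensor_map_pure[OF m fl gl x y]
        Mod_proj_act_one[OF M' N' linear_mapD(1)[OF fg pt]]
      by (simp add: bracket_def)
  qed
qed

end

section \<open>The associativity constraint\<close>

context prebialgebra
begin

text \<open>\<open>\<Delta>(h) (1 \<otimes> 1) = \<Delta>(h)\<close>, although \<open>1 \<otimes> 1\<close> may act non-trivially on either factor.\<close>

lemma dact_pure_absorb:
  assumes M: "module k M" and N: "module k N" and \<mu>: "semiaction M \<mu>" and \<nu>: "semiaction N \<nu>"
    and x: "x \<in> carrier M" and y: "y \<in> carrier N"
  shows "dact M N \<mu> \<nu> h (pure M N (\<mu> 1\<^sub>H x) y) = dact M N \<mu> \<nu> h (pure M N x y)"
    and "dact M N \<mu> \<nu> h (pure M N x (\<nu> 1\<^sub>H y)) = dact M N \<mu> \<nu> h (pure M N x y)"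
proof -
  have mx: "\<mu> a (\<mu> 1\<^sub>H x) = \<mu> a x" if "a \<in> carrier H" for a
    using semiactionD(2)[OF \<mu> that H.one_closed x] that by simp
  have ny: "\<nu> a (\<nu> 1\<^sub>H y) = \<nu> a y" if "a \<in> carrier H" for a
    using semiactionD(2)[OF \<nu> that H.one_closed y] that by simp
  have "tmap H M H N (\<lambda>a. \<mu> a (\<mu> 1\<^sub>H x)) (\<lambda>b. \<nu> b y) =
      tmap H M H N (\<lambda>a. \<mu> a x) (\<lambda>b. \<nu> b y)"
    "tmap H M H N (\<lambda>a. \<mu> a x) (\<lambda>b. \<nu> b (\<nu> 1\<^sub>H y)) =
      tmap H M H N (\<lambda>a. \<mu> a x) (\<lambda>b. \<nu> b y)"
    by (rule tensor_map_cong; simp add: mx ny)+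
  then show "dact M N \<mu> \<nu> h (pure M N (\<mu> 1\<^sub>H x) y) = dact M N \<mu> \<nu> h (pure M N x y)"
    "dact M N \<mu> \<nu> h (pure M N x (\<nu> 1\<^sub>H y)) = dact M N \<mu> \<nu> h (pure M N x y)"
    using dact_pure[OF M N \<mu> \<nu>] semiaction_closed[OF \<mu> H.one_closed x]
      semiaction_closed[OF \<nu> H.one_closed y] x y by simp_all
qed

lemma tensor_map_one_dact:
  assumes M: "module k M" and N: "module k N" and \<mu>: "semiaction M \<mu>" and \<nu>: "semiaction N \<nu>"
    and h: "h \<in> carrier H" and u: "u \<in> carrier (tens M N)"
  shows "tmap M M N N (\<lambda>x. x) (\<nu> 1\<^sub>H) (dact M N \<mu> \<nu> h u) = dact M N \<mu> \<nu> h u"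
proof -
  note D = bilinearD(1)[OF semiactionD(1)[OF dact_semiaction[OF M N \<mu> \<nu>]] h]
  note n1 = bilinearD(1)[OF semiactionD(1)[OF \<nu>] H.one_closed]
  note F = tensor_map_linear[OF M N M N linear_map_id n1]
  show ?thesis
  proof (rule tensor_map_eqI[OF M N linear_map_compose[OF D F] D _ u])
    fix x y assume x: "x \<in> carrier M" and y: "y \<in> carrier N"
    note mx = bilinearD(2)[OF semiactionD(1)[OF \<mu>] x] and ny = bilinearD(2)[OF semiactionD(1)[OF \<nu>] y]
    have c: "tmap H M H N (\<lambda>a. \<mu> a x) (\<lambda>b. \<nu> 1\<^sub>H (\<nu> b y)) =
        tmap H M H N (\<lambda>a. \<mu> a x) (\<lambda>b. \<nu> b y)"
      by (rule tensor_map_cong) (simp_all add: semiactionD(2)[OF \<nu> H.one_closed _ y, symmetric])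
    show "tmap M M N N (\<lambda>x. x) (\<nu> 1\<^sub>H) (dact M N \<mu> \<nu> h (pure M N x y)) =
        dact M N \<mu> \<nu> h (pure M N x y)"
      unfolding dact_pure[OF M N \<mu> \<nu> x y]
        tensor_map_compose[OF H_module H_module M N M N mx ny linear_map_id n1 comult_closed[OF h]] c ..
  qed
qed

text \<open>Let \<open>p\<close> be the projection of \<open>N \<otimes> P\<close> onto \<open>N \<otimes>\<^sup>l P\<close>. The inclusion of \<open>N \<otimes>\<^sup>l P\<close> is split by \<open>p\<close>,
  hence stays injective after tensoring with \<open>M\<close>; so the only candidate for the value of the
  constraint is the image of \<open>Y'\<close> under \<open>id \<otimes> p\<close>. It qualifies because \<open>Y'\<close> is fixed by \<open>1\<close>, whose action
  on \<open>M \<otimes> (N \<otimes> P)\<close> absorbs the action of \<open>1\<close> on \<open>N \<otimes> P\<close>.\<close>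

lemma lassoc_eq:
  assumes M: "lmod M" and N: "lmod N" and P: "lmod P"
    and X: "X \<in> carrier (lten (lten M N) P)"
  defines "Y' \<equiv> tensor_assoc k M N P
    (tmap (lten M N) (tens M N) P P (\<lambda>u. u) (\<lambda>u. u) X)"
  defines "Y \<equiv> tmap M M (tens N P) (lten N P) (\<lambda>u. u)
    (act2 N P 1\<^sub>H) Y'"
  shows "lassoc k H \<Delta> M N P X = Y" "Y \<in> carrier (lten M (lten N P))"
    "Y' \<in> carrier (tens M (tens N P))"
proof -
  let ?L = "lten M N" and ?R = "lten N P"
  let ?T = "tens M N" and ?S = "tens N P"
  note m = left_moduleD(1)[OF M] left_moduleD(1)[OF N] left_moduleD(1)[OF P]
  note s = left_moduleD(2)[OF M] left_moduleD(2)[OF N] left_moduleD(2)[OF P]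
  note L = ltensor_left_module[OF M N] and R = ltensor_left_module[OF N P]
  note mL = left_moduleD(1)[OF L(1)] and mR = left_moduleD(1)[OF R(1)]
  note sL = left_moduleD(2)[OF L(1)] and sR = left_moduleD(2)[OF R(1)]
  note T = module_tensor[OF m(1,2)] and S = module_tensor[OF m(2,3)]
  note sT = dact_semiaction[OF m(1,2) s(1,2)] and sS = dact_semiaction[OF m(2,3) s(2,3)]
  note inclL = tensor_map_linear[OF mL m(3) T m(3) L(3) linear_map_id]
  note p = tensor_map_linear[OF m(1) S m(1) mR linear_map_id R(2)]
  note A = tensor_assoc_linear[OF m]
  have X': "X \<in> carrier (tens ?L P)" "dact ?L P (act ?L) (act P) 1\<^sub>H X = X"
    using X by (simp_all add: ltensor_mem_iff[OF L(1) P])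
  let ?X = "tmap ?L ?T P P (\<lambda>u. u) (\<lambda>u. u) X"
  have X2: "?X \<in> carrier (tens ?T P)" by (rule linear_mapD(1)[OF inclL X'(1)])
  have "dact ?T P (act2 M N) (act P) 1\<^sub>H ?X =
      tmap ?L ?T P P (\<lambda>u. u) (\<lambda>u. u) (dact ?L P (act ?L) (act P) 1\<^sub>H X)"
    by (rule dact_natural[OF mL m(3) T m(3) sL s(3) sT s(3) L(3) linear_map_id _ _
          H.one_closed X'(1), symmetric]) (simp_all add: ltensor_simps)
  then have X3: "dact ?T P (act2 M N) (act P) 1\<^sub>H ?X = ?X" by (simp only: X'(2))
  show Y'1: "Y' \<in> carrier (tens M ?S)"
    unfolding Y'_def by (rule linear_mapD(1)[OF A X2])
  have Y'2: "dact M ?S (act M) (act2 N P) 1\<^sub>H Y' = Y'"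
    unfolding Y'_def
    by (simp only: tensor_assoc_equivariant[OF m s H.one_closed X2, symmetric] X3)
  have "act2 M ?R 1\<^sub>H Y = tmap M M ?S ?R (\<lambda>u. u) (act2 N P 1\<^sub>H)
      (dact M ?S (act M) (act2 N P) 1\<^sub>H Y')"
    unfolding Y_def
    by (rule dact_natural[OF m(1) S m(1) mR s(1) sS s(1) sR linear_map_id R(2) _ _
          H.one_closed Y'1, symmetric])
      (simp_all add: ltensor_simps dact_one[OF N P])
  then have "act2 M ?R 1\<^sub>H Y = Y" by (simp only: Y'2 Y_def)
  then show Ymem: "Y \<in> carrier (lten M ?R)"
    using linear_mapD(1)[OF p Y'1] by (simp add: ltensor_mem_iff[OF M R(1)] Y_def)
  have incl_Y: "tmap M M ?R ?S (\<lambda>u. u) (\<lambda>u. u) Y = Y'"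
    unfolding Y_def
      tensor_map_compose[OF m(1) S m(1) mR m(1) S linear_map_id R(2) linear_map_id R(3) Y'1]
    using tensor_map_one_dact[OF m(1) S s(1) sS H.one_closed Y'1] by (simp only: Y'2)
  have unique: "y = Y" if y: "y \<in> carrier (lten M ?R)"
    "tmap M M ?R ?S (\<lambda>u. u) (\<lambda>u. u) y = Y'" for y
  proof -
    have y': "y \<in> carrier (tens M ?R)"
      using y(1) by (simp add: ltensor_mem_iff[OF M R(1)])
    have c: "tmap M M ?R ?R (\<lambda>u. u) (act2 N P 1\<^sub>H) = tmap M M ?R ?R (\<lambda>u. u) (\<lambda>u. u)"
      by (rule tensor_map_cong) (simp_all add: ltensor_mem_iff[OF N P])
    have "Y = tmap M M ?R ?R (\<lambda>u. u) (act2 N P 1\<^sub>H) y"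
      unfolding Y_def y(2)[symmetric]
      by (rule tensor_map_compose[OF m(1) mR m(1) S m(1) mR linear_map_id R(3) linear_map_id R(2) y'])
    also have "\<dots> = y"
      unfolding c by (rule tensor_map_id[OF m(1) mR y'])
    finally show ?thesis by simp
  qed
  show "lassoc k H \<Delta> M N P X = Y"
    unfolding lassoc_def restrict_apply'[OF X] Y'_def[symmetric]
  proof (rule the_equality)
    fix y assume "y \<in> carrier (lten M ?R) \<and>
      tmap M M ?R ?S (\<lambda>u. u) (\<lambda>u. u) y = Y'"
    then show "y = Y" using unique by blast
  qed (rule conjI[OF Ymem incl_Y])
qed

text \<open>The inverse of the associativity constraint, written as in \<open>Mod_assoc_eq\<close> with the projections and
  inclusions interchanged.\<close>

definition Mod_unassoc where
  "Mod_unassoc M N P x =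
    Mod_proj (Ten M N) P
      (tmap (tens M N) (Ten M N) P P (Mod_proj M N) (\<lambda>z. z)
        (tensor_unassoc M N P
          (tmap M M (Ten N P) (tens N P) (\<lambda>x. x)
            (decode N P) (decode M (Ten N P) x))))"

context
  fixes M N P :: "('k, 'h, 'x) umodule"
  assumes M: "lmod M" and N: "lmod N" and P: "lmod P"
begin

private abbreviation (input) "MN \<equiv> Ten M N"
private abbreviation (input) "NP \<equiv> Ten N P"
private abbreviation (input) "TMN \<equiv> tens M N"
private abbreviation (input) "TNP \<equiv> tens N P"

private lemmas mods = left_moduleD(1)[OF M] left_moduleD(1)[OF N] left_moduleD(1)[OF P]
private lemmas acts = left_moduleD(2)[OF M] left_moduleD(2)[OF N] left_moduleD(2)[OF P]
private lemmas MN = Mod_tensor_left_module[OF M N]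
private lemmas NP = Mod_tensor_left_module[OF N P]
private lemmas mMN = left_moduleD(1)[OF MN] and mNP = left_moduleD(1)[OF NP]
private lemmas sMN = left_moduleD(2)[OF MN] and sNP = left_moduleD(2)[OF NP]
private lemmas mTMN = module_tensor[OF mods(1,2)] and mTNP = module_tensor[OF mods(2,3)]
private lemmas sTMN = dact_semiaction[OF mods(1,2) acts(1,2)] and sTNP = dact_semiaction[OF mods(2,3) acts(2,3)]

lemma Mod_assoc_eq:
  assumes x: "x \<in> carrier (Ten MN P)"
  shows "Assoc M N P x =
    Mod_proj M NP (tmap M M TNP NP (\<lambda>x. x) (Mod_proj N P) (tensor_assoc k M N P
      (tmap MN TMN P P (decode M N) (\<lambda>z. z) (decode MN P x))))"
proof -
  let ?L = "lten M N" and ?R = "lten N P"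
  note L = ltensor_left_module[OF M N] and R = ltensor_left_module[OF N P]
  note mL = left_moduleD(1)[OF L(1)] and mR = left_moduleD(1)[OF R(1)]
  note decL = tensor_decode_linear_ltensor[OF M N] and codeR = tensor_code_linear[OF N P]
  define X1 where "X1 = decode MN P x"
  have X1: "X1 \<in> carrier (lten MN P)" "X1 \<in> carrier (tens MN P)"
    unfolding X1_def
    using linear_mapD(1)[OF tensor_decode_linear_ltensor[OF MN P] x]
    by (simp_all add: ltensor_mem_iff[OF MN P])
  define X2 where "X2 = tmap MN ?L P P (decode M N) (\<lambda>z. z) X1"
  have X2: "X2 \<in> carrier (lten ?L P)"
    unfolding X2_def
    by (rule ltensor_tensor_map[OF MN P L(1) P decL linear_map_id _ _ X1(1)])
      (simp_all add: ltensor_simps tensor_decode_act[OF M N])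
  define Y' where "Y' = tensor_assoc k M N P (tmap ?L TMN P P (\<lambda>u. u) (\<lambda>u. u) X2)"
  define Y where "Y = tmap M M TNP ?R (\<lambda>u. u) (act2 N P 1\<^sub>H) Y'"
  note la = lassoc_eq[OF M N P X2, folded Y'_def, folded Y_def]
  define Z where "Z = tmap M M ?R NP (\<lambda>u. u) (tensor_code k) Y"
  have "Z \<in> carrier (lten M NP)"
    unfolding Z_def
    by (rule ltensor_tensor_map[OF M R(1) M NP linear_map_id codeR _ _ la(2)])
      (simp_all add: ltensor_simps(5) Mod_tensor_act_code[OF N P])
  then have Z: "act2 M NP 1\<^sub>H Z = Z" by (simp add: ltensor_mem_iff[OF M NP])
  have "Assoc M N P x = tensor_code k Z"
    using x X1(1) X2 la(1,2) unfolding Mod_assoc_def Let_def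
    by (simp add: ltensor_map_def X1_def[symmetric] X2_def[symmetric] Z_def)
  also have "\<dots> = Mod_proj M NP Z" by (simp only: Mod_proj_def Z)
  also have "Z = tmap M M TNP NP (\<lambda>x. x) (Mod_proj N P) Y'"
    unfolding Z_def Y_def Mod_proj_def[abs_def]
    by (rule tensor_map_compose[OF mods(1) mTNP mods(1) mR mods(1) mNP linear_map_id R(2)
          linear_map_id codeR la(3)])
  also have "Y' = tensor_assoc k M N P (tmap MN TMN P P (decode M N) (\<lambda>z. z) X1)"
    unfolding Y'_def X2_def
      tensor_map_compose[OF mMN mods(3) mL mods(3) mTMN mods(3) decL linear_map_id L(3) linear_map_id
        X1(2)] ..
  finally show ?thesis by (simp only: X1_def)
qed

lemma Mod_assoc_hom:
  shows "Assoc M N P \<in>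
      left_module_maps k H (Ten MN P) (Ten M NP)"
    and "a \<in> carrier M \<Longrightarrow> b \<in> carrier N \<Longrightarrow> c \<in> carrier P \<Longrightarrow>
      Assoc M N P (bracket MN P (bracket M N a b) c) = bracket M NP a (bracket N P b c)"
proof -
  let ?i = "decode MN P"
  let ?j = "tmap MN TMN P P (decode M N) (\<lambda>z. z)"
  let ?a = "tensor_assoc k M N P"
  let ?p = "tmap M M TNP NP (\<lambda>x. x) (Mod_proj N P)"
  note i = tensor_decode_linear[OF MN P]
  note j = tensor_map_linear[OF mMN mods(3) mTMN mods(3) tensor_decode_linear[OF M N] linear_map_id]
  note a = tensor_assoc_linear[OF mods]
  note p = tensor_map_linear[OF mods(1) mTNP mods(1) mNP linear_map_id Mod_proj_linear[OF N P]]
  note q = Mod_proj_linear[OF M NP]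
  note MNP = Mod_tensor_left_module[OF MN P]
  have j_act: "?j (act2 MN P h u) = dact TMN P (act2 M N) (act P) h (?j u)"
    if "h \<in> carrier H" "u \<in> carrier (tens MN P)" for h u
    by (rule dact_natural[OF mMN mods(3) mTMN mods(3) sMN acts(3) sTMN acts(3)
          tensor_decode_linear[OF M N] linear_map_id _ _ that])
      (simp_all add: tensor_decode_act[OF M N])
  note a_act = tensor_assoc_equivariant[OF mods acts]
  have p_act: "?p (dact M TNP (act M) (act2 N P) h u) = act2 M NP h (?p u)"
    if "h \<in> carrier H" "u \<in> carrier (tens M TNP)" for h u
    by (rule dact_natural[OF mods(1) mTNP mods(1) mNP acts(1) sTNP acts(1) sNP linear_map_id
          Mod_proj_linear[OF N P] _ _ that])
      (simp_all add: Mod_proj_act[OF N P])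
  note lin = linear_map_compose[OF linear_map_compose[OF linear_map_compose[OF
        linear_map_compose[OF i j] a] p] q]
  note mem = linear_mapD(1)[OF i] linear_mapD(1)[OF j] linear_mapD(1)[OF a] linear_mapD(1)[OF p]
  show "Assoc M N P \<in>
      left_module_maps k H (Ten MN P) (Ten M NP)"
  proof (rule left_module_mapsI)
    show "linear_map k (Ten MN P) (Ten M NP) (Assoc M N P)"
      by (rule linear_map_cong[OF lin Mod_assoc_eq[symmetric] left_moduleD(1)[OF MNP]])
    show "Assoc M N P \<in> extensional (carrier (Ten MN P))"
      by (simp add: Mod_assoc_def Let_def)
    fix h x assume h: "h \<in> carrier H" and x: "x \<in> carrier (Ten MN P)"
    show "Assoc M N P (act (Ten MN P) h x) =
        act (Ten M NP) h (Assoc M N P x)"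
      unfolding Mod_assoc_eq[OF x] Mod_assoc_eq[OF act_closed[OF MNP h x]]
        tensor_decode_act[OF MN P h x] j_act[OF h mem(1)[OF x]]
        a_act[OF h mem(2)[OF mem(1)[OF x]]] p_act[OF h mem(3)[OF mem(2)[OF mem(1)[OF x]]]]
      by (rule Mod_proj_act[OF M NP h mem(4)[OF mem(3)[OF mem(2)[OF mem(1)[OF x]]]]])
  qed
  show "Assoc M N P (bracket MN P (bracket M N x y) z) = bracket M NP x (bracket N P y z)"
    if x: "x \<in> carrier M" and y: "y \<in> carrier N" and z: "z \<in> carrier P" for x y z
  proof -
    note xy = bracket_closed[OF M N x y] and pxy = pure_tensor_closed[OF mods(1,2) x y]
    note pyz = pure_tensor_closed[OF mods(2,3) y z]
    have "?j (?i (bracket MN P (bracket M N x y) z)) =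
        dact TMN P (act2 M N) (act P) 1\<^sub>H (pure TMN P (pure M N x y) z)"
      unfolding tensor_decode_bracket[OF MN P xy z]
        j_act[OF H.one_closed pure_tensor_closed[OF mMN mods(3) xy z]]
        tensor_map_pure[OF mMN mods(3) mTMN mods(3) tensor_decode_linear[OF M N] linear_map_id xy z]
        tensor_decode_bracket[OF M N x y]
      by (rule dact_pure_absorb(1)[OF mTMN mods(3) sTMN acts(3) pxy z])
    then have "?p (?a (?j (?i (bracket MN P (bracket M N x y) z)))) =
        act2 M NP 1\<^sub>H (pure M NP x (bracket N P y z))"
      using a_act[OF H.one_closed pure_tensor_closed[OF mTMN mods(3) pxy z]]
        tensor_assoc_pure[OF mods x y z] p_act[OF H.one_closed pure_tensor_closed[OF mods(1) mTNP x pyz]]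
        tensor_map_pure[OF mods(1) mTNP mods(1) mNP linear_map_id Mod_proj_linear[OF N P] x pyz]
      by (simp add: bracket_def)
    then show ?thesis
      unfolding Mod_assoc_eq[OF bracket_closed[OF MN P xy z]]
      by (simp add: bracket_def[of M NP]
          Mod_proj_act_one[OF M NP pure_tensor_closed[OF mods(1) mNP x bracket_closed[OF N P y z]]])
  qed
qed

lemma Mod_unassoc_linear:
  shows "linear_map k (Ten M NP) (Ten MN P) (Mod_unassoc M N P)"
    and "a \<in> carrier M \<Longrightarrow> b \<in> carrier N \<Longrightarrow> c \<in> carrier P \<Longrightarrow>
      Mod_unassoc M N P (bracket M NP a (bracket N P b c)) = bracket MN P (bracket M N a b) c"
proof -
  let ?i = "decode M NP"
  let ?j = "tmap M M NP TNP (\<lambda>x. x) (decode N P)"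
  let ?a = "tensor_unassoc M N P"
  let ?p = "tmap TMN MN P P (Mod_proj M N) (\<lambda>z. z)"
  note i = tensor_decode_linear[OF M NP]
  note j = tensor_map_linear[OF mods(1) mNP mods(1) mTNP linear_map_id tensor_decode_linear[OF N P]]
  note a = tensor_unassoc_linear[OF mods]
  note p = tensor_map_linear[OF mTMN mods(3) mMN mods(3) Mod_proj_linear[OF M N] linear_map_id]
  note q = Mod_proj_linear[OF MN P]
  show "linear_map k (Ten M NP) (Ten MN P) (Mod_unassoc M N P)"
    unfolding Mod_unassoc_def[abs_def]
    by (rule linear_map_compose[OF linear_map_compose[OF linear_map_compose[OF
            linear_map_compose[OF i j] a] p] q])
  have j_act: "?j (act2 M NP h u) = dact M TNP (act M) (act2 N P) h (?j u)"
    if "h \<in> carrier H" "u \<in> carrier (tens M NP)" for h u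
    by (rule dact_natural[OF mods(1) mNP mods(1) mTNP acts(1) sNP acts(1) sTNP linear_map_id
          tensor_decode_linear[OF N P] _ _ that])
      (simp_all add: tensor_decode_act[OF N P])
  note a_act = tensor_unassoc_equivariant[OF mods acts]
  have p_act: "?p (dact TMN P (act2 M N) (act P) h u) = act2 MN P h (?p u)"
    if "h \<in> carrier H" "u \<in> carrier (tens TMN P)" for h u
    by (rule dact_natural[OF mTMN mods(3) mMN mods(3) sTMN acts(3) sMN acts(3)
          Mod_proj_linear[OF M N] linear_map_id _ _ that])
      (simp_all add: Mod_proj_act[OF M N])
  show "Mod_unassoc M N P (bracket M NP x (bracket N P y z)) = bracket MN P (bracket M N x y) z"
    if x: "x \<in> carrier M" and y: "y \<in> carrier N" and z: "z \<in> carrier P" for x y z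
  proof -
    note yz = bracket_closed[OF N P y z] and pxy = pure_tensor_closed[OF mods(1,2) x y]
    note pyz = pure_tensor_closed[OF mods(2,3) y z]
    have "?j (?i (bracket M NP x (bracket N P y z))) =
        dact M TNP (act M) (act2 N P) 1\<^sub>H (pure M TNP x (pure N P y z))"
      unfolding tensor_decode_bracket[OF M NP x yz]
        j_act[OF H.one_closed pure_tensor_closed[OF mods(1) mNP x yz]]
        tensor_map_pure[OF mods(1) mNP mods(1) mTNP linear_map_id tensor_decode_linear[OF N P] x yz]
        tensor_decode_bracket[OF N P y z]
      by (rule dact_pure_absorb(2)[OF mods(1) mTNP acts(1) sTNP x pyz])
    then have "?p (?a (?j (?i (bracket M NP x (bracket N P y z))))) =
        act2 MN P 1\<^sub>H (pure MN P (bracket M N x y) z)"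
      using a_act[OF H.one_closed pure_tensor_closed[OF mods(1) mTNP x pyz]]
        tensor_unassoc_pure[OF mods x y z] p_act[OF H.one_closed pure_tensor_closed[OF mTMN mods(3) pxy z]]
        tensor_map_pure[OF mTMN mods(3) mMN mods(3) Mod_proj_linear[OF M N] linear_map_id pxy z]
      by (simp add: bracket_def)
    then show ?thesis
      unfolding Mod_unassoc_def
      by (simp add: bracket_def[of MN P]
          Mod_proj_act_one[OF MN P pure_tensor_closed[OF mMN mods(3) bracket_closed[OF M N x y] z]])
  qed
qed

end

lemma Mod_tensor_eqI_left:
  assumes M: "lmod M" and N: "lmod N" and P: "lmod P"
    and f: "linear_map k (Ten (Ten M N) P) Q f"
    and g: "linear_map k (Ten (Ten M N) P) Q g"
    and eq: "\<And>a b c. a \<in> carrier M \<Longrightarrow> b \<in> carrier N \<Longrightarrow> c \<in> carrier P \<Longrightarrow>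
      f (bracket (Ten M N) P (bracket M N a b) c) =
      g (bracket (Ten M N) P (bracket M N a b) c)"
    and x: "x \<in> carrier (Ten (Ten M N) P)"
  shows "f x = g x"
proof (rule Mod_tensor_eqI[OF Mod_tensor_left_module[OF M N] P f g _ x])
  fix u c assume u: "u \<in> carrier (Ten M N)" and c: "c \<in> carrier P"
  note b = bilinearD(2)[OF bracket_bilinear[OF Mod_tensor_left_module[OF M N] P] c]
  show "f (bracket (Ten M N) P u c) = g (bracket (Ten M N) P u c)"
    by (rule Mod_tensor_eqI[OF M N linear_map_compose[OF b f] linear_map_compose[OF b g] _ u])
      (rule eq[OF _ _ c])
qed

lemma Mod_tensor_eqI_right:
  assumes M: "lmod M" and N: "lmod N" and P: "lmod P"
    and f: "linear_map k (Ten M (Ten N P)) Q f"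
    and g: "linear_map k (Ten M (Ten N P)) Q g"
    and eq: "\<And>a b c. a \<in> carrier M \<Longrightarrow> b \<in> carrier N \<Longrightarrow> c \<in> carrier P \<Longrightarrow>
      f (bracket M (Ten N P) a (bracket N P b c)) =
      g (bracket M (Ten N P) a (bracket N P b c))"
    and x: "x \<in> carrier (Ten M (Ten N P))"
  shows "f x = g x"
proof (rule Mod_tensor_eqI[OF M Mod_tensor_left_module[OF N P] f g _ x])
  fix a u assume a: "a \<in> carrier M" and u: "u \<in> carrier (Ten N P)"
  note b = bilinearD(1)[OF bracket_bilinear[OF M Mod_tensor_left_module[OF N P]] a]
  show "f (bracket M (Ten N P) a u) = g (bracket M (Ten N P) a u)"
    by (rule Mod_tensor_eqI[OF N P linear_map_compose[OF b f] linear_map_compose[OF b g] _ u])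
      (rule eq[OF a])
qed

end

section \<open>The unit object and the unit constraints\<close>

context prebialgebra
begin

abbreviation "HL \<equiv> lunit_module k H \<epsilon>"

lemma g_map_apply: "x \<in> carrier H \<Longrightarrow> g_map H \<epsilon> h x = \<epsilon> (x \<cdot> h)"
  by (simp add: g_map_def)

lemma lunit_simps:
  "carrier HL = g_map H \<epsilon> ` carrier H"
  "\<zero>\<^bsub>HL\<^esub> = (\<lambda>x \<in> carrier H. \<zero>\<^bsub>k\<^esub>)"
  "\<phi> \<oplus>\<^bsub>HL\<^esub> \<psi> = (\<lambda>x \<in> carrier H. \<phi> x \<oplus>\<^bsub>k\<^esub> \<psi> x)"
  "a \<odot>\<^bsub>HL\<^esub> \<phi> = (\<lambda>x \<in> carrier H. a \<otimes>\<^bsub>k\<^esub> \<phi> x)"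
  by (simp_all add: lunit_module_def dual_module_def)

lemma lunit_act:
  assumes h: "h \<in> carrier H" and h': "h' \<in> carrier H"
  shows "act HL h (g_map H \<epsilon> h') = g_map H \<epsilon> (h \<cdot> h')"
proof -
  have key: "g_map H \<epsilon> (h \<cdot> h'') = g_map H \<epsilon> (h \<cdot> h')"
    if h'': "h'' \<in> carrier H" and eq: "g_map H \<epsilon> h' = g_map H \<epsilon> h''" for h''
  proof -
    have "\<epsilon> (x \<cdot> (h \<cdot> h'')) = \<epsilon> (x \<cdot> (h \<cdot> h'))" if x: "x \<in> carrier H" for x
      using fun_cong[OF eq, of "x \<cdot> h"] x h h' h'' by (simp add: g_map_apply H.m_assoc)
    then show ?thesis unfolding g_map_def by (rule restrict_ext)
  qed
  have "act HL h (g_map H \<epsilon> h') = (THE \<psi>. \<exists>h'' \<in> carrier H.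
      g_map H \<epsilon> h' = g_map H \<epsilon> h'' \<and> \<psi> = g_map H \<epsilon> (h \<cdot> h''))"
    by (simp add: lunit_module_def)
  also have "\<dots> = g_map H \<epsilon> (h \<cdot> h')"
  proof (rule the_equality)
    fix \<psi> assume "\<exists>h'' \<in> carrier H. g_map H \<epsilon> h' = g_map H \<epsilon> h'' \<and> \<psi> = g_map H \<epsilon> (h \<cdot> h'')"
    then show "\<psi> = g_map H \<epsilon> (h \<cdot> h')" using key by metis
  qed (use h' in blast)
  finally show ?thesis .
qed

lemma g_map_linear: "linear_map k H HL (g_map H \<epsilon>)"
proof (rule linear_mapI)
  fix x y assume xy: "x \<in> carrier H" "y \<in> carrier H"
  have "\<epsilon> (z \<cdot> (x \<oplus>\<^bsub>H\<^esub> y)) = \<epsilon> (z \<cdot> x) \<oplus>\<^bsub>k\<^esub> \<epsilon> (z \<cdot> y)" if "z \<in> carrier H" for z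
    using linear_mapD(2)[OF counit_mult_linear(2)[OF that] xy] by simp
  then show "g_map H \<epsilon> (x \<oplus>\<^bsub>H\<^esub> y) = g_map H \<epsilon> x \<oplus>\<^bsub>HL\<^esub> g_map H \<epsilon> y"
    unfolding lunit_simps by (auto simp: g_map_def fun_eq_iff)
next
  fix a x assume ax: "a \<in> carrier k" "x \<in> carrier H"
  have "\<epsilon> (z \<cdot> (a \<odot>\<^bsub>H\<^esub> x)) = a \<otimes>\<^bsub>k\<^esub> \<epsilon> (z \<cdot> x)" if "z \<in> carrier H" for z
    using linear_mapD(3)[OF counit_mult_linear(2)[OF that] ax] by simp
  then show "g_map H \<epsilon> (a \<odot>\<^bsub>H\<^esub> x) = a \<odot>\<^bsub>HL\<^esub> g_map H \<epsilon> x"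
    unfolding lunit_simps by (auto simp: g_map_def fun_eq_iff)
qed (simp add: lunit_simps)

lemma lunit_left_module: "lmod HL"
proof (rule left_module_surj_image[OF H_module mult_semiaction lunit_simps(1)[symmetric] g_map_linear])
  have "\<epsilon> (x \<cdot> \<zero>\<^bsub>H\<^esub>) = \<zero>\<^bsub>k\<^esub>" if "x \<in> carrier H" for x
    using linear_map_zero[OF H_module module_self counit_mult_linear(2)[OF that]]
    by (simp add: self_module_def)
  then show "g_map H \<epsilon> \<zero>\<^bsub>H\<^esub> = \<zero>\<^bsub>HL\<^esub>"
    unfolding lunit_simps g_map_def by (rule restrict_ext)
qed (simp_all add: lunit_act)

lemma lunit_eval_linear:
  assumes "x \<in> carrier H"
  shows "linear_map k HL (self_module k) (\<lambda>\<phi>. \<phi> x)"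
  by (rule linear_mapI) (use assms in \<open>auto simp: lunit_simps g_map_apply counit_mult_closed\<close>)

lemma lunit_functional:
  assumes "\<phi> \<in> carrier HL"
  shows "linear_map k H (self_module k) \<phi>"
proof -
  obtain h where h: "h \<in> carrier H" "\<phi> = g_map H \<epsilon> h" using assms by (auto simp: lunit_simps)
  show ?thesis
    by (rule linear_map_cong[OF counit_mult_linear(1)[OF h(1)] _ H_module])
      (simp add: h(2) g_map_apply)
qed

lemma f_map_linear:
  shows "linear_map k HL H (f_map k H \<Delta>)" "linear_map k HL H (f'_map k H \<Delta>)"
proof -
  note mU = left_moduleD(1)[OF lunit_left_module] and c = comult_closed[OF H.one_closed]
  note e = linear_map_smult_const[OF lunit_eval_linear H_module]
  show "linear_map k HL H (f_map k H \<Delta>)"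
    unfolding f_map_def[abs_def]
    by (rule tensor_lift_linear_parameter[OF H_module H_module H_module mU
          functional_bilinear(1)[OF H_module H_module lunit_functional] _ c]) (assumption | rule e)+
  show "linear_map k HL H (f'_map k H \<Delta>)"
    unfolding f'_map_def[abs_def]
    by (rule tensor_lift_linear_parameter[OF H_module H_module H_module mU
          functional_bilinear(2)[OF H_module H_module lunit_functional] _ c]) (assumption | rule e)+
qed

lemma unit_action_bilinear:
  assumes M: "lmod M"
  shows "bilinear HL M M (\<lambda>\<phi> x. act M (f_map k H \<Delta> \<phi>) x)"
    and "bilinear M HL M (\<lambda>x \<phi>. act M (f'_map k H \<Delta> \<phi>) x)"
proof -
  note B = semiactionD(1)[OF left_moduleD(2)[OF M]]
  show "bilinear HL M M (\<lambda>\<phi> x. act M (f_map k H \<Delta> \<phi>) x)"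
    by (rule bilinear_compose[OF B f_map_linear(1) linear_map_id linear_map_id])
  have "bilinear HL M M (\<lambda>\<phi> x. act M (f'_map k H \<Delta> \<phi>) x)"
    by (rule bilinear_compose[OF B f_map_linear(2) linear_map_id linear_map_id])
  then show "bilinear M HL M (\<lambda>x \<phi>. act M (f'_map k H \<Delta> \<phi>) x)"
    by (simp add: bilinear_def)
qed

abbreviation "left_ev M \<equiv> tlift HL M M (\<lambda>\<phi> x. act M (f_map k H \<Delta> \<phi>) x)"
abbreviation "right_ev M \<equiv> tlift M HL M (\<lambda>x \<phi>. act M (f'_map k H \<Delta> \<phi>) x)"

abbreviation "mul2 \<equiv> tensor_act k H H H (mult H) (mult H)"

text \<open>In Sweedler notation for \<open>w\<close>, the first equation reads
  \<open>\<epsilon>(w\<^sub>1 a h) w\<^sub>2 b = \<epsilon>((w\<^sub>1 a) h) (w\<^sub>2 b)\<close>: slicing by \<open>a h\<close> and then multiplying by \<open>b\<close> is slicing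
  \<open>w (a \<otimes> b)\<close> by \<open>h\<close>.\<close>

lemma lift_mul2:
  assumes h: "h \<in> carrier H" and a: "a \<in> carrier H" and b: "b \<in> carrier H" and w: "w \<in> carrier HH"
  shows "tlift H H H (\<lambda>p q. \<epsilon> (p \<cdot> (a \<cdot> h)) \<odot>\<^bsub>H\<^esub> q) w \<cdot> b =
      tlift H H H (\<lambda>p q. \<epsilon> (p \<cdot> h) \<odot>\<^bsub>H\<^esub> q) (mul2 w (pure H H a b))"
    and "tlift H H H (\<lambda>p q. \<epsilon> (q \<cdot> (b \<cdot> h)) \<odot>\<^bsub>H\<^esub> p) w \<cdot> a =
      tlift H H H (\<lambda>p q. \<epsilon> (q \<cdot> h) \<odot>\<^bsub>H\<^esub> p) (mul2 w (pure H H a b))"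
proof -
  note mul = tensor_act_bilinear(1)[OF H_module H_module mult_bilinear mult_bilinear]
  note mul_pure = tensor_act_pure[OF H_module H_module mult_bilinear mult_bilinear]
  note mul_ab = bilinearD(2)[OF mul pure_tensor_closed[OF H_module H_module a b]]
  note e = counit_mult_linear(1)[OF h]
  note ea = counit_mult_linear(1)[OF H.m_closed[OF a h]]
  note eb = counit_mult_linear(1)[OF H.m_closed[OF b h]]
  show "tlift H H H (\<lambda>p q. \<epsilon> (p \<cdot> (a \<cdot> h)) \<odot>\<^bsub>H\<^esub> q) w \<cdot> b =
      tlift H H H (\<lambda>p q. \<epsilon> (p \<cdot> h) \<odot>\<^bsub>H\<^esub> q) (mul2 w (pure H H a b))"
    by (rule tensor_map_eqI[OF H_module H_module
          linear_map_compose[OF lift_left_linear[OF ea] bilinearD(2)[OF mult_bilinear b]]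
          linear_map_compose[OF mul_ab lift_left_linear[OF e]] _ w])
      (simp add: a b h lift_left_pure[OF e] lift_left_pure[OF ea] mul_pure
        smult_mult_left[symmetric] counit_mult_closed H.m_assoc)
  show "tlift H H H (\<lambda>p q. \<epsilon> (q \<cdot> (b \<cdot> h)) \<odot>\<^bsub>H\<^esub> p) w \<cdot> a =
      tlift H H H (\<lambda>p q. \<epsilon> (q \<cdot> h) \<odot>\<^bsub>H\<^esub> p) (mul2 w (pure H H a b))"
    by (rule tensor_map_eqI[OF H_module H_module
          linear_map_compose[OF lift_right_linear[OF eb] bilinearD(2)[OF mult_bilinear a]]
          linear_map_compose[OF mul_ab lift_right_linear[OF e]] _ w])
      (simp add: a b h lift_right_pure[OF e] lift_right_pure[OF eb] mul_pure
        smult_mult_left[symmetric] counit_mult_closed H.m_assoc)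
qed

lemma mul2_one_comult: "c \<in> carrier H \<Longrightarrow> mul2 (\<Delta> 1\<^sub>H) (\<Delta> c) = \<Delta> c"
  using comult_mult[OF H.one_closed, of c] by simp

text \<open>The left-hand side is \<open>\<epsilon>(1\<^sub>1 c\<^sub>1 h) 1\<^sub>2 c\<^sub>2 x\<close>, where \<open>1\<^sub>1 \<otimes> 1\<^sub>2\<close> comes from the definition of \<open>f\<close>, and
  \<open>\<Delta>(1) \<Delta>(c) = \<Delta>(c)\<close>. For \<open>c = 1\<close> it evaluates the left unit constraint on a bracket; for general
  \<open>c\<close> it expresses how the constraint meets the action of \<open>c\<close>.\<close>

lemma left_ev_dact:
  assumes M: "lmod M" and c: "c \<in> carrier H" and h: "h \<in> carrier H"
    and x: "x \<in> carrier M"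
  shows "left_ev M (act2 HL M c (pure HL M (g_map H \<epsilon> h) x)) = act M (slice_left h c) x"
proof -
  note mM = left_moduleD(1)[OF M] and mU = left_moduleD(1)[OF lunit_left_module]
  note sM = left_moduleD(2)[OF M] and sU = left_moduleD(2)[OF lunit_left_module]
  note E = tensor_lift_linear[OF mU mM mM unit_action_bilinear(1)[OF M]]
  note E_pure = tensor_lift_pure[OF mU mM mM unit_action_bilinear(1)[OF M]]
  note mul = tensor_act_bilinear(1)[OF H_module H_module mult_bilinear mult_bilinear]
  note e = counit_mult_linear(1)[OF h]
  note act_x = bilinearD(2)[OF semiactionD(1)[OF sM] x]
  have gU: "g_map H \<epsilon> h \<in> carrier HL" if "h \<in> carrier H" for h
    using that by (simp add: lunit_simps)
  note act_g = bilinearD(2)[OF semiactionD(1)[OF sU] gU[OF h]]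
  note t = tensor_map_linear[OF H_module H_module mU mM act_g act_x]
  note D1 = comult_closed[OF H.one_closed]
  have "left_ev M (tmap H HL H M (\<lambda>a. act HL a (g_map H \<epsilon> h)) (\<lambda>b. act M b x) w) =
      act M (tlift H H H (\<lambda>p q. \<epsilon> (p \<cdot> h) \<odot>\<^bsub>H\<^esub> q) (mul2 (\<Delta> 1\<^sub>H) w)) x"
    if w: "w \<in> carrier HH" for w
  proof (rule tensor_map_eqI[OF H_module H_module linear_map_compose[OF t E]
        linear_map_compose[OF linear_map_compose[OF bilinearD(1)[OF mul D1] lift_left_linear[OF e]]
          act_x] _ w])
    fix a b assume a: "a \<in> carrier H" and b: "b \<in> carrier H"
    have ah: "a \<cdot> h \<in> carrier H" using a h by simp
    have "left_ev M (tmap H HL H M (\<lambda>a. act HL a (g_map H \<epsilon> h)) (\<lambda>b. act M b x)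
        (pure H H a b)) = act M (slice_left (a \<cdot> h) 1\<^sub>H) (act M b x)"
      by (simp add: tensor_map_pure[OF H_module H_module mU mM act_g act_x a b] lunit_act[OF a h]
          E_pure[OF gU[OF ah] act_closed[OF M b x]] f_map_g_map(1)[OF ah])
    also have "\<dots> = act M (slice_left (a \<cdot> h) 1\<^sub>H \<cdot> b) x"
      by (rule semiactionD(2)[OF sM slice_closed(1)[OF ah H.one_closed] b x, symmetric])
    finally show "left_ev M (tmap H HL H M (\<lambda>a. act HL a (g_map H \<epsilon> h)) (\<lambda>b. act M b x)
        (pure H H a b)) = act M (tlift H H H
          (\<lambda>p q. \<epsilon> (p \<cdot> h) \<odot>\<^bsub>H\<^esub> q) (mul2 (\<Delta> 1\<^sub>H) (pure H H a b))) x"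
      by (simp only: slice_left_def lift_mul2(1)[OF h a b D1])
  qed
  from this[OF comult_closed[OF c]] show ?thesis
    by (simp only: dact_pure[OF mU mM sU sM gU[OF h] x] mul2_one_comult[OF c] slice_left_def)
qed

lemma right_ev_dact:
  assumes M: "lmod M" and c: "c \<in> carrier H" and h: "h \<in> carrier H"
    and x: "x \<in> carrier M"
  shows "right_ev M (act2 M HL c (pure M HL x (g_map H \<epsilon> h))) = act M (slice_right h c) x"
proof -
  note mM = left_moduleD(1)[OF M] and mU = left_moduleD(1)[OF lunit_left_module]
  note sM = left_moduleD(2)[OF M] and sU = left_moduleD(2)[OF lunit_left_module]
  note E = tensor_lift_linear[OF mM mU mM unit_action_bilinear(2)[OF M]]
  note E_pure = tensor_lift_pure[OF mM mU mM unit_action_bilinear(2)[OF M]]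
  note mul = tensor_act_bilinear(1)[OF H_module H_module mult_bilinear mult_bilinear]
  note e = counit_mult_linear(1)[OF h]
  note act_x = bilinearD(2)[OF semiactionD(1)[OF sM] x]
  have gU: "g_map H \<epsilon> h \<in> carrier HL" if "h \<in> carrier H" for h
    using that by (simp add: lunit_simps)
  note act_g = bilinearD(2)[OF semiactionD(1)[OF sU] gU[OF h]]
  note t = tensor_map_linear[OF H_module H_module mM mU act_x act_g]
  note D1 = comult_closed[OF H.one_closed]
  have "right_ev M (tmap H M H HL (\<lambda>a. act M a x) (\<lambda>b. act HL b (g_map H \<epsilon> h)) w) =
      act M (tlift H H H (\<lambda>p q. \<epsilon> (q \<cdot> h) \<odot>\<^bsub>H\<^esub> p) (mul2 (\<Delta> 1\<^sub>H) w)) x"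
    if w: "w \<in> carrier HH" for w
  proof (rule tensor_map_eqI[OF H_module H_module linear_map_compose[OF t E]
        linear_map_compose[OF linear_map_compose[OF bilinearD(1)[OF mul D1] lift_right_linear[OF e]]
          act_x] _ w])
    fix a b assume a: "a \<in> carrier H" and b: "b \<in> carrier H"
    have bh: "b \<cdot> h \<in> carrier H" using b h by simp
    have "right_ev M (tmap H M H HL (\<lambda>a. act M a x) (\<lambda>b. act HL b (g_map H \<epsilon> h))
        (pure H H a b)) = act M (slice_right (b \<cdot> h) 1\<^sub>H) (act M a x)"
      by (simp add: tensor_map_pure[OF H_module H_module mM mU act_x act_g a b] lunit_act[OF b h]
          E_pure[OF act_closed[OF M a x] gU[OF bh]] f_map_g_map(2)[OF bh])
    also have "\<dots> = act M (slice_right (b \<cdot> h) 1\<^sub>H \<cdot> a) x"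
      by (rule semiactionD(2)[OF sM slice_closed(2)[OF bh H.one_closed] a x, symmetric])
    finally show "right_ev M (tmap H M H HL (\<lambda>a. act M a x) (\<lambda>b. act HL b (g_map H \<epsilon> h))
        (pure H H a b)) = act M (tlift H H H
          (\<lambda>p q. \<epsilon> (q \<cdot> h) \<odot>\<^bsub>H\<^esub> p) (mul2 (\<Delta> 1\<^sub>H) (pure H H a b))) x"
      by (simp only: slice_right_def lift_mul2(2)[OF h a b D1])
  qed
  from this[OF comult_closed[OF c]] show ?thesis
    by (simp only: dact_pure[OF mM mU sM sU x gU[OF h]] mul2_one_comult[OF c] slice_right_def)
qed

definition unit_elt :: "'h \<Rightarrow> ('k, 'h, 'x) universe" where "unit_elt h = Functional (g_map H \<epsilon> h)"

abbreviation "Unit \<equiv> Mod_unit k H \<epsilon>"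

lemma Functional_inj: "inj_on Functional A"
  by (simp add: inj_on_def)

lemma Mod_unit_left_module: "lmod Unit"
  unfolding Mod_unit_def by (rule transport_left_module(1)[OF lunit_left_module Functional_inj])

lemma unit_elt_facts:
  "linear_map k H Unit unit_elt"
  "carrier Unit = unit_elt ` carrier H"
  "h \<in> carrier H \<Longrightarrow> a \<in> carrier H \<Longrightarrow> act Unit a (unit_elt h) = unit_elt (a \<cdot> h)"
  "h \<in> carrier H \<Longrightarrow> unit_decode k H \<epsilon> (unit_elt h) = g_map H \<epsilon> h"
proof -
  show "linear_map k H Unit unit_elt"
    unfolding Mod_unit_def unit_elt_def[abs_def]
    by (rule linear_map_compose[OF g_map_linear transport_left_module(2)[OF lunit_left_module
            Functional_inj]])
  show "carrier Unit = unit_elt ` carrier H"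
    by (auto simp: Mod_unit_def transport_simps[OF Functional_inj] lunit_simps unit_elt_def)
  show "h \<in> carrier H \<Longrightarrow> a \<in> carrier H \<Longrightarrow> act Unit a (unit_elt h) = unit_elt (a \<cdot> h)"
    by (simp add: Mod_unit_def unit_elt_def transport_simps(5)[OF Functional_inj] lunit_simps
        lunit_act)
  show "h \<in> carrier H \<Longrightarrow> unit_decode k H \<epsilon> (unit_elt h) = g_map H \<epsilon> h"
    by (simp add: unit_decode_def unit_elt_def Functional_inj lunit_simps)
qed

lemma unit_elt_closed: "h \<in> carrier H \<Longrightarrow> unit_elt h \<in> carrier Unit"
  by (simp add: unit_elt_facts)

lemma unit_decode_linear: "linear_map k Unit HL (unit_decode k H \<epsilon>)"
  unfolding Mod_unit_def unit_decode_def
  by (rule transport_left_module(3)[OF lunit_left_module Functional_inj])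

lemma unit_decode_act:
  assumes "h \<in> carrier H" "\<phi> \<in> carrier Unit"
  shows "unit_decode k H \<epsilon> (act Unit h \<phi>) = act HL h (unit_decode k H \<epsilon> \<phi>)"
  using assms by (auto simp: unit_elt_facts(2-4) lunit_act)

lemma Mod_left_unit_eq:
  assumes M: "lmod M" and x: "x \<in> carrier (Ten Unit M)"
  shows "LUnit M x =
    left_ev M (tmap Unit HL M M (unit_decode k H \<epsilon>) (\<lambda>u. u) (decode Unit M x))"
proof -
  note d = linear_mapD(1)[OF tensor_decode_linear_ltensor[OF Mod_unit_left_module M] x]
  have "tmap Unit HL M M (unit_decode k H \<epsilon>) (\<lambda>u. u) (decode Unit M x)
      \<in> carrier (lten HL M)"
    by (rule ltensor_tensor_map[OF Mod_unit_left_module M lunit_left_module M unit_decode_linear linear_map_id _ _ d])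
      (simp_all add: unit_decode_act)
  then show ?thesis
    using x d by (simp add: Mod_left_unit_def Let_def left_unit_def ltensor_map_def)
qed

lemma Mod_right_unit_eq:
  assumes M: "lmod M" and x: "x \<in> carrier (Ten M Unit)"
  shows "RUnit M x =
    right_ev M (tmap M M Unit HL (\<lambda>u. u) (unit_decode k H \<epsilon>) (decode M Unit x))"
proof -
  note d = linear_mapD(1)[OF tensor_decode_linear_ltensor[OF M Mod_unit_left_module] x]
  have "tmap M M Unit HL (\<lambda>u. u) (unit_decode k H \<epsilon>) (decode M Unit x)
      \<in> carrier (lten M HL)"
    by (rule ltensor_tensor_map[OF M Mod_unit_left_module M lunit_left_module linear_map_id unit_decode_linear _ _ d])
      (simp_all add: unit_decode_act)
  then show ?thesis
    using x d by (simp add: Mod_right_unit_def Let_def right_unit_def ltensor_map_def)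
qed

end

context monoidal_prebialgebra
begin

lemma Mod_left_unit_hom:
  fixes M :: "('k, 'h, 'x) umodule"
  assumes M: "lmod M"
  shows "LUnit M \<in> left_module_maps k H (Ten Unit M) M"
    and "h \<in> carrier H \<Longrightarrow> x \<in> carrier M \<Longrightarrow>
      LUnit M (bracket Unit M (unit_elt h) x) = act M (slice_left h 1\<^sub>H) x"
proof -
  note Unit = Mod_unit_left_module and HL = lunit_left_module
  note mM = left_moduleD(1)[OF M] and mU = left_moduleD(1)[OF HL] and mUn = left_moduleD(1)[OF Unit]
  note sM = left_moduleD(2)[OF M] and sU = left_moduleD(2)[OF HL] and sUn = left_moduleD(2)[OF Unit]
  let ?d = "tmap Unit HL M M (unit_decode k H \<epsilon>) (\<lambda>u. u)"
  note T = Mod_tensor_left_module[OF Unit M]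
  note i = tensor_decode_linear[OF Unit M]
  note d = tensor_map_linear[OF mUn mM mU mM unit_decode_linear linear_map_id]
  note E = tensor_lift_linear[OF mU mM mM unit_action_bilinear(1)[OF M]]
  have lin: "linear_map k (Ten Unit M) M (LUnit M)"
    by (rule linear_map_cong[OF linear_map_compose[OF linear_map_compose[OF i d] E]
          Mod_left_unit_eq[OF M, symmetric] left_moduleD(1)[OF T]])
  have d_act: "?d (act2 Unit M c u) = act2 HL M c (?d u)"
    if "c \<in> carrier H" "u \<in> carrier (tens Unit M)" for c u
    by (rule dact_natural[OF mUn mM mU mM sUn sM sU sM unit_decode_linear linear_map_id _ _ that])
      (simp_all add: unit_decode_act)
  have bracket_act: "LUnit M (act (Ten Unit M) c (bracket Unit M (unit_elt h) x)) =
      act M (slice_left h c) x"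
    if c: "c \<in> carrier H" and h: "h \<in> carrier H" and x: "x \<in> carrier M" for c h x
  proof -
    note G = unit_elt_closed[OF h]
    note b = bracket_closed[OF Unit M G x] and pt = pure_tensor_closed[OF mUn mM G x]
    show ?thesis
      unfolding Mod_left_unit_eq[OF M act_closed[OF T c b]] tensor_decode_act[OF Unit M c b]
        tensor_decode_bracket[OF Unit M G x] dact_one(1)[OF Unit M c pt] d_act[OF c pt]
        tensor_map_pure[OF mUn mM mU mM unit_decode_linear linear_map_id G x] unit_elt_facts(4)[OF h]
      by (rule left_ev_dact[OF M c h x])
  qed
  show bracket: "LUnit M (bracket Unit M (unit_elt h) x) = act M (slice_left h 1\<^sub>H) x"
    if h: "h \<in> carrier H" and x: "x \<in> carrier M" for h x
    using bracket_act[OF H.one_closed h x]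
      left_moduleD(3)[OF T bracket_closed[OF Unit M unit_elt_closed[OF h] x]] by simp
  show "LUnit M \<in> left_module_maps k H (Ten Unit M) M"
  proof (rule left_module_mapsI[OF lin])
    show "LUnit M \<in> extensional (carrier (Ten Unit M))"
      by (simp add: Mod_left_unit_def Let_def)
    fix c z assume c: "c \<in> carrier H" and z: "z \<in> carrier (Ten Unit M)"
    note aT = bilinearD(1)[OF semiactionD(1)[OF left_moduleD(2)[OF T]] c]
    note aM = bilinearD(1)[OF semiactionD(1)[OF sM] c]
    show "LUnit M (act (Ten Unit M) c z) = act M c (LUnit M z)"
    proof (rule Mod_tensor_eqI[OF Unit M linear_map_compose[OF aT lin] linear_map_compose[OF lin aM] _ z])
      fix \<phi> :: "('k, 'h, 'x) universe" and x assume "\<phi> \<in> carrier Unit" and x: "x \<in> carrier M"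
      then obtain h where h: "h \<in> carrier H" "\<phi> = unit_elt h" by (auto simp: unit_elt_facts(2))
      show "LUnit M (act (Ten Unit M) c (bracket Unit M \<phi> x)) =
          act M c (LUnit M (bracket Unit M \<phi> x))"
        unfolding h(2) bracket_act[OF c h(1) x] bracket[OF h(1) x]
        using semiactionD(2)[OF sM c slice_closed(1)[OF h(1) H.one_closed] x]
          slice_left_mult[OF h(1) c H.one_closed] c by simp
    qed
  qed
qed

lemma Mod_right_unit_hom:
  fixes M :: "('k, 'h, 'x) umodule"
  assumes M: "lmod M"
  shows "RUnit M \<in> left_module_maps k H (Ten M Unit) M"
    and "h \<in> carrier H \<Longrightarrow> x \<in> carrier M \<Longrightarrow>
      RUnit M (bracket M Unit x (unit_elt h)) = act M (slice_right h 1\<^sub>H) x"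
proof -
  note Unit = Mod_unit_left_module and HL = lunit_left_module
  note mM = left_moduleD(1)[OF M] and mU = left_moduleD(1)[OF HL] and mUn = left_moduleD(1)[OF Unit]
  note sM = left_moduleD(2)[OF M] and sU = left_moduleD(2)[OF HL] and sUn = left_moduleD(2)[OF Unit]
  let ?d = "tmap M M Unit HL (\<lambda>u. u) (unit_decode k H \<epsilon>)"
  note T = Mod_tensor_left_module[OF M Unit]
  note i = tensor_decode_linear[OF M Unit]
  note d = tensor_map_linear[OF mM mUn mM mU linear_map_id unit_decode_linear]
  note E = tensor_lift_linear[OF mM mU mM unit_action_bilinear(2)[OF M]]
  have lin: "linear_map k (Ten M Unit) M (RUnit M)"
    by (rule linear_map_cong[OF linear_map_compose[OF linear_map_compose[OF i d] E]
          Mod_right_unit_eq[OF M, symmetric] left_moduleD(1)[OF T]])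
  have d_act: "?d (act2 M Unit c u) = act2 M HL c (?d u)"
    if "c \<in> carrier H" "u \<in> carrier (tens M Unit)" for c u
    by (rule dact_natural[OF mM mUn mM mU sM sUn sM sU linear_map_id unit_decode_linear _ _ that])
      (simp_all add: unit_decode_act)
  have bracket_act: "RUnit M (act (Ten M Unit) c (bracket M Unit x (unit_elt h))) =
      act M (slice_right h c) x"
    if c: "c \<in> carrier H" and h: "h \<in> carrier H" and x: "x \<in> carrier M" for c h x
  proof -
    note G = unit_elt_closed[OF h]
    note b = bracket_closed[OF M Unit x G] and pt = pure_tensor_closed[OF mM mUn x G]
    show ?thesis
      unfolding Mod_right_unit_eq[OF M act_closed[OF T c b]] tensor_decode_act[OF M Unit c b]
        tensor_decode_bracket[OF M Unit x G] dact_one(1)[OF M Unit c pt] d_act[OF c pt]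
        tensor_map_pure[OF mM mUn mM mU linear_map_id unit_decode_linear x G] unit_elt_facts(4)[OF h]
      by (rule right_ev_dact[OF M c h x])
  qed
  show bracket: "RUnit M (bracket M Unit x (unit_elt h)) = act M (slice_right h 1\<^sub>H) x"
    if h: "h \<in> carrier H" and x: "x \<in> carrier M" for h x
    using bracket_act[OF H.one_closed h x]
      left_moduleD(3)[OF T bracket_closed[OF M Unit x unit_elt_closed[OF h]]] by simp
  show "RUnit M \<in> left_module_maps k H (Ten M Unit) M"
  proof (rule left_module_mapsI[OF lin])
    show "RUnit M \<in> extensional (carrier (Ten M Unit))"
      by (simp add: Mod_right_unit_def Let_def)
    fix c z assume c: "c \<in> carrier H" and z: "z \<in> carrier (Ten M Unit)"
    note aT = bilinearD(1)[OF semiactionD(1)[OF left_moduleD(2)[OF T]] c]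
    note aM = bilinearD(1)[OF semiactionD(1)[OF sM] c]
    show "RUnit M (act (Ten M Unit) c z) = act M c (RUnit M z)"
    proof (rule Mod_tensor_eqI[OF M Unit linear_map_compose[OF aT lin] linear_map_compose[OF lin aM] _ z])
      fix x and \<phi> :: "('k, 'h, 'x) universe" assume x: "x \<in> carrier M" and "\<phi> \<in> carrier Unit"
      then obtain h where h: "h \<in> carrier H" "\<phi> = unit_elt h" by (auto simp: unit_elt_facts(2))
      show "RUnit M (act (Ten M Unit) c (bracket M Unit x \<phi>)) =
          act M c (RUnit M (bracket M Unit x \<phi>))"
        unfolding h(2) bracket_act[OF c h(1) x] bracket[OF h(1) x]
        using semiactionD(2)[OF sM c slice_closed(2)[OF h(1) H.one_closed] x]
          slice_right_mult[OF h(1) c H.one_closed] c by simp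
    qed
  qed
qed

text \<open>By \<open>H\<close>-linearity of the slices,
  \<open>1\<^sub>1 x \<otimes> 1\<^sub>2 \<lambda>\<^sub>h(1) y = 1\<^sub>1 x \<otimes> \<lambda>\<^sub>h(1\<^sub>2) y = \<rho>\<^sub>h(1\<^sub>1) x \<otimes> 1\<^sub>2 y = 1\<^sub>1 \<rho>\<^sub>h(1) x \<otimes> 1\<^sub>2 y\<close>. The triangle identity
  and the invertibility of both unit constraints rest on this exchange.\<close>

lemma bracket_exchange:
  assumes M: "lmod M" and N: "lmod N" and h: "h \<in> carrier H"
    and x: "x \<in> carrier M" and y: "y \<in> carrier N"
  shows "bracket M N x (act N (slice_left h 1\<^sub>H) y) =
    bracket M N (act M (slice_right h 1\<^sub>H) x) y"
proof -
  note m = left_moduleD(1)[OF M] left_moduleD(1)[OF N]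
  note s = left_moduleD(2)[OF M] left_moduleD(2)[OF N]
  note cl = slice_closed[OF h H.one_closed]
  note ax = bilinearD(2)[OF semiactionD(1)[OF s(1)] x] and ay = bilinearD(2)[OF semiactionD(1)[OF s(2)] y]
  note lin = slice_linear[OF h]
  have left: "act N b (act N (slice_left h 1\<^sub>H) y) = act N (slice_left h b) y"
    if b: "b \<in> carrier H" for b
    using semiactionD(2)[OF s(2) b cl(1) y] slice_left_mult[OF h b H.one_closed] b by simp
  have right: "act M a (act M (slice_right h 1\<^sub>H) x) = act M (slice_right h a) x"
    if a: "a \<in> carrier H" for a
    using semiactionD(2)[OF s(1) a cl(2) x] slice_right_mult[OF h a H.one_closed] a by simp
  have "act2 M N 1\<^sub>H (pure M N x (act N (slice_left h 1\<^sub>H) y)) =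
      tmap H M H N (\<lambda>a. act M a x) (\<lambda>b. act N (slice_left h b) y) (\<Delta> 1\<^sub>H)"
    unfolding dact_pure[OF m s x act_closed[OF N cl(1) y]]
    by (rule fun_cong[OF tensor_map_cong]) (simp_all add: left)
  also have "\<dots> = tmap H M H N (\<lambda>a. act M a x) (\<lambda>b. act N b y)
      (tmap H H H H (\<lambda>a. a) (slice_left h) (\<Delta> 1\<^sub>H))"
    by (rule tensor_map_compose[OF H_module H_module H_module H_module m linear_map_id lin(1) ax ay
          comult_closed[OF H.one_closed], symmetric])
  also have "\<dots> = tmap H M H N (\<lambda>a. act M a x) (\<lambda>b. act N b y)
      (tmap H H H H (slice_right h) (\<lambda>b. b) (\<Delta> 1\<^sub>H))"
    by (simp only: slice_exchange[OF h H.one_closed])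
  also have "\<dots> = tmap H M H N (\<lambda>a. act M (slice_right h a) x) (\<lambda>b. act N b y) (\<Delta> 1\<^sub>H)"
    by (rule tensor_map_compose[OF H_module H_module H_module H_module m lin(2) linear_map_id ax ay
          comult_closed[OF H.one_closed]])
  also have "\<dots> = act2 M N 1\<^sub>H (pure M N (act M (slice_right h 1\<^sub>H) x) y)"
    unfolding dact_pure[OF m s act_closed[OF M cl(2) x] y]
    by (rule fun_cong[OF tensor_map_cong]) (simp_all add: right)
  finally have "Mod_proj M N (act2 M N 1\<^sub>H (pure M N x (act N (slice_left h 1\<^sub>H) y))) =
      Mod_proj M N (act2 M N 1\<^sub>H (pure M N (act M (slice_right h 1\<^sub>H) x) y))"
    by simp
  then show ?thesis
    unfolding bracket_def
      Mod_proj_act_one[OF M N pure_tensor_closed[OF m x act_closed[OF N cl(1) y]]]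
      Mod_proj_act_one[OF M N pure_tensor_closed[OF m act_closed[OF M cl(2) x] y]] .
qed

lemma act_unit_elt_one:
  assumes h: "h \<in> carrier H"
  shows "act Unit (slice_right h 1\<^sub>H) (unit_elt 1\<^sub>H) = unit_elt h"
    and "act Unit (slice_left h 1\<^sub>H) (unit_elt 1\<^sub>H) = unit_elt h"
  using g_map_slice_right[OF h H.one_closed] g_map_slice_left[OF h H.one_closed]
    slice_closed[OF h H.one_closed] h
  by (simp_all add: unit_elt_facts(3)) (simp_all add: unit_elt_def)

lemma Mod_left_unit_inverse:
  fixes M :: "('k, 'h, 'x) umodule"
  assumes M: "lmod M"
  shows "x \<in> carrier M \<Longrightarrow> LUnit M (bracket Unit M (unit_elt 1\<^sub>H) x) = x"
    and "z \<in> carrier (Ten Unit M) \<Longrightarrow>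
      bracket Unit M (unit_elt 1\<^sub>H) (LUnit M z) = z"
proof -
  note Unit = Mod_unit_left_module
  show "LUnit M (bracket Unit M (unit_elt 1\<^sub>H) x) = x" if "x \<in> carrier M" for x
    using Mod_left_unit_hom(2)[OF M H.one_closed that] left_moduleD(3)[OF M that]
    by (simp add: slice_one)
  note b = bilinearD(1)[OF bracket_bilinear[OF Unit M] unit_elt_closed[OF H.one_closed]]
  show "bracket Unit M (unit_elt 1\<^sub>H) (LUnit M z) = z"
    if z: "z \<in> carrier (Ten Unit M)"
  proof (rule Mod_tensor_eqI[OF Unit M linear_map_compose[OF left_module_mapsD(1)[OF
            Mod_left_unit_hom(1)[OF M]] b] linear_map_id _ z])
    fix \<phi> :: "('k, 'h, 'x) universe" and x assume "\<phi> \<in> carrier Unit" and x: "x \<in> carrier M"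
    then obtain h where h: "h \<in> carrier H" "\<phi> = unit_elt h" by (auto simp: unit_elt_facts(2))
    show "bracket Unit M (unit_elt 1\<^sub>H) (LUnit M (bracket Unit M \<phi> x)) = bracket Unit M \<phi> x"
      unfolding h(2) Mod_left_unit_hom(2)[OF M h(1) x]
        bracket_exchange[OF Unit M h(1) unit_elt_closed[OF H.one_closed] x] act_unit_elt_one(1)[OF h(1)] ..
  qed
qed

lemma Mod_right_unit_inverse:
  fixes M :: "('k, 'h, 'x) umodule"
  assumes M: "lmod M"
  shows "x \<in> carrier M \<Longrightarrow> RUnit M (bracket M Unit x (unit_elt 1\<^sub>H)) = x"
    and "z \<in> carrier (Ten M Unit) \<Longrightarrow>
      bracket M Unit (RUnit M z) (unit_elt 1\<^sub>H) = z"
proof -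
  note Unit = Mod_unit_left_module
  show "RUnit M (bracket M Unit x (unit_elt 1\<^sub>H)) = x" if "x \<in> carrier M" for x
    using Mod_right_unit_hom(2)[OF M H.one_closed that] left_moduleD(3)[OF M that]
    by (simp add: slice_one)
  note b = bilinearD(2)[OF bracket_bilinear[OF M Unit] unit_elt_closed[OF H.one_closed]]
  show "bracket M Unit (RUnit M z) (unit_elt 1\<^sub>H) = z"
    if z: "z \<in> carrier (Ten M Unit)"
  proof (rule Mod_tensor_eqI[OF M Unit linear_map_compose[OF left_module_mapsD(1)[OF
            Mod_right_unit_hom(1)[OF M]] b] linear_map_id _ z])
    fix x and \<phi> :: "('k, 'h, 'x) universe" assume x: "x \<in> carrier M" and "\<phi> \<in> carrier Unit"
    then obtain h where h: "h \<in> carrier H" "\<phi> = unit_elt h" by (auto simp: unit_elt_facts(2))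
    show "bracket M Unit (RUnit M (bracket M Unit x \<phi>)) (unit_elt 1\<^sub>H) = bracket M Unit x \<phi>"
      unfolding h(2) Mod_right_unit_hom(2)[OF M h(1) x]
        bracket_exchange[OF M Unit h(1) x unit_elt_closed[OF H.one_closed], symmetric]
        act_unit_elt_one(2)[OF h(1)] ..
  qed
qed

end

section \<open>The monoidal category\<close>

context prebialgebra
begin

lemma left_module_maps_eqI:
  assumes "f \<in> left_module_maps k H M N" "g \<in> left_module_maps k H M N"
    and "\<And>x. x \<in> carrier M \<Longrightarrow> f x = g x"
  shows "f = g"
  using extensionalityI[OF left_module_mapsD(2)[OF assms(1)] left_module_mapsD(2)[OF assms(2)]] assms(3)
  by blast

lemma Mod_Comp_apply: "x \<in> carrier M \<Longrightarrow> Mod_Comp M N P g f x = g (f x)"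
  by (simp add: Mod_Comp_def compose_eq)

lemma Mod_Id_apply: "x \<in> carrier M \<Longrightarrow> Mod_Id M x = x"
  by (simp add: Mod_Id_def)

lemma Mod_Id_hom: "lmod M \<Longrightarrow> Mod_Id M \<in> left_module_maps k H M M"
  by (rule left_module_mapsI)
    (auto simp: Mod_Id_def act_closed intro!: linear_mapI module_ops[OF left_moduleD(1)])

lemma Mod_Comp_hom:
  assumes M: "lmod M"
    and f: "f \<in> left_module_maps k H M N" and g: "g \<in> left_module_maps k H N P"
  shows "Mod_Comp M N P g f \<in> left_module_maps k H M P"
proof (rule left_module_mapsI)
  note fl = left_module_mapsD(1)[OF f] and gl = left_module_mapsD(1)[OF g]
  show "linear_map k M P (Mod_Comp M N P g f)"
    by (rule linear_map_cong[OF linear_map_compose[OF fl gl] _ left_moduleD(1)[OF M]])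
      (simp add: Mod_Comp_apply)
  show "Mod_Comp M N P g f \<in> extensional (carrier M)"
    by (simp add: Mod_Comp_def)
  fix h x assume h: "h \<in> carrier H" and x: "x \<in> carrier M"
  show "Mod_Comp M N P g f (act M h x) = act P h (Mod_Comp M N P g f x)"
    using left_module_mapsD(3)[OF f h x] left_module_mapsD(3)[OF g h linear_mapD(1)[OF fl x]]
    by (simp add: Mod_Comp_apply x act_closed[OF M h x])
qed

lemma Mod_category:
  "category (Mod_Ob k H :: ('k, 'h, 'x) umodule set) (left_module_maps k H) Mod_Id Mod_Comp"
proof (rule category.intro)
  fix A B C D :: "('k, 'h, 'x) umodule" and f g h
  assume ob: "A \<in> Mod_Ob k H" "B \<in> Mod_Ob k H" "C \<in> Mod_Ob k H" "D \<in> Mod_Ob k H"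
    and f: "f \<in> left_module_maps k H A B" and g: "g \<in> left_module_maps k H B C"
    and h: "h \<in> left_module_maps k H C D"
  then have A: "lmod A" and B: "lmod B" and C: "lmod C"
    by (simp_all add: Mod_Ob_def)
  note fc = linear_mapD(1)[OF left_module_mapsD(1)[OF f]]
  show "Mod_Comp A B D (Mod_Comp B C D h g) f = Mod_Comp A C D h (Mod_Comp A B C g f)"
    by (rule left_module_maps_eqI[OF Mod_Comp_hom[OF A f Mod_Comp_hom[OF B g h]]
          Mod_Comp_hom[OF A Mod_Comp_hom[OF A f g] h]])
      (simp add: Mod_Comp_apply fc)
next
  fix A B :: "('k, 'h, 'x) umodule" and f
  assume ob: "A \<in> Mod_Ob k H" "B \<in> Mod_Ob k H" and f: "f \<in> left_module_maps k H A B"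
  then have A: "lmod A" and B: "lmod B"
    by (simp_all add: Mod_Ob_def)
  note fc = linear_mapD(1)[OF left_module_mapsD(1)[OF f]]
  show "Mod_Comp A B B (Mod_Id B) f = f"
    by (rule left_module_maps_eqI[OF Mod_Comp_hom[OF A f Mod_Id_hom[OF B]] f])
      (simp add: Mod_Comp_apply Mod_Id_apply fc)
  show "Mod_Comp A A B f (Mod_Id A) = f"
    by (rule left_module_maps_eqI[OF Mod_Comp_hom[OF A Mod_Id_hom[OF A] f] f])
      (simp add: Mod_Comp_apply Mod_Id_apply)
qed (simp_all add: Mod_Ob_def Mod_Id_hom Mod_Comp_hom)

lemma bijective_left_module_map_inverse:
  assumes M: "lmod M" and N: "lmod N" and f: "f \<in> left_module_maps k H M N"
    and j: "\<And>y. y \<in> carrier N \<Longrightarrow> j y \<in> carrier M"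
    and jf: "\<And>x. x \<in> carrier M \<Longrightarrow> j (f x) = x" and fj: "\<And>y. y \<in> carrier N \<Longrightarrow> f (j y) = y"
  shows "\<exists>g \<in> left_module_maps k H N M.
    Mod_Comp M N M g f = Mod_Id M \<and> Mod_Comp N M N f g = Mod_Id N"
proof -
  let ?g = "\<lambda>y \<in> carrier N. j y"
  note fl = linear_mapD[OF left_module_mapsD(1)[OF f]]
  note Mo = module_ops[OF left_moduleD(1)[OF M]] and No = module_ops[OF left_moduleD(1)[OF N]]
  have g: "?g \<in> left_module_maps k H N M"
  proof (rule left_module_mapsI)
    show "linear_map k N M ?g"
    proof (rule linear_mapI)
      fix x y assume xy: "x \<in> carrier N" "y \<in> carrier N"
      have "j (x \<oplus>\<^bsub>N\<^esub> y) = j (f (j x \<oplus>\<^bsub>M\<^esub> j y))" using xy by (simp add: fl(2) j fj)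
      then show "?g (x \<oplus>\<^bsub>N\<^esub> y) = ?g x \<oplus>\<^bsub>M\<^esub> ?g y" using xy by (simp add: jf j Mo No)
    next
      fix a x assume ax: "a \<in> carrier k" "x \<in> carrier N"
      have "j (a \<odot>\<^bsub>N\<^esub> x) = j (f (a \<odot>\<^bsub>M\<^esub> j x))" using ax by (simp add: fl(3) j fj)
      then show "?g (a \<odot>\<^bsub>N\<^esub> x) = a \<odot>\<^bsub>M\<^esub> ?g x" using ax by (simp add: jf j Mo No)
    qed (simp add: j)
    fix h x assume hx: "h \<in> carrier H" "x \<in> carrier N"
    have "j (act N h x) = j (f (act M h (j x)))"
      using hx left_module_mapsD(3)[OF f] by (simp add: j fj)
    then show "?g (act N h x) = act M h (?g x)"
      using hx by (simp add: jf j act_closed[OF M] act_closed[OF N])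
  qed simp
  have "Mod_Comp M N M ?g f = Mod_Id M"
    by (rule left_module_maps_eqI[OF Mod_Comp_hom[OF M f g] Mod_Id_hom[OF M]])
      (simp add: Mod_Comp_apply Mod_Id_apply fl jf)
  moreover have "Mod_Comp N M N f ?g = Mod_Id N"
    by (rule left_module_maps_eqI[OF Mod_Comp_hom[OF N g f] Mod_Id_hom[OF N]])
      (simp add: Mod_Comp_apply Mod_Id_apply fj)
  ultimately show ?thesis using g by blast
qed

lemma Mod_tensor_hom_eqI:
  assumes M: "lmod M" and N: "lmod N"
    and f: "f \<in> left_module_maps k H (Ten M N) P"
    and g: "g \<in> left_module_maps k H (Ten M N) P"
    and eq: "\<And>x y. x \<in> carrier M \<Longrightarrow> y \<in> carrier N \<Longrightarrow> f (bracket M N x y) = g (bracket M N x y)"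
  shows "f = g"
  by (rule left_module_maps_eqI[OF f g])
    (rule Mod_tensor_eqI[OF M N left_module_mapsD(1)[OF f] left_module_mapsD(1)[OF g] eq])

lemma Mod_tensor_hom_eqI3:
  assumes M: "lmod M" and N: "lmod N" and P: "lmod P"
    and f: "f \<in> left_module_maps k H (Ten (Ten M N) P) Q"
    and g: "g \<in> left_module_maps k H (Ten (Ten M N) P) Q"
    and eq: "\<And>a b c. a \<in> carrier M \<Longrightarrow> b \<in> carrier N \<Longrightarrow> c \<in> carrier P \<Longrightarrow>
      f (bracket (Ten M N) P (bracket M N a b) c) =
      g (bracket (Ten M N) P (bracket M N a b) c)"
  shows "f = g"
  by (rule left_module_maps_eqI[OF f g])
    (rule Mod_tensor_eqI_left[OF M N P left_module_mapsD(1)[OF f] left_module_mapsD(1)[OF g] eq])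

lemma Mod_tensor_hom_eqI4:
  assumes M: "lmod M" and N: "lmod N" and P: "lmod P"
    and Q: "lmod Q"
  defines "MN \<equiv> Ten M N"
  assumes f: "f \<in> left_module_maps k H (Ten (Ten MN P) Q) R"
    and g: "g \<in> left_module_maps k H (Ten (Ten MN P) Q) R"
    and eq: "\<And>a b c d. a \<in> carrier M \<Longrightarrow> b \<in> carrier N \<Longrightarrow> c \<in> carrier P \<Longrightarrow> d \<in> carrier Q \<Longrightarrow>
      f (bracket (Ten MN P) Q (bracket MN P (bracket M N a b) c) d) =
      g (bracket (Ten MN P) Q (bracket MN P (bracket M N a b) c) d)"
  shows "f = g"
proof (rule Mod_tensor_hom_eqI[OF Mod_tensor_left_module[OF _ P] Q f g])
  show MN: "lmod MN" unfolding MN_def by (rule Mod_tensor_left_module[OF M N])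
  fix u d assume u: "u \<in> carrier (Ten MN P)" and d: "d \<in> carrier Q"
  note b = bilinearD(2)[OF bracket_bilinear[OF Mod_tensor_left_module[OF MN P] Q] d]
  note fb = linear_map_compose[OF b left_module_mapsD(1)[OF f]]
    and gb = linear_map_compose[OF b left_module_mapsD(1)[OF g]]
  show "f (bracket (Ten MN P) Q u d) = g (bracket (Ten MN P) Q u d)"
    by (rule Mod_tensor_eqI_left[OF M N P fb[unfolded MN_def] gb[unfolded MN_def] _ u[unfolded MN_def],
          folded MN_def]) (rule eq[OF _ _ _ d])
qed

end

theorem theorem2p3:
  fixes k :: "('k, 'r) ring_scheme"
    and H :: "('k, 'h, 's) module_scheme"
    and \<Delta> :: "'h \<Rightarrow> ('k, 'h, 'h) tensor"
    and \<epsilon> :: "'h \<Rightarrow> 'k"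
  assumes "monoidal_prebialgebra k H \<Delta> \<epsilon>"
  shows "monoidal_category
    (Mod_Ob k H :: ('k, 'h, 'x) umodule set) (left_module_maps k H) Mod_Id Mod_Comp
    (Mod_tensor k H \<Delta>) (Mod_tensor_map k H \<Delta>) (Mod_unit k H \<epsilon>)
    (Mod_assoc k H \<Delta>) (Mod_left_unit k H \<Delta> \<epsilon>) (Mod_right_unit k H \<Delta> \<epsilon>)"
proof -
  interpret monoidal_prebialgebra k H \<Delta> \<epsilon> by (rule assms)
  interpret C: category "Mod_Ob k H :: ('k, 'h, 'x) umodule set" "left_module_maps k H" Mod_Id Mod_Comp
    by (rule Mod_category)
  have ob: "A \<in> Mod_Ob k H \<longleftrightarrow> lmod A" for A :: "('k, 'h, 'x) umodule"
    by (simp add: Mod_Ob_def)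
  have iso: "f \<in> C.Iso A B"
    if "lmod A" "lmod B" "f \<in> left_module_maps k H A B"
      "\<And>y. y \<in> carrier B \<Longrightarrow> j y \<in> carrier A" "\<And>x. x \<in> carrier A \<Longrightarrow> j (f x) = x"
      "\<And>y. y \<in> carrier B \<Longrightarrow> f (j y) = y"
    for A B :: "('k, 'h, 'x) umodule" and f j
    using bijective_left_module_map_inverse[of A B f j] that unfolding C.Iso_def by simp
  note T = Mod_tensor_left_module and U = Mod_unit_left_module
  note br = bracket_closed
  have fc: "f x \<in> carrier B" if "f \<in> left_module_maps k H A B" "x \<in> carrier A"
    for A B :: "('k, 'h, 'x) umodule" and f x
    using linear_mapD(1)[OF left_module_mapsD(1)[OF that(1)] that(2)] .
  note th = Mod_tensor_map_hom and ah = Mod_assoc_hom and idh = Mod_Id_hom and ch = Mod_Comp_hom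
  note lh = Mod_left_unit_hom and rh = Mod_right_unit_hom
  show ?thesis
  proof (intro monoidal_category.intro[OF Mod_category] monoidal_category_axioms.intro, unfold ob)
    fix A B :: "('k, 'h, 'x) umodule"
    assume A: "lmod A" and B: "lmod B"
    show "lmod (Ten A B)" by (rule T[OF A B])
    show "TenMap A A B B (Mod_Id A) (Mod_Id B) = Mod_Id (Ten A B)"
      by (rule Mod_tensor_hom_eqI[OF A B th(1)[OF A B A B idh[OF A] idh[OF B]] idh[OF T[OF A B]]])
        (simp add: th(2)[OF A B A B idh[OF A] idh[OF B]] Mod_Id_apply br[OF A B])
    show "Mod_Comp (Ten (Ten A Unit) B) (Ten A (Ten Unit B)) (Ten A B)
        (TenMap A A (Ten Unit B) B (Mod_Id A) (LUnit B))
        (Assoc A Unit B) =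
      TenMap (Ten A Unit) A B B (RUnit A) (Mod_Id B)"
      (is "?f = ?g")
    proof (rule Mod_tensor_hom_eqI3[OF A U B])
      note AU = T[OF A U] and UB = T[OF U B]
      note l = th[OF A UB A B idh[OF A] lh(1)[OF B]] and r = th[OF AU B A B rh(1)[OF A] idh[OF B]]
      show "?f \<in> left_module_maps k H (Ten (Ten A Unit) B) (Ten A B)"
        by (rule ch[OF T[OF AU B] ah(1)[OF A U B] l(1)])
      show "?g \<in> left_module_maps k H (Ten (Ten A Unit) B) (Ten A B)" by (rule r(1))
      fix a c and \<phi> :: "('k, 'h, 'x) universe"
      assume a: "a \<in> carrier A" and \<phi>: "\<phi> \<in> carrier Unit" and c: "c \<in> carrier B"
      then obtain h where h: "h \<in> carrier H" "\<phi> = unit_elt h" by (auto simp: unit_elt_facts(2))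
      note G = unit_elt_closed[OF h(1)]
      have "?f (bracket (Ten A Unit) B (bracket A Unit a (unit_elt h)) c) =
          bracket A B a (act B (slice_left h 1\<^sub>H) c)"
        by (simp add: Mod_Comp_apply br[OF AU B br[OF A U a G] c] ah(2)[OF A U B a G c]
            l(2)[OF a br[OF U B G c]] Mod_Id_apply a lh(2)[OF B h(1) c])
      also have "\<dots> = bracket A B (act A (slice_right h 1\<^sub>H) a) c"
        by (rule bracket_exchange[OF A B h(1) a c])
      also have "\<dots> = ?g (bracket (Ten A Unit) B (bracket A Unit a (unit_elt h)) c)"
        by (simp add: r(2)[OF br[OF A U a G] c] Mod_Id_apply c rh(2)[OF A h(1) a])
      finally show "?f (bracket (Ten A Unit) B (bracket A Unit a \<phi>) c) =
          ?g (bracket (Ten A Unit) B (bracket A Unit a \<phi>) c)" by (simp only: h(2))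
    qed
  next
    fix A A' B B' :: "('k, 'h, 'x) umodule" and f g
    assume A: "lmod A" and A': "lmod A'" and B: "lmod B"
      and B': "lmod B'" and f: "f \<in> left_module_maps k H A A'"
      and g: "g \<in> left_module_maps k H B B'"
    show "TenMap A A' B B' f g \<in> left_module_maps k H (Ten A B) (Ten A' B')"
      by (rule th(1)[OF A B A' B' f g])
  next
    fix A A' A'' B B' B'' :: "('k, 'h, 'x) umodule" and f f' g g'
    assume A: "lmod A" and A': "lmod A'" and A'': "lmod A''"
      and B: "lmod B" and B': "lmod B'" and B'': "lmod B''"
      and f: "f \<in> left_module_maps k H A A'" and f': "f' \<in> left_module_maps k H A' A''"
      and g: "g \<in> left_module_maps k H B B'" and g': "g' \<in> left_module_maps k H B' B''"
    note c1 = ch[OF A f f'] and c2 = ch[OF B g g']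
    note t = th[OF A B A'' B'' c1 c2] and t1 = th[OF A B A' B' f g] and t2 = th[OF A' B' A'' B'' f' g']
    show "TenMap A A'' B B'' (Mod_Comp A A' A'' f' f) (Mod_Comp B B' B'' g' g) =
      Mod_Comp (Ten A B) (Ten A' B') (Ten A'' B'')
        (TenMap A' A'' B' B'' f' g') (TenMap A A' B B' f g)"
      by (rule Mod_tensor_hom_eqI[OF A B t(1) ch[OF T[OF A B] t1(1) t2(1)]])
        (simp add: Mod_Comp_apply br[OF A B] t(2) t1(2) t2(2) fc[OF f] fc[OF g])
  next
    show "lmod (Unit :: ('k, 'h, 'x) umodule)" by (rule U)
  next
    fix A B C :: "('k, 'h, 'x) umodule"
    assume A: "lmod A" and B: "lmod B" and C: "lmod C"
    note AB = T[OF A B] and BC = T[OF B C]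
    note a = ah[OF A B C] and u = Mod_unassoc_linear[OF A B C]
    show "Assoc A B C \<in> C.Iso (Ten (Ten A B) C) (Ten A (Ten B C))"
    proof (rule iso[OF T[OF AB C] T[OF A BC] a(1)])
      show "Mod_unassoc A B C y \<in> carrier (Ten (Ten A B) C)" if "y \<in> carrier (Ten A (Ten B C))" for y
        by (rule linear_mapD(1)[OF u(1) that])
      show "Mod_unassoc A B C (Assoc A B C x) = x" if "x \<in> carrier (Ten (Ten A B) C)" for x
        by (rule Mod_tensor_eqI_left[OF A B C linear_map_compose[OF left_module_mapsD(1)[OF a(1)] u(1)]
              linear_map_id _ that]) (simp add: a(2) u(2))
      show "Assoc A B C (Mod_unassoc A B C y) = y" if "y \<in> carrier (Ten A (Ten B C))" for y
        by (rule Mod_tensor_eqI_right[OF A B C linear_map_compose[OF u(1) left_module_mapsD(1)[OF a(1)]]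
              linear_map_id _ that]) (simp add: a(2) u(2))
    qed
  next
    fix A A' B B' C C' :: "('k, 'h, 'x) umodule" and f g h
    assume A: "lmod A" and A': "lmod A'" and B: "lmod B"
      and B': "lmod B'" and C: "lmod C" and C': "lmod C'"
      and f: "f \<in> left_module_maps k H A A'" and g: "g \<in> left_module_maps k H B B'"
      and h: "h \<in> left_module_maps k H C C'"
    note fg = th[OF A B A' B' f g] and gh = th[OF B C B' C' g h]
    note fgh = th[OF T[OF A B] C T[OF A' B'] C' fg(1) h] and fgh' = th[OF A T[OF B C] A' T[OF B' C'] f gh(1)]
    note a = ah[OF A B C] and a' = ah[OF A' B' C']
    show "Mod_Comp (Ten (Ten A B) C) (Ten (Ten A' B') C') (Ten A' (Ten B' C'))
        (Assoc A' B' C')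
        (TenMap (Ten A B) (Ten A' B') C C' (TenMap A A' B B' f g) h) =
      Mod_Comp (Ten (Ten A B) C) (Ten A (Ten B C)) (Ten A' (Ten B' C'))
        (TenMap A A' (Ten B C) (Ten B' C') f (TenMap B B' C C' g h))
        (Assoc A B C)"
      by (rule Mod_tensor_hom_eqI3[OF A B C ch[OF T[OF T[OF A B] C] fgh(1) a'(1)]
            ch[OF T[OF T[OF A B] C] a(1) fgh'(1)]])
        (simp add: Mod_Comp_apply br[OF T[OF A B] C] br[OF A B] br[OF B C] fgh(2) fgh'(2) fg(2) gh(2)
          a(2) a'(2) fc[OF f] fc[OF g] fc[OF h])
  next
    fix A :: "('k, 'h, 'x) umodule"
    assume A: "lmod A"
    show "LUnit A \<in> C.Iso (Ten Unit A) A"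
      by (rule iso[OF T[OF U A] A lh(1)[OF A] _ Mod_left_unit_inverse(2)[OF A]
            Mod_left_unit_inverse(1)[OF A]])
        (rule br[OF U A unit_elt_closed[OF H.one_closed]])
    show "RUnit A \<in> C.Iso (Ten A Unit) A"
      by (rule iso[OF T[OF A U] A rh(1)[OF A] _ Mod_right_unit_inverse(2)[OF A]
            Mod_right_unit_inverse(1)[OF A]])
        (rule br[OF A U _ unit_elt_closed[OF H.one_closed]])
  next
    fix A A' :: "('k, 'h, 'x) umodule" and f
    assume A: "lmod A" and A': "lmod A'" and f: "f \<in> left_module_maps k H A A'"
    note tl = th[OF U A U A' idh[OF U] f] and tr = th[OF A U A' U f idh[OF U]]
    have f_act: "f (act A h x) = act A' h (f x)" if "h \<in> carrier H" "x \<in> carrier A" for h x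
      by (rule left_module_mapsD(3)[OF f that])
    show "Mod_Comp (Ten Unit A) (Ten Unit A') A' (LUnit A')
        (TenMap Unit Unit A A' (Mod_Id Unit) f) =
      Mod_Comp (Ten Unit A) A A' f (LUnit A)"
    proof (rule Mod_tensor_hom_eqI[OF U A ch[OF T[OF U A] tl(1) lh(1)[OF A']]
          ch[OF T[OF U A] lh(1)[OF A] f]])
      fix x and \<phi> :: "('k, 'h, 'x) universe" assume \<phi>: "\<phi> \<in> carrier Unit" and x: "x \<in> carrier A"
      then obtain h where h: "h \<in> carrier H" "\<phi> = unit_elt h" by (auto simp: unit_elt_facts(2))
      show "Mod_Comp (Ten Unit A) (Ten Unit A') A' (LUnit A')
          (TenMap Unit Unit A A' (Mod_Id Unit) f) (bracket Unit A \<phi> x) =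
        Mod_Comp (Ten Unit A) A A' f (LUnit A) (bracket Unit A \<phi> x)"
        using \<phi> x h
        by (simp add: Mod_Comp_apply br[OF U A] tl(2) Mod_Id_apply lh(2)[OF A'] lh(2)[OF A] fc[OF f]
            f_act slice_closed)
    qed
    show "Mod_Comp (Ten A Unit) (Ten A' Unit) A' (RUnit A')
        (TenMap A A' Unit Unit f (Mod_Id Unit)) =
      Mod_Comp (Ten A Unit) A A' f (RUnit A)"
    proof (rule Mod_tensor_hom_eqI[OF A U ch[OF T[OF A U] tr(1) rh(1)[OF A']]
          ch[OF T[OF A U] rh(1)[OF A] f]])
      fix x and \<phi> :: "('k, 'h, 'x) universe" assume x: "x \<in> carrier A" and \<phi>: "\<phi> \<in> carrier Unit"
      then obtain h where h: "h \<in> carrier H" "\<phi> = unit_elt h" by (auto simp: unit_elt_facts(2))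
      show "Mod_Comp (Ten A Unit) (Ten A' Unit) A' (RUnit A')
          (TenMap A A' Unit Unit f (Mod_Id Unit)) (bracket A Unit x \<phi>) =
        Mod_Comp (Ten A Unit) A A' f (RUnit A) (bracket A Unit x \<phi>)"
        using \<phi> x h
        by (simp add: Mod_Comp_apply br[OF A U] tr(2) Mod_Id_apply rh(2)[OF A'] rh(2)[OF A] fc[OF f]
            f_act slice_closed)
    qed
  next
    fix A B C D :: "('k, 'h, 'x) umodule"
    assume A: "lmod A" and B: "lmod B" and C: "lmod C"
      and D: "lmod D"
    note AB = T[OF A B] and BC = T[OF B C] and CD = T[OF C D]
    note a1 = ah[OF AB C D] and a2 = ah[OF A B CD] and a3 = ah[OF A B C] and a4 = ah[OF A BC D]
      and a5 = ah[OF B C D]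
    note t1 = th[OF T[OF AB C] D T[OF A BC] D a3(1) idh[OF D]]
    note t2 = th[OF A T[OF BC D] A T[OF B CD] idh[OF A] a5(1)]
    note S = T[OF T[OF AB C] D]
    show "Mod_Comp (Ten (Ten (Ten A B) C) D) (Ten (Ten A B) (Ten C D)) (Ten A (Ten B (Ten C D)))
        (Assoc A B (Ten C D)) (Assoc (Ten A B) C D) =
      Mod_Comp (Ten (Ten (Ten A B) C) D) (Ten A (Ten (Ten B C) D)) (Ten A (Ten B (Ten C D)))
        (TenMap A A (Ten (Ten B C) D) (Ten B (Ten C D)) (Mod_Id A) (Assoc B C D))
        (Mod_Comp (Ten (Ten (Ten A B) C) D) (Ten (Ten A (Ten B C)) D) (Ten A (Ten (Ten B C) D))
          (Assoc A (Ten B C) D)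
          (TenMap (Ten (Ten A B) C) (Ten A (Ten B C)) D D (Assoc A B C) (Mod_Id D)))"
      by (rule Mod_tensor_hom_eqI4[OF A B C D ch[OF S a1(1) a2(1)] ch[OF S ch[OF S t1(1) a4(1)] t2(1)]])
        (simp add: Mod_Comp_apply Mod_Id_apply br[OF T[OF AB C] D] br[OF AB C] br[OF A B] br[OF C D]
          br[OF B C] br[OF BC D] a1(2) a2(2) a3(2) a4(2) a5(2) t1(2) t2(2))
  qed
qed

end
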